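(* Any (local) solution $(E,F,G)$ to the system $$\begin{array}{l} 2EF_u-FE_u-EE_v=0,\\ 2GF_v-FG_v-GG_u=0,\\ GE_u+EG_v-2F(F_u+F_v)+(3F-2G)E_v+(3F-2E)G_u=0,\end{array}$$ invariant with respect to the operator $X=u\partial_u+v\partial_v-2(E\partial_E+F\partial_F+G\partial_G)$, determines a metric $E\,du^2+2F\,du\,dv+G\,dv^2$ admitting a Killing vector field. The geodesic flow of the metric has a 4-dimensional space of cubic integrals.
   Context: Solutions are local and satisfy $E>0$, $EG-F^2>0$. A solution is invariant with respect to a vector field $X$ on $\mathbb R^5$ (with coordinates $u,v,E,F,G$) if $X$ is tangent to the surface $\{(u,v,E(u,v),F(u,v),G(u,v))\}\subset\mathbb R^5$. With momenta $(p,q)$ conjugate to $(u,v)$, the geodesic flow is the Hamiltonian flow of $H=\frac{Gp^2-2Fpq+Eq^2}{2(EG-F^2)}$. A cubic integral is a homogeneous polynomial of degree 3 in $(p,q)$ with coefficients smooth functions of $(u,v)$ (locally defined) which Poisson-commutes with $H$; cubic integrals form a real vector space.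
   Formalization: The space of all cubic integrals is shown to have dimension exactly 4 only when the curvature is nonconstant; some of these metrics have constant curvature, where that space is 10-dimensional. In every case a Killing field and a 4-dimensional linear space of cubic integrals are obtained. *)

theory Defs
  imports "HOL-Analysis.Analysis" "HOL-Library.Function_Algebras"
begin

type_synonym point = "real \<times> real"
type_synonym phase = "point \<times> point"

definition du :: "(point \<Rightarrow> real) \<Rightarrow> point \<Rightarrow> real" where
  "du f x = deriv (\<lambda>t. f (t, snd x)) (fst x)"

definition dv :: "(point \<Rightarrow> real) \<Rightarrow> point \<Rightarrow> real" where
  "dv f x = deriv (\<lambda>t. f (fst x, t)) (snd x)"

primrec Ck_on :: "nat \<Rightarrow> (point \<Rightarrow> real) \<Rightarrow> point set \<Rightarrow> bool" where
  "Ck_on 0 f U \<longleftrightarrow> continuous_on U f"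
| "Ck_on (Suc k) f U \<longleftrightarrow> f differentiable_on U \<and> Ck_on k (du f) U \<and> Ck_on k (dv f) U"

definition smooth_on :: "(point \<Rightarrow> real) \<Rightarrow> point set \<Rightarrow> bool" where
  "smooth_on f U \<longleftrightarrow> (\<forall>k. Ck_on k f U)"

definition is_metric :: "point set \<Rightarrow> (point \<Rightarrow> real) \<Rightarrow> (point \<Rightarrow> real) \<Rightarrow> (point \<Rightarrow> real) \<Rightarrow> bool" where
  "is_metric U E F G \<longleftrightarrow> smooth_on E U \<and> smooth_on F U \<and> smooth_on G U \<and>
     (\<forall>x\<in>U. E x > 0 \<and> E x * G x - (F x)\<^sup>2 > 0)"

definition solves_system :: "point set \<Rightarrow> (point \<Rightarrow> real) \<Rightarrow> (point \<Rightarrow> real) \<Rightarrow> (point \<Rightarrow> real) \<Rightarrow> bool" where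
  "solves_system U E F G \<longleftrightarrow> (\<forall>x\<in>U.
     2 * E x * du F x - F x * du E x - E x * dv E x = 0 \<and>
     2 * G x * dv F x - F x * dv G x - G x * du G x = 0 \<and>
     G x * du E x + E x * dv G x - 2 * F x * (du F x + dv F x)
       + (3 * F x - 2 * G x) * dv E x + (3 * F x - 2 * E x) * du G x = 0)"

type_synonym space5 = "real \<times> real \<times> real \<times> real \<times> real"

text \<open>The tangent plane of the surface \<open>{(u, v, E, F, G)}\<close> is spanned by the partial derivatives
  of its parametrization by \<open>(u, v)\<close>.\<close>

definition invariant_under ::
  "(space5 \<Rightarrow> space5) \<Rightarrow> point set \<Rightarrow> (point \<Rightarrow> real) \<Rightarrow> (point \<Rightarrow> real) \<Rightarrow> (point \<Rightarrow> real) \<Rightarrow> bool" where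
  "invariant_under X U E F G \<longleftrightarrow> (\<forall>x\<in>U.
     X (fst x, snd x, E x, F x, G x)
       \<in> span {(1, 0, du E x, du F x, du G x), (0, 1, dv E x, dv F x, dv G x)})"

definition scaling_field :: "space5 \<Rightarrow> space5" where
  "scaling_field = (\<lambda>(u, v, e, f, g). (u, v, -2 * e, -2 * f, -2 * g))"

text \<open>The three equations are the components of the Lie derivative of
  \<open>E du\<^sup>2 + 2 F du dv + G dv\<^sup>2\<close> along \<open>a \<partial>\<^sub>u + b \<partial>\<^sub>v\<close>. The zero field is excluded.\<close>

definition killing_field ::
  "point set \<Rightarrow> (point \<Rightarrow> real) \<Rightarrow> (point \<Rightarrow> real) \<Rightarrow> (point \<Rightarrow> real) \<Rightarrow>
   (point \<Rightarrow> real) \<Rightarrow> (point \<Rightarrow> real) \<Rightarrow> bool" where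
  "killing_field U E F G a b \<longleftrightarrow> smooth_on a U \<and> smooth_on b U \<and>
     (\<exists>x\<in>U. (a x, b x) \<noteq> (0, 0)) \<and>
     (\<forall>x\<in>U.
       a x * du E x + b x * dv E x + 2 * (E x * du a x + F x * du b x) = 0 \<and>
       a x * du F x + b x * dv F x + E x * dv a x + F x * dv b x + F x * du a x + G x * du b x = 0 \<and>
       a x * du G x + b x * dv G x + 2 * (F x * dv a x + G x * dv b x) = 0)"

definition hamiltonian :: "(point \<Rightarrow> real) \<Rightarrow> (point \<Rightarrow> real) \<Rightarrow> (point \<Rightarrow> real) \<Rightarrow> phase \<Rightarrow> real" where
  "hamiltonian E F G = (\<lambda>(x, (p, q)).
     (G x * p\<^sup>2 - 2 * F x * p * q + E x * q\<^sup>2) / (2 * (E x * G x - (F x)\<^sup>2)))"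

definition poisson :: "(phase \<Rightarrow> real) \<Rightarrow> (phase \<Rightarrow> real) \<Rightarrow> phase \<Rightarrow> real" where
  "poisson f g = (\<lambda>(x, y).
       du (\<lambda>y. f (x, y)) y * du (\<lambda>x. g (x, y)) x - du (\<lambda>x. f (x, y)) x * du (\<lambda>y. g (x, y)) y
     + dv (\<lambda>y. f (x, y)) y * dv (\<lambda>x. g (x, y)) x - dv (\<lambda>x. f (x, y)) x * dv (\<lambda>y. g (x, y)) y)"

text \<open>An integral is a function on \<open>U \<times> \<real>\<^sup>2\<close>; it is extended by zero to positions outside \<open>U\<close>,
  so that integrals agreeing over \<open>U\<close> are equal and linear dimension is not affected by junk values.\<close>

definition cubic_integrals ::
  "point set \<Rightarrow> (point \<Rightarrow> real) \<Rightarrow> (point \<Rightarrow> real) \<Rightarrow> (point \<Rightarrow> real) \<Rightarrow> (phase \<Rightarrow> real) set" where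
  "cubic_integrals U E F G = {I.
     (\<exists>a b c d. smooth_on a U \<and> smooth_on b U \<and> smooth_on c U \<and> smooth_on d U \<and>
        (\<forall>x\<in>U. \<forall>p q. I (x, (p, q)) = a x * p ^ 3 + b x * p\<^sup>2 * q + c x * p * q\<^sup>2 + d x * q ^ 3)) \<and>
     (\<forall>x\<in>U. \<forall>y. poisson (hamiltonian E F G) I (x, y) = 0) \<and>
     (\<forall>x y. x \<notin> U \<longrightarrow> I (x, y) = 0)}"

definition phase_scale :: "real \<Rightarrow> (phase \<Rightarrow> real) \<Rightarrow> phase \<Rightarrow> real" where
  "phase_scale c f = (\<lambda>z. c * f z)"

global_interpretation phase: vector_space phase_scale
  by unfold_locales (auto simp: phase_scale_def fun_eq_iff algebra_simps)

definition det3 :: "real \<times> real \<times> real \<Rightarrow> real \<times> real \<times> real \<Rightarrow> real \<times> real \<times> real \<Rightarrow> real" where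
  "det3 = (\<lambda>(a1, a2, a3) (b1, b2, b3) (c1, c2, c3).
     a1 * (b2 * c3 - b3 * c2) - a2 * (b1 * c3 - b3 * c1) + a3 * (b1 * c2 - b2 * c1))"

text \<open>Brioschi's formula.\<close>

definition gauss_curvature ::
  "(point \<Rightarrow> real) \<Rightarrow> (point \<Rightarrow> real) \<Rightarrow> (point \<Rightarrow> real) \<Rightarrow> point \<Rightarrow> real" where
  "gauss_curvature E F G x =
     (det3 (- dv (dv E) x / 2 + dv (du F) x - du (du G) x / 2, du E x / 2, du F x - dv E x / 2)
           (dv F x - du G x / 2, E x, F x)
           (dv G x / 2, F x, G x)
      - det3 (0, dv E x / 2, du G x / 2)
             (dv E x / 2, E x, F x)
             (du G x / 2, F x, G x)) / (E x * G x - (F x)\<^sup>2)\<^sup>2"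

text \<open>Some of the metrics considered have constant curvature. With \<open>T = (u + v)\<^sup>2 / (8 u v)\<close>, an example
  on \<open>{0 < u < v, T < 1}\<close> is the hyperbolic metric
  \<open>T \<omega>\<^sup>2 / (1 - T)\<^sup>2 + (du/u + dv/v)\<^sup>2 / (4 (1 - T))\<close>, where
  \<open>\<omega> = (du + dv) / (u + v) - (du/u + dv/v) / 2\<close>.
  Its space of cubic integrals has dimension 10, so the dimension is exactly 4 only in
  nonconstant curvature.\<close>

definition constant_curvature ::
  "point set \<Rightarrow> (point \<Rightarrow> real) \<Rightarrow> (point \<Rightarrow> real) \<Rightarrow> (point \<Rightarrow> real) \<Rightarrow> bool" where
  "constant_curvature U E F G \<longleftrightarrow> (\<exists>k. \<forall>x\<in>U. gauss_curvature E F G x = k)"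

end

theory Submission
  imports Defs "HOL-Computational_Algebra.Fundamental_Theorem_Algebra"
begin

text \<open>Invariance under scaling says that \<open>E\<close>, \<open>F\<close>, \<open>G\<close> are homogeneous of degree \<open>- 2\<close>, so
  \<open>u \<partial>\<^sub>u + v \<partial>\<^sub>v\<close> is a Killing field with linear integral \<open>k = u p + v q\<close>, and \<open>k\<^sup>3\<close> and \<open>2 H k\<close> are
  cubic integrals. The system says that the lines \<open>u = const\<close>, \<open>v = const\<close> and \<open>u + v = const\<close> are
  geodesics, which makes \<open>D u' v' (u' + v')\<close> a third integral, where \<open>D = E G - F\<^sup>2\<close>. Reflecting it in
  the lines orthogonal to the Killing field gives a fourth one. Both have nonzero weight, of opposite
  sign, under the Killing flow.

  For the upper bound, take coordinates \<open>(z, y)\<close> with \<open>\<partial>\<^sub>y\<close> the Killing field, let \<open>m\<close> be the reciprocal of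
  its squared length and \<open>M\<close> a primitive of \<open>m\<close>. A cubic integral with leading coefficient \<open>\<beta>\<close>
  yields for each \<open>y\<close> a relation \<open>3 \<beta> m\<^sup>2 + q m + q' M = S\<close> with polynomials \<open>q\<close> and \<open>S\<close> in \<open>z\<close> of degrees
  at most 2 and 4. If such a relation is not proportional to the one of the third integral, then \<open>M\<close> is
  a rational function, hence a polynomial of degree at most 3, hence the curvature is constant. If all
  relations are proportional, the integral is locally a combination of the four known ones. The
  combination extends to the whole domain because the relation also bounds the highest derivatives
  of the coefficients by the lower ones.\<close>

section \<open>Calculus of smooth functions\<close>

text \<open>In the coordinates (z, y) the metric is dz^2 / m^2 + dy^2 / m. The length of
  \<open>Z\<close> is chosen so that the Poisson bracket has the common factor \<open>m\<close> and
  otherwise contains only \<open>Z\<close>, \<open>Y\<close> and \<open>Z m\<close>. Four of its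
  five coefficients can then be integrated explicitly in z, and the fifth becomes the z-derivative
  of the polynomial relation. The curvature is m m'' / 2 - m'^2 / 4, hence constant for quadratic m;
  this is why a primitive of degree at most 3 is the exceptional case. Two obstacles shape the
  proof. One of the three geodesic families may be orthogonal to the Killing field. Then the leading
  coefficient of the third integral vanishes, the next one takes its place, and the arguments split
  into two cases; by connectedness only one of them occurs on all of \<open>U\<close>. Moreover
  \<open>U\<close> need not lie in one chart, and the coordinate along the Killing field is a priori
  not single-valued on it. So the fourth integral is built with a global function instead of an
  exponential, and the comparison with the four integrals is made in a single chart whose
  \<open>M\<close> is not a polynomial of degree at most 3.\<close>

lemma eventually_in_open_slices:
  fixes u v :: real
  assumes "open U" "(u, v) \<in> U"
  shows "eventually (\<lambda>t. (t, v) \<in> U) (nhds u)" "eventually (\<lambda>t. (u, t) \<in> U) (nhds v)"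
proof -
  have "((\<lambda>t. (t, v)) \<longlongrightarrow> (u, v)) (nhds u)" "((\<lambda>t. (u, t)) \<longlongrightarrow> (u, v)) (nhds v)"
    by (intro tendsto_Pair tendsto_const filterlim_ident)+
  then show "eventually (\<lambda>t. (t, v) \<in> U) (nhds u)" "eventually (\<lambda>t. (u, t) \<in> U) (nhds v)"
    using eventually_nhds_in_open[OF assms] by (auto dest: eventually_compose_filterlim)
qed

text \<open>Partial derivatives at a point of an open set depend only on the values along short
  slices, which stay inside the set; agreement on \<open>U\<close> therefore passes to
  \<open>du\<close> and \<open>dv\<close>.\<close>

lemma Ck_on_cong:
  assumes "open U" "\<And>x. x \<in> U \<Longrightarrow> f x = g x" "Ck_on k f U"
  shows "Ck_on k g U"
  using assms(2,3)
proof (induction k arbitrary: f g)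
  case 0
  then show ?case
    by (metis Ck_on.simps(1) continuous_on_cong)
next
  case (Suc k)
  have dfg: "du f x = du g x \<and> dv f x = dv g x" if "x \<in> U" for x
  proof -
    have x: "(fst x, snd x) \<in> U" using that by simp
    have "eventually (\<lambda>t. f (t, snd x) = g (t, snd x)) (nhds (fst x))"
      by (rule eventually_mono[OF eventually_in_open_slices(1)[OF assms(1) x]]) (rule Suc.prems)
    moreover have "eventually (\<lambda>t. f (fst x, t) = g (fst x, t)) (nhds (snd x))"
      by (rule eventually_mono[OF eventually_in_open_slices(2)[OF assms(1) x]]) (rule Suc.prems)
    ultimately show ?thesis
      unfolding du_def dv_def by (auto intro!: deriv_cong_ev)
  qed
  have "g differentiable_on U"
    unfolding differentiable_on_def
  proof
    fix x assume "x \<in> U"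
    then have "f differentiable (at x within U)"
      using Suc.prems(2) differentiable_on_def by auto
    then obtain f' where "(f has_derivative f') (at x within U)"
      using differentiable_def by blast
    then have "(g has_derivative f') (at x within U)"
      by (rule has_derivative_transform[rotated 2]) (use \<open>x \<in> U\<close> Suc.prems(1) in auto)
    then show "g differentiable (at x within U)" using differentiable_def by blast
  qed
  moreover have "Ck_on k (du g) U" "Ck_on k (dv g) U"
    using Suc.IH[of "du f" "du g"] Suc.IH[of "dv f" "dv g"] dfg Suc.prems(2) by auto
  ultimately show ?case by simp
qed

lemma smooth_on_imp_differentiable_on: "smooth_on f U \<Longrightarrow> f differentiable_on U"
  unfolding smooth_on_def by (metis Ck_on.simps(2))

lemma smooth_on_du: "smooth_on f U \<Longrightarrow> smooth_on (du f) U"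
  unfolding smooth_on_def by (metis Ck_on.simps(2))

lemma smooth_on_dv: "smooth_on f U \<Longrightarrow> smooth_on (dv f) U"
  unfolding smooth_on_def by (metis Ck_on.simps(2))

text \<open>Smoothness is the largest property that implies differentiability and is stable under
  both partials. The partials have to satisfy \<open>P\<close> only up to equality on
  \<open>U\<close>, since their values elsewhere are arbitrary.\<close>

lemma smooth_on_coinduct:
  assumes "open U" and "P f"
    and step: "\<And>f. P f \<Longrightarrow> f differentiable_on U \<and>
      (\<exists>g h. P g \<and> P h \<and> (\<forall>x\<in>U. du f x = g x \<and> dv f x = h x))"
  shows "smooth_on f U"
proof -
  have "Ck_on k f U" if "P f" for k f
    using that
  proof (induction k arbitrary: f)
    case 0
    then show ?case using step differentiable_imp_continuous_on by auto
  next
    case (Suc k)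
    obtain g h where "P g" "P h" "\<forall>x\<in>U. du f x = g x \<and> dv f x = h x"
      using step[OF Suc.prems] by blast
    then have "Ck_on k (du f) U" "Ck_on k (dv f) U"
      using Suc.IH[of g] Suc.IH[of h] Ck_on_cong[OF assms(1)] by metis+
    then show ?case using step[OF Suc.prems] by simp
  qed
  then show ?thesis using assms(2) unfolding smooth_on_def by blast
qed

lemma has_derivative_imp_partials:
  assumes "(f has_derivative (\<lambda>h. fst h * a + snd h * b)) (at x)"
  shows "((\<lambda>t. f (t, snd x)) has_real_derivative a) (at (fst x))"
    and "((\<lambda>t. f (fst x, t)) has_real_derivative b) (at (snd x))"
proof -
  have "((\<lambda>t. (t, snd x)) has_derivative (\<lambda>h. (h, 0))) (at (fst x))"
    by (auto intro!: derivative_eq_intros)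
  from has_derivative_compose[OF this, of f "(\<lambda>h. fst h * a + snd h * b)"] assms
  show "((\<lambda>t. f (t, snd x)) has_real_derivative a) (at (fst x))"
    by (simp add: has_field_derivative_def mult_commute_abs)
  have "((\<lambda>t. (fst x, t)) has_derivative (\<lambda>h. (0, h))) (at (snd x))"
    by (auto intro!: derivative_eq_intros)
  from has_derivative_compose[OF this, of f "(\<lambda>h. fst h * a + snd h * b)"] assms
  show "((\<lambda>t. f (fst x, t)) has_real_derivative b) (at (snd x))"
    by (simp add: has_field_derivative_def mult_commute_abs)
qed

lemma has_derivative_du_dv_eq:
  assumes "(f has_derivative (\<lambda>h. fst h * a + snd h * b)) (at x)"
  shows "du f x = a" "dv f x = b"
  using has_derivative_imp_partials[OF assms] unfolding du_def dv_def
  by (auto intro: DERIV_imp_deriv)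

lemma differentiable_has_derivative_du_dv:
  assumes "f differentiable (at x)"
  shows "(f has_derivative (\<lambda>h. fst h * du f x + snd h * dv f x)) (at x)"
proof -
  obtain f' where f': "(f has_derivative f') (at x)"
    using assms differentiable_def by blast
  interpret bounded_linear f' using f' has_derivative_bounded_linear by blast
  have eq: "f' = (\<lambda>h. fst h * f' (1, 0) + snd h * f' (0, 1))"
  proof
    fix h :: point
    have "h = fst h *\<^sub>R (1, 0) + snd h *\<^sub>R (0, 1)" by (simp add: prod_eq_iff)
    then have "f' h = f' (fst h *\<^sub>R (1, 0) + snd h *\<^sub>R (0, 1))" by simp
    also have "\<dots> = fst h * f' (1, 0) + snd h * f' (0, 1)"
      by (simp only: add scaleR) simp
    finally show "f' h = fst h * f' (1, 0) + snd h * f' (0, 1)" .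
  qed
  have "(f has_derivative (\<lambda>h. fst h * f' (1, 0) + snd h * f' (0, 1))) (at x)"
    using f' eq by simp
  with has_derivative_du_dv_eq[OF this] show ?thesis by simp
qed

lemma smooth_on_has_derivative:
  assumes "open U" "smooth_on f U" "x \<in> U"
  shows "(f has_derivative (\<lambda>h. fst h * du f x + snd h * dv f x)) (at x)"
  using assms smooth_on_imp_differentiable_on differentiable_on_eq_differentiable_at
    differentiable_has_derivative_du_dv by blast

lemma smooth_on_partials:
  assumes "open U" "smooth_on f U" "(u, v) \<in> U"
  shows "((\<lambda>t. f (t, v)) has_real_derivative du f (u, v)) (at u)"
    and "((\<lambda>t. f (u, t)) has_real_derivative dv f (u, v)) (at v)"
  using has_derivative_imp_partials[OF smooth_on_has_derivative[OF assms]] by auto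

lemma smooth_on_continuous_on: "smooth_on f U \<Longrightarrow> continuous_on U f"
  by (simp add: differentiable_imp_continuous_on smooth_on_imp_differentiable_on)

text \<open>The closure of the smooth functions under algebraic operations is closed under the partial
  derivatives, so coinduction gives all closure properties of \<open>smooth_on\<close> simultaneously.\<close>

inductive smooth_closure :: "point set \<Rightarrow> (point \<Rightarrow> real) \<Rightarrow> bool" for U where
  base: "smooth_on f U \<Longrightarrow> smooth_closure U f"
| const: "smooth_closure U (\<lambda>_. c)"
| coord1: "smooth_closure U fst"
| coord2: "smooth_closure U snd"
| add: "smooth_closure U f \<Longrightarrow> smooth_closure U g \<Longrightarrow> smooth_closure U (\<lambda>x. f x + g x)"
| mult: "smooth_closure U f \<Longrightarrow> smooth_closure U g \<Longrightarrow> smooth_closure U (\<lambda>x. f x * g x)"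
| inverse: "smooth_closure U f \<Longrightarrow> \<forall>x\<in>U. f x \<noteq> 0 \<Longrightarrow> smooth_closure U (\<lambda>x. inverse (f x))"
| sqrt: "smooth_closure U f \<Longrightarrow> \<forall>x\<in>U. f x > 0 \<Longrightarrow> smooth_closure U (\<lambda>x. sqrt (f x))"

lemma smooth_closure_step:
  assumes "open U" "smooth_closure U f"
  shows "\<exists>g h. smooth_closure U g \<and> smooth_closure U h \<and>
    (\<forall>x\<in>U. (f has_derivative (\<lambda>d. fst d * g x + snd d * h x)) (at x))"
  using assms(2)
proof induction
  case (base f)
  then show ?case
    by (intro exI[of _ "du f"] exI[of _ "dv f"] conjI ballI smooth_closure.base smooth_on_du
        smooth_on_dv smooth_on_has_derivative[OF assms(1)])
next
  case (const c)
  show ?case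
    by (rule exI[of _ "\<lambda>_. 0"], rule exI[of _ "\<lambda>_. 0"]) (auto intro: smooth_closure.const)
next
  case coord1
  show ?case
    by (rule exI[of _ "\<lambda>_. 1"], rule exI[of _ "\<lambda>_. 0"])
      (auto intro!: smooth_closure.const derivative_eq_intros)
next
  case coord2
  show ?case
    by (rule exI[of _ "\<lambda>_. 0"], rule exI[of _ "\<lambda>_. 1"])
      (auto intro!: smooth_closure.const derivative_eq_intros)
next
  case (add f1 f2)
  from add.IH(1) obtain g1 h1 where 1: "smooth_closure U g1" "smooth_closure U h1"
    "\<forall>x\<in>U. (f1 has_derivative (\<lambda>d. fst d * g1 x + snd d * h1 x)) (at x)" by (elim exE conjE)
  from add.IH(2) obtain g2 h2 where 2: "smooth_closure U g2" "smooth_closure U h2"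
    "\<forall>x\<in>U. (f2 has_derivative (\<lambda>d. fst d * g2 x + snd d * h2 x)) (at x)" by (elim exE conjE)
  note d = 1(3)[rule_format] 2(3)[rule_format]
  have "((\<lambda>x. f1 x + f2 x) has_derivative
      (\<lambda>d. fst d * (g1 x + g2 x) + snd d * (h1 x + h2 x))) (at x)" if "x \<in> U" for x
    by (rule has_derivative_eq_rhs[OF has_derivative_add[OF d(1)[OF that] d(2)[OF that]]])
      (simp add: algebra_simps)
  note der = this
  have "smooth_closure U (\<lambda>x. g1 x + g2 x)" "smooth_closure U (\<lambda>x. h1 x + h2 x)"
    by (intro smooth_closure.add smooth_closure.mult smooth_closure.inverse smooth_closure.const 1 2)+
  then show ?case using der by (intro exI conjI ballI)
next
  case (mult f1 f2)
  from mult.IH(1) obtain g1 h1 where 1: "smooth_closure U g1" "smooth_closure U h1"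
    "\<forall>x\<in>U. (f1 has_derivative (\<lambda>d. fst d * g1 x + snd d * h1 x)) (at x)" by (elim exE conjE)
  from mult.IH(2) obtain g2 h2 where 2: "smooth_closure U g2" "smooth_closure U h2"
    "\<forall>x\<in>U. (f2 has_derivative (\<lambda>d. fst d * g2 x + snd d * h2 x)) (at x)" by (elim exE conjE)
  note d = 1(3)[rule_format] 2(3)[rule_format]
  have "((\<lambda>x. f1 x * f2 x) has_derivative
      (\<lambda>d. fst d * (g1 x * f2 x + f1 x * g2 x) + snd d * (h1 x * f2 x + f1 x * h2 x))) (at x)"
    if "x \<in> U" for x
    by (rule has_derivative_eq_rhs[OF has_derivative_mult[OF d(1)[OF that] d(2)[OF that]]])
      (simp add: algebra_simps)
  note der = this
  have "smooth_closure U (\<lambda>x. g1 x * f2 x + f1 x * g2 x)" "smooth_closure U (\<lambda>x. h1 x * f2 x + f1 x * h2 x)"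
    by (intro smooth_closure.add smooth_closure.mult smooth_closure.inverse smooth_closure.const 1 2 mult.hyps)+
  then show ?case using der by (intro exI conjI ballI)
next
  case (inverse f)
  from inverse.IH obtain g h where *: "smooth_closure U g" "smooth_closure U h"
    and "\<forall>x\<in>U. (f has_derivative (\<lambda>d. fst d * g x + snd d * h x)) (at x)" by (elim exE conjE)
  note d = this(3)[rule_format]
  \<comment> \<open>The derivative is spelled with the operations of the closure: negation is
    multiplication by -1, division is multiplication by an inverse.\<close>
  have "((\<lambda>x. inverse (f x)) has_derivative
      (\<lambda>d. fst d * (((-1) * g x) * (inverse (f x) * inverse (f x)))
        + snd d * (((-1) * h x) * (inverse (f x) * inverse (f x))))) (at x)"
    if "x \<in> U" for x
    by (rule has_derivative_eq_rhs[OF Deriv.has_derivative_inverse[OF _ d[OF that]]])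
      (use inverse.hyps that in \<open>auto simp: algebra_simps\<close>)
  note der = this
  have "smooth_closure U (\<lambda>x. ((-1) * g x) * (inverse (f x) * inverse (f x)))" "smooth_closure U (\<lambda>x. ((-1) * h x) * (inverse (f x) * inverse (f x)))"
    by (intro smooth_closure.add smooth_closure.mult smooth_closure.inverse smooth_closure.const * inverse.hyps)+
  then show ?case using der by (intro exI conjI ballI)
next
  case (sqrt f)
  from sqrt.IH obtain g h where *: "smooth_closure U g" "smooth_closure U h"
    and "\<forall>x\<in>U. (f has_derivative (\<lambda>d. fst d * g x + snd d * h x)) (at x)" by (elim exE conjE)
  note d = this(3)[rule_format]
  have i: "smooth_closure U (\<lambda>x. inverse (sqrt (f x)))"
    using sqrt.hyps by (intro smooth_closure.inverse smooth_closure.sqrt) auto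
  have "((\<lambda>x. sqrt (f x)) has_derivative
      (\<lambda>d. fst d * (g x * (inverse (sqrt (f x)) * (1/2)))
        + snd d * (h x * (inverse (sqrt (f x)) * (1/2))))) (at x)"
    if "x \<in> U" for x
    by (rule has_derivative_eq_rhs[OF has_derivative_real_sqrt[OF _ d[OF that]]])
      (use sqrt.hyps that in \<open>auto simp: field_simps\<close>)
  note der = this
  have "smooth_closure U (\<lambda>x. g x * (inverse (sqrt (f x)) * (1/2)))" "smooth_closure U (\<lambda>x. h x * (inverse (sqrt (f x)) * (1/2)))"
    by (intro smooth_closure.add smooth_closure.mult smooth_closure.inverse smooth_closure.const * i)+
  then show ?case using der by (intro exI conjI ballI)
qed

lemma smooth_closure_imp_smooth_on:
  assumes "open U" "smooth_closure U f"
  shows "smooth_on f U"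
proof (rule smooth_on_coinduct[where P="smooth_closure U", OF assms])
  fix f assume "smooth_closure U f"
  from smooth_closure_step[OF assms(1) this] obtain g h where
    *: "smooth_closure U g" "smooth_closure U h"
    "\<forall>x\<in>U. (f has_derivative (\<lambda>d. fst d * g x + snd d * h x)) (at x)" by blast
  then have "\<forall>x\<in>U. du f x = g x \<and> dv f x = h x"
    using has_derivative_du_dv_eq[OF *(3)[rule_format]] by auto
  moreover have "f differentiable_on U"
    unfolding differentiable_on_eq_differentiable_at[OF assms(1)]
    using differentiableI[OF *(3)[rule_format]] by auto
  ultimately show "f differentiable_on U \<and>
      (\<exists>g h. smooth_closure U g \<and> smooth_closure U h \<and> (\<forall>x\<in>U. du f x = g x \<and> dv f x = h x))"
    using * by auto
qed

context
  fixes U :: "point set"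
  assumes U: "open U"
begin

lemma smooth_on_const: "smooth_on (\<lambda>_. c) U"
  and smooth_on_fst: "smooth_on fst U"
  and smooth_on_snd: "smooth_on snd U"
  by (simp_all add: smooth_closure_imp_smooth_on[OF U] smooth_closure.intros)

lemma smooth_on_add: "smooth_on f U \<Longrightarrow> smooth_on g U \<Longrightarrow> smooth_on (\<lambda>x. f x + g x) U"
  and smooth_on_mult: "smooth_on f U \<Longrightarrow> smooth_on g U \<Longrightarrow> smooth_on (\<lambda>x. f x * g x) U"
  by (simp_all add: smooth_closure_imp_smooth_on[OF U] smooth_closure.intros)

lemma smooth_on_uminus: "smooth_on f U \<Longrightarrow> smooth_on (\<lambda>x. - f x) U"
  using smooth_on_mult[OF smooth_on_const[of "-1"]] by simp

lemma smooth_on_diff: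
  "smooth_on f U \<Longrightarrow> smooth_on g U \<Longrightarrow> smooth_on (\<lambda>x. f x - g x) U"
  using smooth_on_add[OF _ smooth_on_uminus] by simp

lemma smooth_on_power: "smooth_on f U \<Longrightarrow> smooth_on (\<lambda>x. f x ^ k) U"
proof (induction k)
  case 0
  then show ?case using smooth_on_const by simp
next
  case (Suc k)
  then show ?case using smooth_on_mult[OF Suc.prems Suc.IH] by simp
qed

lemma smooth_on_divide:
  "smooth_on f U \<Longrightarrow> smooth_on g U \<Longrightarrow> \<forall>x\<in>U. g x \<noteq> 0 \<Longrightarrow> smooth_on (\<lambda>x. f x / g x) U"
  unfolding divide_inverse
  by (rule smooth_closure_imp_smooth_on[OF U smooth_closure.mult[OF smooth_closure.base
          smooth_closure.inverse[OF smooth_closure.base]]])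

lemma smooth_on_sqrt:
  "smooth_on f U \<Longrightarrow> \<forall>x\<in>U. f x > 0 \<Longrightarrow> smooth_on (\<lambda>x. sqrt (f x)) U"
  by (rule smooth_closure_imp_smooth_on[OF U smooth_closure.sqrt[OF smooth_closure.base]])

end

section \<open>Polynomial relations for a primitive\<close>

lemma DERIV_unique_on_interval:
  assumes "\<And>y. \<bar>y\<bar> < d \<Longrightarrow> f y = g y" "\<bar>y\<bar> < (d::real)"
    "(f has_real_derivative a) (at y)" "(g has_real_derivative b) (at y)"
  shows "a = b"
proof -
  have "eventually (\<lambda>x. x \<in> {-d<..<d}) (nhds y)"
    using assms(2) by (intro eventually_nhds_in_open) (auto simp: abs_less_iff)
  then have "eventually (\<lambda>x. f x = g x) (nhds y)"
    by (rule eventually_mono) (use assms(1) in \<open>simp add: abs_less_iff\<close>)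
  from DERIV_cong_ev[OF refl this refl] assms(3) have "(g has_real_derivative a) (at y)" by blast
  from DERIV_unique[OF this assms(4)] show ?thesis .
qed

text \<open>The arguments are real but the field is generic: the pole argument compares complex
  polynomials, the degree arguments real ones.\<close>

lemma poly_eq_if_eq_on_interval:
  fixes p q :: "'a::{real_algebra_1,idom,real_normed_field} poly"
  assumes "d > 0" "\<And>z. \<bar>z\<bar> < d \<Longrightarrow> poly p (of_real z) = poly q (of_real z)"
  shows "p = q"
proof (rule ccontr)
  assume "p \<noteq> q"
  then have "finite {z. poly (p - q) z = 0}" by (intro poly_roots_finite) simp
  moreover have "of_real ` {-d<..<d} \<subseteq> {z. poly (p - q) z = 0}"
  proof (rule image_subsetI)
    fix z assume "z \<in> {-d<..<d}"
    then have "\<bar>z\<bar> < d" by (simp add: abs_less_iff)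
    then show "of_real z \<in> {z. poly (p - q) z = 0}" using assms(2)[of z] by simp
  qed
  ultimately have "finite (of_real ` {-d<..<d} :: 'a set)" by (rule finite_subset[rotated])
  then have "finite {-d<..<d}" by (rule finite_imageD) (simp add: inj_on_def)
  moreover have "infinite {-d<..<d}" by (rule infinite_Ioo) (use assms(1) in simp)
  ultimately show False by contradiction
qed

text \<open>Serves to cancel a common linear factor of two polynomials: the cancelled identity holds
  off the root, and continuity supplies the root itself.\<close>

lemma isCont_eq_zero_if_zero_off_point:
  fixes f :: "real \<Rightarrow> 'a::real_normed_vector"
  assumes "isCont f z" "eventually (\<lambda>x. f x = 0) (at z)"
  shows "f z = 0"
proof -
  have "(f \<longlongrightarrow> 0) (at z)" by (rule tendsto_eventually[OF assms(2)])
  with assms(1) show ?thesis unfolding isCont_def using LIM_unique by blast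
qed

lemma poly_antiderivative:
  fixes T :: "real poly"
  shows "\<exists>P. pderiv P = T \<and> degree P \<le> Suc (degree T)"
proof -
  let ?P = "\<Sum>i\<le>degree T. monom (coeff T i / real (Suc i)) (Suc i)"
  have "pderiv ?P = (\<Sum>i\<le>degree T. monom (coeff T i) i)"
    using higher_pderiv_sum[of 1 "\<lambda>i. monom (coeff T i / real (Suc i)) (Suc i)" "{..degree T}"]
    by (simp add: pderiv_monom del: of_nat_Suc)
  moreover have "degree ?P \<le> Suc (degree T)"
    by (intro degree_sum_le) (auto intro: order_trans[OF degree_monom_le])
  ultimately show ?thesis by (metis poly_as_sum_of_monoms)
qed

lemma primitive_eq_poly:
  fixes T :: "real poly"
  assumes "d > 0" "\<And>z. \<bar>z\<bar> < d \<Longrightarrow> (f has_real_derivative poly T z) (at z)"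
  shows "\<exists>P. degree P \<le> Suc (degree T) \<and> (\<forall>z. \<bar>z\<bar> < d \<longrightarrow> f z = poly P z)"
proof -
  obtain P where P: "pderiv P = T" "degree P \<le> Suc (degree T)" using poly_antiderivative by blast
  let ?c = "f 0 - poly P 0"
  have "f z = poly (P + [:?c:]) z" if "\<bar>z\<bar> < d" for z
  proof -
    have "((\<lambda>z. f z - poly P z) has_real_derivative 0) (at x)" if "x \<in> {-d<..<d}" for x
      using that P(1) by (auto intro!: derivative_eq_intros assms(2) simp: abs_less_iff)
    then have "\<exists>c. \<forall>x\<in>{-d<..<d}. f x - poly P x = c"
      by (intro has_field_derivative_zero_constant) (auto simp: has_field_derivative_at_within)
    then obtain c where "\<forall>x\<in>{-d<..<d}. f x - poly P x = c" by blast
    with that assms(1) show ?thesis by (auto simp: abs_less_iff algebra_simps)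
  qed
  moreover have "degree (P + [:?c:]) \<le> Suc (degree T)"
    by (rule degree_add_le) (use P in auto)
  ultimately show ?thesis by blast
qed

lemma poly_map_poly_Re: "poly (map_poly Re p) z = Re (poly p (of_real z))"
  by (induction p) (simp_all add: map_poly_pCons)

text \<open>A pole of \<open>M\<close> would be of higher order in the square of \<open>M'\<close> than in the other terms of the
  relation. Poles may be complex, so \<open>M = P/Q\<close> is written with complex polynomials.\<close>

lemma rational_primitive_is_poly:
  fixes M m :: "real \<Rightarrow> real" and P0 Q0 q S :: "complex poly"
  assumes d: "d > 0" and der: "\<And>z. \<bar>z\<bar> < d \<Longrightarrow> (M has_real_derivative m z) (at z)"
    and rat: "\<And>z. \<bar>z\<bar> < d \<Longrightarrow> poly Q0 (of_real z) * of_real (M z) = poly P0 (of_real z)" "Q0 \<noteq> 0"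
    and rel: "\<And>z. \<bar>z\<bar> < d \<Longrightarrow>
      b * (of_real (m z))\<^sup>2 + poly q (of_real z) * of_real (m z) + poly q' (of_real z) * of_real (M z)
        = poly S (of_real z)"
    and b: "b \<noteq> 0"
  shows "\<exists>A::real poly. \<forall>z. \<bar>z\<bar> < d \<longrightarrow> M z = poly A z"
proof -
  \<comment> \<open>The denominators of \<open>M\<close>. One of least degree plays the part of the
    reduced fraction.\<close>
  define den where "den Q \<longleftrightarrow> Q \<noteq> 0 \<and>
    (\<exists>P. \<forall>z. \<bar>z\<bar> < d \<longrightarrow> poly Q (of_real z) * of_real (M z) = poly P (of_real z))" for Q :: "complex poly"
  have denI: "den Q" if "Q \<noteq> 0" "\<And>z. \<bar>z\<bar> < d \<Longrightarrow> poly Q (of_real z) * of_real (M z) = poly P (of_real z)" for Q P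
    unfolding den_def using that by auto
  have "den Q0" by (rule denI[OF rat(2,1)])
  then have "\<exists>Q. den Q \<and> (\<forall>Q'. den Q' \<longrightarrow> degree Q \<le> degree Q')" by (rule ex_has_least_nat)
  then obtain Q where Q: "den Q" "\<forall>Q'. den Q' \<longrightarrow> degree Q \<le> degree Q'" by (elim exE conjE)
  then obtain P where QM: "\<forall>z. \<bar>z\<bar> < d \<longrightarrow> poly Q (of_real z) * of_real (M z) = poly P (of_real z)"
    and Q0: "Q \<noteq> 0" unfolding den_def by (elim exE conjE)
  note QM = QM[rule_format]
  have contM: "isCont M z" if "\<bar>z\<bar> < d" for z using der[OF that] by (rule DERIV_isCont)
  have near: "eventually (\<lambda>x. \<bar>x\<bar> < d) (nhds z)" if "\<bar>z\<bar> < d" for z :: real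
  proof -
    have "eventually (\<lambda>x. x \<in> {-d<..<d}) (nhds z)"
      using that by (intro eventually_nhds_in_open) (auto simp: abs_less_iff)
    then show ?thesis by (rule eventually_mono) (simp add: abs_less_iff)
  qed
  \<comment> \<open>By the quotient rule, \<open>m\<close> is \<open>W / Q^2\<close>.\<close>
  define W where "W = pderiv P * Q - P * pderiv Q"
  have W: "(poly Q (of_real z))\<^sup>2 * of_real (m z) = poly W (of_real z)" if z: "\<bar>z\<bar> < d" for z
  proof -
    have "((\<lambda>z. of_real (M z) :: complex) has_vector_derivative of_real (m z)) (at z)"
      using has_vector_derivative_of_real[OF der[OF z]] .
    moreover have dp: "((\<lambda>z. poly p (of_real z :: complex)) has_vector_derivative poly (pderiv p) (of_real z)) (at z)" for p
      by (rule has_vector_derivative_real_field[OF poly_DERIV])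
    ultimately have 1: "((\<lambda>z. poly Q (of_real z) * of_real (M z)) has_vector_derivative
        poly Q (of_real z) * of_real (m z) + poly (pderiv Q) (of_real z) * of_real (M z)) (at z)"
      using has_vector_derivative_mult by blast
    have "((\<lambda>z. poly Q (of_real z) * of_real (M z)) has_vector_derivative poly (pderiv P) (of_real z)) (at z)"
      by (rule has_vector_derivative_transform_within_open[OF dp[of P] open_greaterThanLessThan[of "-d" d]])
        (use z QM in \<open>auto simp: abs_less_iff\<close>)
    from vector_derivative_unique_at[OF 1 this]
    have e: "poly Q (of_real z) * of_real (m z) + poly (pderiv Q) (of_real z) * of_real (M z)
      = poly (pderiv P) (of_real z)" .
    have "(poly Q (of_real z))\<^sup>2 * of_real (m z)
        = poly Q (of_real z) * (poly Q (of_real z) * of_real (m z) + poly (pderiv Q) (of_real z) * of_real (M z))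
          - poly (pderiv Q) (of_real z) * (poly Q (of_real z) * of_real (M z))"
      by (simp add: algebra_simps power2_eq_square)
    then show ?thesis unfolding e QM[OF z] by (simp add: W_def algebra_simps)
  qed
  \<comment> \<open>This is the relation multiplied by the fourth power of \<open>Q\<close>.\<close>
  have id: "smult b (W\<^sup>2) = Q\<^sup>2 * (S * Q\<^sup>2 - q * W - q' * P * Q)"
  proof (rule poly_eq_if_eq_on_interval[OF d])
    fix z assume z: "\<bar>z\<bar> < d"
    let ?z = "of_real z :: complex" and ?m = "of_real (m z) :: complex" and ?M = "of_real (M z) :: complex"
    have "(poly Q ?z)^4 * (b * ?m\<^sup>2 + poly q ?z * ?m + poly q' ?z * ?M)
      = b * ((poly Q ?z)\<^sup>2 * ?m)\<^sup>2 + poly q ?z * (poly Q ?z)\<^sup>2 * ((poly Q ?z)\<^sup>2 * ?m)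
        + poly q' ?z * (poly Q ?z)^3 * (poly Q ?z * ?M)"
      by (simp add: algebra_simps power2_eq_square power3_eq_cube power4_eq_xxxx)
    then have "(poly Q ?z)^4 * poly S ?z = b * (poly W ?z)\<^sup>2 + poly q ?z * (poly Q ?z)\<^sup>2 * poly W ?z
        + poly q' ?z * (poly Q ?z)^3 * poly P ?z"
      by (simp only: rel[OF z] W[OF z] QM[OF z])
    then show "poly (smult b (W\<^sup>2)) ?z = poly (Q\<^sup>2 * (S * Q\<^sup>2 - q * W - q' * P * Q)) ?z"
      by (simp add: algebra_simps power2_eq_square power3_eq_cube power4_eq_xxxx)
  qed
  have "degree Q = 0"
  proof (rule ccontr)
    assume dQ: "degree Q \<noteq> 0"
    then obtain a where a: "poly Q a = 0"
      using fundamental_theorem_of_algebra[of Q] by (metis constant_degree)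
    \<comment> \<open>Otherwise the factor x - a cancels, against the minimality of
      \<open>Q\<close>.\<close>
    have Pa: "poly P a \<noteq> 0"
    proof
      assume "poly P a = 0"
      then obtain P1 where P1: "P = [:-a, 1:] * P1" by (metis poly_eq_0_iff_dvd dvdE)
      obtain Q1 where Q1: "Q = [:-a, 1:] * Q1" using a by (metis poly_eq_0_iff_dvd dvdE)
      have "poly Q1 (of_real z) * of_real (M z) = poly P1 (of_real z)" if z: "\<bar>z\<bar> < d" for z
      proof -
        let ?f = "\<lambda>z. poly Q1 (of_real z) * of_real (M z) - poly P1 (of_real z)"
        have off: "?f x = 0" if "\<bar>x\<bar> < d" "of_real x \<noteq> a" for x
        proof -
          have "(of_real x - a) * ?f x = 0" using QM[OF that(1)] by (simp add: P1 Q1 algebra_simps)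
          then show ?thesis using that(2) by simp
        qed
        have "isCont ?f z" by (intro continuous_intros contM z)
        moreover have "eventually (\<lambda>x. ?f x = 0) (at z)"
        proof -
          have "eventually (\<lambda>x. of_real x \<noteq> a) (at z)"
          proof (cases "of_real z = a")
            case True
            then show ?thesis by (auto simp: eventually_at_filter)
          next
            case False
            have "((\<lambda>x. of_real x :: complex) \<longlongrightarrow> of_real z) (at z)" by (intro tendsto_intros)
            from tendsto_imp_eventually_ne[OF this False] show ?thesis .
          qed
          moreover have "eventually (\<lambda>x. \<bar>x\<bar> < d) (at z)"
            using near[OF z] by (simp add: eventually_nhds_conv_at)
          ultimately show ?thesis by eventually_elim (rule off)
        qed
        ultimately have "?f z = 0" by (rule isCont_eq_zero_if_zero_off_point)
        then show ?thesis by simp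
      qed
      moreover have "Q1 \<noteq> 0" using Q0 Q1 by auto
      ultimately have "den Q1" using denI by metis
      then have "degree Q \<le> degree Q1" using Q(2) by (elim allE impE)
      moreover have "degree Q = Suc (degree Q1)"
        unfolding Q1 using \<open>Q1 \<noteq> 0\<close> by (subst degree_mult_eq) auto
      ultimately show False by simp
    qed
    define n where "n = order a Q"
    have n0: "n \<noteq> 0" using a Q0 by (simp add: n_def order_root)
    have pQ: "pderiv Q \<noteq> 0" using dQ by (simp add: pderiv_eq_0_iff)
    have ord: "n = Suc (order a (pderiv Q))"
      using order_pderiv[OF Q0, of a] n0 a unfolding n_def by simp
    \<comment> \<open>By \<open>id\<close> the square of \<open>W\<close> is divisible by
      \<open>Q^2\<close>, so \<open>W\<close> vanishes at \<open>a\<close> to order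
      \<open>n\<close>. Then so does \<open>P * pderiv Q\<close>, although \<open>pderiv Q\<close>
      has order n - 1 and \<open>P\<close> has order 0 there.\<close>
    have "[:-a, 1:] ^ n dvd W"
    proof (cases "W = 0")
      case False
      have "[:-a, 1:] ^ (2 * n) dvd Q\<^sup>2"
        using dvd_power_same[OF order_1[of a Q], of 2] unfolding n_def
        by (simp add: mult.commute flip: power_mult)
      then have "[:-a, 1:] ^ (2 * n) dvd smult b (W\<^sup>2)" unfolding id by (rule dvd_mult2)
      then have "[:-a, 1:] ^ (2 * n) dvd W * W" using b by (simp add: dvd_smult_iff power2_eq_square)
      then have "2 * n \<le> order a (W * W)" using False by (simp add: order_divides)
      then have "n \<le> order a W" using False by (simp add: order_mult)
      then show ?thesis using False by (simp add: order_divides)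
    qed simp
    moreover have "[:-a, 1:] ^ n dvd pderiv P * Q"
      using order_1[of a Q] unfolding n_def by (rule dvd_mult)
    ultimately have "[:-a, 1:] ^ n dvd P * pderiv Q"
      using dvd_diff[of "[:-a, 1:] ^ n" "pderiv P * Q" W] by (simp add: W_def)
    moreover have P0: "P \<noteq> 0" using Pa by auto
    ultimately have "n \<le> order a (P * pderiv Q)" using pQ by (simp add: order_divides)
    also have "\<dots> = order a (pderiv Q)"
      using P0 pQ Pa by (simp add: order_mult order_0I)
    finally show False using ord by simp
  qed
  then obtain c where c: "Q = [:c:]" "c \<noteq> 0" using Q0 by (metis degree_eq_zeroE pCons_0_0)
  \<comment> \<open>The values of \<open>M\<close> are real, so the coefficients may be replaced by
    their real parts.\<close>
  have "M z = poly (map_poly Re (smult (1 / c) P)) z" if "\<bar>z\<bar> < d" for z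
  proof -
    have "of_real (M z) = poly (smult (1 / c) P) (of_real z)"
      using QM[OF that] c by (simp flip: QM[OF that])
    then show ?thesis unfolding poly_map_poly_Re by (metis Re_complex_of_real)
  qed
  then show ?thesis by blast
qed

lemma rational_primitive_is_cubic:
  fixes M m :: "real \<Rightarrow> real" and P0 Q0 q S :: "real poly"
  assumes d: "d > 0" and der: "\<And>z. \<bar>z\<bar> < d \<Longrightarrow> (M has_real_derivative m z) (at z)"
    and rat: "\<And>z. \<bar>z\<bar> < d \<Longrightarrow> poly Q0 z * M z = poly P0 z" "Q0 \<noteq> 0"
    and rel: "\<And>z. \<bar>z\<bar> < d \<Longrightarrow>
      3 * b * (m z)\<^sup>2 + poly q z * m z + poly (pderiv q) z * M z = poly S z"
    and b: "b \<noteq> 0" and deg: "degree q \<le> 2" "degree S \<le> 4"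
  shows "\<exists>A. degree A \<le> 3 \<and> (\<forall>z. \<bar>z\<bar> < d \<longrightarrow> M z = poly A z)"
proof -
  let ?c = "map_poly complex_of_real"
  have c: "poly (?c p) (of_real z) = of_real (poly p z)" for p z
    by (induction p) (simp_all add: map_poly_pCons)
  have "\<exists>A. \<forall>z. \<bar>z\<bar> < d \<longrightarrow> M z = poly A z"
  proof (rule rational_primitive_is_poly[OF d der, where ?Q0.0="?c Q0" and ?P0.0="?c P0" and q="?c q"
        and q'="?c (pderiv q)" and S="?c S" and b="of_real (3 * b)"])
    fix z assume z: "\<bar>z\<bar> < d"
    show "poly (?c Q0) (of_real z) * of_real (M z) = poly (?c P0) (of_real z)"
      unfolding c rat(1)[OF z, symmetric] by simp
    show "of_real (3 * b) * (of_real (m z))\<^sup>2 + poly (?c q) (of_real z) * of_real (m z)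
        + poly (?c (pderiv q)) (of_real z) * of_real (M z) = poly (?c S) (of_real z)"
      unfolding c rel[OF z, symmetric] by simp
  qed (use rat(2) b in \<open>auto simp: map_poly_eq_0_iff\<close>)
  then obtain A where MA: "\<And>z. \<bar>z\<bar> < d \<Longrightarrow> M z = poly A z" by blast
  have mA: "m z = poly (pderiv A) z" if "\<bar>z\<bar> < d" for z
    by (rule DERIV_unique_on_interval[of d, OF MA that der[OF that] poly_DERIV])
  have idA: "smult (3 * b) ((pderiv A)\<^sup>2) + q * pderiv A + pderiv q * A = S"
  proof (rule poly_eq_if_eq_on_interval[OF d], unfold of_real_eq_id id_apply)
    fix z assume z: "\<bar>z\<bar> < d"
    show "poly (smult (3 * b) ((pderiv A)\<^sup>2) + q * pderiv A + pderiv q * A) z = poly S z"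
      using rel[OF z] by (simp add: MA[OF z] mA[OF z])
  qed
  \<comment> \<open>For degree n at least 4 the square of the derivative has degree 2n - 2, which
    exceeds the bound n + 1 for all other terms.\<close>
  have "degree A \<le> 3"
  proof (rule ccontr)
    assume n: "\<not> degree A \<le> 3"
    have dp: "degree (pderiv A) = degree A - 1" by (rule degree_pderiv)
    have nz: "pderiv A \<noteq> 0" using n by (auto simp: pderiv_eq_0_iff)
    have "degree (smult (3 * b) ((pderiv A)\<^sup>2)) = 2 * (degree A - 1)"
      using b nz by (simp add: degree_power_eq dp)
    moreover have "smult (3 * b) ((pderiv A)\<^sup>2) = S - q * pderiv A - pderiv q * A"
      unfolding idA[symmetric] by simp
    moreover have "degree (S - q * pderiv A - pderiv q * A) \<le> degree A + 1"
    proof (intro degree_diff_le)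
      show "degree S \<le> degree A + 1" using deg n by simp
      show "degree (q * pderiv A) \<le> degree A + 1"
        by (rule order_trans[OF degree_mult_le]) (use deg n dp in simp)
      show "degree (pderiv q * A) \<le> degree A + 1"
        by (rule order_trans[OF degree_mult_le]) (use deg degree_pderiv[of q] in simp)
    qed
    ultimately show False using n by simp
  qed
  then show ?thesis using MA by blast
qed

text \<open>Both relations below come from cubic integrals; \<open>q\<close> and \<open>S\<close> are the polynomials in the
  coordinate \<open>z\<close> attached to an integral, and the index \<open>0\<close> refers to the integral that is known
  explicitly.\<close>

locale primitive_relation =
  fixes d :: real and M m :: "real \<Rightarrow> real" and b0 s0 t0 c0 c1 :: real
  assumes d: "d > 0"
    and der: "\<And>z. \<bar>z\<bar> < d \<Longrightarrow> (M has_real_derivative m z) (at z)"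
    and nz: "b0 \<noteq> 0 \<or> s0 \<noteq> 0"
    and rel0: "\<And>z. \<bar>z\<bar> < d \<Longrightarrow>
      3 * b0 * (m z)\<^sup>2 + (4 * t0 + 4 * s0 * z + 2 * b0 * z\<^sup>2) * m z + (4 * s0 + 4 * b0 * z) * M z
        = c0 + c1 * z - 4 * t0 * z\<^sup>2 - 4 / 3 * s0 * z ^ 3 - 1 / 3 * b0 * z ^ 4"
    and not_cubic: "\<not> (\<exists>A. degree A \<le> 3 \<and> (\<forall>z. \<bar>z\<bar> < d \<longrightarrow> M z = poly A z))"
begin

text \<open>Eliminating the square of \<open>m\<close> between the two relations leaves (r M)' = T
  with polynomials r and T. For nonzero r this makes \<open>M\<close> rational, hence a polynomial
  of degree at most 3 by a relation that still contains the square. So r = 0, which is the claimed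
  proportionality. If \<open>b0 = 0\<close>, the known relation alone makes \<open>M\<close>
  rational, and \<open>b\<close> has to vanish.\<close>

lemma relation_unique:
  assumes rel: "\<And>z. \<bar>z\<bar> < d \<Longrightarrow>
      3 * b * (m z)\<^sup>2 + (4 * t + 4 * s * z + 2 * b2 * z\<^sup>2) * m z + (4 * s + 4 * b2 * z) * M z
        = e0 + e1 * z + e2 * z\<^sup>2 + e3 * z ^ 3 + e4 * z ^ 4"
  shows "b0 \<noteq> 0 \<Longrightarrow> b2 = b \<and> s * b0 = b * s0 \<and> t * b0 = b * t0"
    and "b0 = 0 \<Longrightarrow> b = 0"
    and "b0 = 0 \<Longrightarrow> b2 = 0 \<Longrightarrow> t * s0 = s * t0 \<and> e3 = - 4 / 3 * s"
proof -
  define q0 where "q0 = [:4 * t0, 4 * s0, 2 * b0:]"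
  define S0 where "S0 = [:c0, c1, - 4 * t0, - 4 / 3 * s0, - 1 / 3 * b0:]"
  define q where "q = [:4 * t, 4 * s, 2 * b2:]"
  define S where "S = [:e0, e1, e2, e3, e4:]"
  note defs = q0_def S0_def q_def S_def
  have R0: "3 * b0 * (m z)\<^sup>2 + poly q0 z * m z + poly (pderiv q0) z * M z = poly S0 z"
    if "\<bar>z\<bar> < d" for z
    by (rule trans[OF _ trans[OF rel0[OF that]]]) (simp_all add: q0_def S0_def pderiv_pCons algebra_simps power2_eq_square power3_eq_cube power4_eq_xxxx)
  have R: "3 * b * (m z)\<^sup>2 + poly q z * m z + poly (pderiv q) z * M z = poly S z"
    if "\<bar>z\<bar> < d" for z
    by (rule trans[OF _ trans[OF rel[OF that]]]) (simp_all add: q_def S_def pderiv_pCons algebra_simps power2_eq_square power3_eq_cube power4_eq_xxxx)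
  have deg: "degree q0 \<le> 2" "degree q \<le> 2" "degree S0 \<le> 4" "degree S \<le> 4"
    by (simp_all add: defs)
  have prim: "\<exists>P. degree P \<le> Suc (degree T) \<and> (\<forall>z. \<bar>z\<bar> < d \<longrightarrow> poly r z * M z = poly P z)"
    if "\<And>z. \<bar>z\<bar> < d \<Longrightarrow> poly r z * m z + poly (pderiv r) z * M z = poly T z" for r T
  proof (rule primitive_eq_poly[OF d])
    fix z assume z: "\<bar>z\<bar> < d"
    show "((\<lambda>z. poly r z * M z) has_real_derivative poly T z) (at z)"
      using DERIV_mult[OF poly_DERIV[of r z] der[OF z]] that[OF z] by (simp add: algebra_simps)
  qed
  show "b2 = b \<and> s * b0 = b * s0 \<and> t * b0 = b * t0" if b0: "b0 \<noteq> 0"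
  proof -
    define r where "r = q - smult (b / b0) q0"
    define T where "T = S - smult (b / b0) S0"
    have "r = 0"
    proof (rule ccontr)
      assume r: "r \<noteq> 0"
      have "poly r z * m z + poly (pderiv r) z * M z = poly T z" if z: "\<bar>z\<bar> < d" for z
      proof -
        have "poly r z * m z + poly (pderiv r) z * M z =
            (3 * b * (m z)\<^sup>2 + poly q z * m z + poly (pderiv q) z * M z)
            - b / b0 * (3 * b0 * (m z)\<^sup>2 + poly q0 z * m z + poly (pderiv q0) z * M z)"
          using b0 by (simp add: r_def pderiv_diff pderiv_smult algebra_simps)
        also have "\<dots> = poly T z" by (simp only: R[OF z] R0[OF z]) (simp add: T_def)
        finally show ?thesis .
      qed
      from prim[OF this] obtain P where "\<And>z. \<bar>z\<bar> < d \<Longrightarrow> poly r z * M z = poly P z" by blast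
      from rational_primitive_is_cubic[OF d der this r R0 b0 deg(1,3)] not_cubic show False by blast
    qed
    then have "q = smult (b / b0) q0" by (simp add: r_def)
    then have c: "coeff q i = b / b0 * coeff q0 i" for i by simp
    have "4 * t = b / b0 * (4 * t0)" "4 * s = b / b0 * (4 * s0)" "2 * b2 = b / b0 * (2 * b0)"
      using c[of 0] c[of 1] c[of 2] by (simp_all add: q_def q0_def numeral_2_eq_2)
    then show ?thesis using b0 by (simp add: nonzero_eq_divide_eq)
  qed
  assume b0: "b0 = 0"
  then have s0: "s0 \<noteq> 0" using nz by simp
  have q0n: "q0 \<noteq> 0" using s0 by (simp add: q0_def)
  have "poly q0 z * m z + poly (pderiv q0) z * M z = poly S0 z" if "\<bar>z\<bar> < d" for z
    using R0[OF that] b0 by simp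
  from prim[OF this] obtain P0 where P0: "degree P0 \<le> Suc (degree S0)"
    "\<And>z. \<bar>z\<bar> < d \<Longrightarrow> poly q0 z * M z = poly P0 z" by blast
  have dS0: "degree S0 \<le> 3" by (simp add: S0_def b0)
  show b: "b = 0"
  proof (rule ccontr)
    assume "b \<noteq> 0"
    from rational_primitive_is_cubic[OF d der P0(2) q0n R this deg(2,4)] not_cubic show False by blast
  qed
  show "t * s0 = s * t0 \<and> e3 = - 4 / 3 * s" if b2: "b2 = 0"
  proof -
    define x where "x = s / s0"
    have s: "s = x * s0" using s0 by (simp add: x_def)
    \<comment> \<open>Now \<open>q\<close> and \<open>q0\<close> have degree at most 1. Subtracting
      \<open>x\<close> times the known relation leaves the constant \<open>k\<close> in front of
      \<open>m\<close> and nothing in front of \<open>M\<close>.\<close>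
    define k where "k = 4 * (t - x * t0)"
    define T where "T = S - smult x S0"
    have kT: "k * m z = poly T z" if z: "\<bar>z\<bar> < d" for z
    proof -
      have "k * m z = (3 * b * (m z)\<^sup>2 + poly q z * m z + poly (pderiv q) z * M z)
          - x * (3 * b0 * (m z)\<^sup>2 + poly q0 z * m z + poly (pderiv q0) z * M z)"
        unfolding k_def b b0 b2 q_def q0_def s by (simp add: pderiv_pCons) (simp add: algebra_simps)
      also have "\<dots> = poly T z" by (simp only: R[OF z] R0[OF z]) (simp add: T_def)
      finally show ?thesis .
    qed
    have k: "k = 0"
    proof (rule ccontr)
      assume k: "k \<noteq> 0"
      have "(M has_real_derivative poly (smult (1 / k) T) z) (at z)" if z: "\<bar>z\<bar> < d" for z
      proof -
        have "m z = poly (smult (1 / k) T) z" using k by (simp add: kT[OF z, symmetric])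
        then show ?thesis using der[OF z] by simp
      qed
      from primitive_eq_poly[OF d this] obtain A where A: "\<And>z. \<bar>z\<bar> < d \<Longrightarrow> M z = poly A z" by blast
      \<comment> \<open>Integrating \<open>T\<close> alone would only bound the degree of
        \<open>A\<close> by 5. The known relation improves this: \<open>P0\<close> has degree at
        most 4 and \<open>q0\<close> has degree 1.\<close>
      have "q0 * A = P0"
        by (rule poly_eq_if_eq_on_interval[OF d]) (use P0(2) A in auto)
      moreover have "degree q0 = 1" using s0 by (simp add: q0_def b0)
      ultimately have "degree P0 = 1 + degree A" if "A \<noteq> 0"
        using degree_mult_eq[OF q0n that] by simp
      then have "degree A \<le> 3" using P0(1) dS0 by (cases "A = 0") auto
      then show False using A not_cubic by auto
    qed
    have "T = 0" by (rule poly_eq_if_eq_on_interval[OF d]) (use kT k in auto)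
    then have "S = smult x S0" by (simp add: T_def)
    then have "coeff S 3 = x * coeff S0 3" by simp
    then have "e3 = x * (- 4 / 3 * s0)" by (simp add: S_def S0_def numeral_3_eq_3)
    then have e3: "e3 = - 4 / 3 * s" by (simp add: s)
    have "t = x * t0" using k by (simp add: k_def)
    then have "t * s0 = s * t0" by (simp add: s)
    with e3 show ?thesis by (intro conjI)
  qed
qed

end

section \<open>Scale-invariant metrics in an adapted frame\<close>

lemma DERIV_cubic_form:
  assumes "(b has_real_derivative b') (at t)" "(s has_real_derivative s') (at t)"
    "(c has_real_derivative c') (at t)" "(d has_real_derivative d') (at t)"
    "(w has_real_derivative w') (at t)" "(k has_real_derivative k') (at t)"
  shows "((\<lambda>t. b t * w t ^ 3 + s t * (w t)\<^sup>2 * k t + c t * w t * (k t)\<^sup>2 + d t * k t ^ 3) has_real_derivative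
    (b' * w t ^ 3 + s' * (w t)\<^sup>2 * k t + c' * w t * (k t)\<^sup>2 + d' * k t ^ 3)
    + (3 * b t * (w t)\<^sup>2 + 2 * s t * w t * k t + c t * (k t)\<^sup>2) * w'
    + (s t * (w t)\<^sup>2 + 2 * c t * w t * k t + 3 * d t * (k t)\<^sup>2) * k') (at t)"
  by (rule derivative_eq_intros assms refl)+ (simp add: algebra_simps power2_eq_square power3_eq_cube)

lemma DERIV_quadratic_form:
  assumes "(w has_real_derivative w') (at t)" "(k has_real_derivative k') (at t)"
    "(m has_real_derivative m') (at t)"
  shows "((\<lambda>t. ((w t)\<^sup>2 + m t * (k t)\<^sup>2) / 2) has_real_derivative
    (w t * w' + m t * k t * k' + m' * (k t)\<^sup>2 / 2)) (at t)"
  by (rule derivative_eq_intros assms refl)+ (simp_all add: algebra_simps power2_eq_square)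

lemma du_eqI: "((\<lambda>t. f (t, v)) has_real_derivative a) (at u) \<Longrightarrow> du f (u, v) = a"
  unfolding du_def by (auto intro: DERIV_imp_deriv)

lemma dv_eqI: "((\<lambda>t. f (u, t)) has_real_derivative a) (at v) \<Longrightarrow> dv f (u, v) = a"
  unfolding dv_def by (auto intro: DERIV_imp_deriv)

lemma poisson_eqI:
  assumes "((\<lambda>t. f ((t, v), (p, q))) has_real_derivative fu) (at u)"
    "((\<lambda>t. f ((u, t), (p, q))) has_real_derivative fv) (at v)"
    "((\<lambda>t. f ((u, v), (t, q))) has_real_derivative fp) (at p)"
    "((\<lambda>t. f ((u, v), (p, t))) has_real_derivative fq) (at q)"
    "((\<lambda>t. g ((t, v), (p, q))) has_real_derivative gu) (at u)"
    "((\<lambda>t. g ((u, t), (p, q))) has_real_derivative gv) (at v)"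
    "((\<lambda>t. g ((u, v), (t, q))) has_real_derivative gp) (at p)"
    "((\<lambda>t. g ((u, v), (p, t))) has_real_derivative gq) (at q)"
  shows "poisson f g ((u, v), (p, q)) = fp * gu - fu * gp + fq * gv - fv * gq"
proof -
  have "du (\<lambda>x. f (x, (p, q))) (u, v) = fu" "dv (\<lambda>x. f (x, (p, q))) (u, v) = fv"
    "du (\<lambda>y. f ((u, v), y)) (p, q) = fp" "dv (\<lambda>y. f ((u, v), y)) (p, q) = fq"
    "du (\<lambda>x. g (x, (p, q))) (u, v) = gu" "dv (\<lambda>x. g (x, (p, q))) (u, v) = gv"
    "du (\<lambda>y. g ((u, v), y)) (p, q) = gp" "dv (\<lambda>y. g ((u, v), y)) (p, q) = gq"
    by (intro du_eqI dv_eqI assms)+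
  then show ?thesis by (simp add: poisson_def)
qed

lemma DERIV_transform_slices:
  assumes "open U" "(u, v) \<in> U" "\<And>x. x \<in> U \<Longrightarrow> f x = g x"
  shows "((\<lambda>t. g (t, v)) has_real_derivative a) (at u) \<Longrightarrow> ((\<lambda>t. f (t, v)) has_real_derivative a) (at u)"
    and "((\<lambda>t. g (u, t)) has_real_derivative b) (at v) \<Longrightarrow> ((\<lambda>t. f (u, t)) has_real_derivative b) (at v)"
proof -
  have "eventually (\<lambda>t. f (t, v) = g (t, v)) (nhds u)"
    using eventually_in_open_slices(1)[OF assms(1,2)] by (rule eventually_mono) (rule assms(3))
  from DERIV_cong_ev[OF refl this refl]
  show "((\<lambda>t. g (t, v)) has_real_derivative a) (at u) \<Longrightarrow> ((\<lambda>t. f (t, v)) has_real_derivative a) (at u)"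
    by blast
  have "eventually (\<lambda>t. f (u, t) = g (u, t)) (nhds v)"
    using eventually_in_open_slices(2)[OF assms(1,2)] by (rule eventually_mono) (rule assms(3))
  from DERIV_cong_ev[OF refl this refl]
  show "((\<lambda>t. g (u, t)) has_real_derivative b) (at v) \<Longrightarrow> ((\<lambda>t. f (u, t)) has_real_derivative b) (at v)"
    by blast
qed

lemma du_dv_cong:
  assumes "open U" "x \<in> U" "\<And>x. x \<in> U \<Longrightarrow> f x = g x" "smooth_on g U"
  shows "du f x = du g x" "dv f x = dv g x"
proof -
  obtain u v where x: "x = (u, v)" by fastforce
  note p = smooth_on_partials[OF assms(1,4), of u v] DERIV_transform_slices[OF assms(1) _ assms(3), of u v]
  show "du f x = du g x" "dv f x = dv g x"
    using assms(2) p unfolding x by (auto intro!: du_eqI dv_eqI)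
qed

context
  fixes U f g x
  assumes U: "open U" and f: "smooth_on f U" and g: "smooth_on g U" and x: "x \<in> U"
begin

lemma du_dv_add:
  "du (\<lambda>x. f x + g x) x = du f x + du g x" "dv (\<lambda>x. f x + g x) x = dv f x + dv g x"
  and du_dv_diff:
  "du (\<lambda>x. f x - g x) x = du f x - du g x" "dv (\<lambda>x. f x - g x) x = dv f x - dv g x"
  and du_dv_mult:
  "du (\<lambda>x. f x * g x) x = du f x * g x + f x * du g x" "dv (\<lambda>x. f x * g x) x = dv f x * g x + f x * dv g x"
  and du_dv_uminus: "du (\<lambda>x. - f x) x = - du f x" "dv (\<lambda>x. - f x) x = - dv f x"
  and du_dv_divide: "g x \<noteq> 0 \<Longrightarrow> du (\<lambda>x. f x / g x) x = (du f x * g x - f x * du g x) / (g x)\<^sup>2"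
   "g x \<noteq> 0 \<Longrightarrow> dv (\<lambda>x. f x / g x) x = (dv f x * g x - f x * dv g x) / (g x)\<^sup>2"
  and du_dv_sqrt: "f x > 0 \<Longrightarrow> du (\<lambda>x. sqrt (f x)) x = du f x / (2 * sqrt (f x))"
    "f x > 0 \<Longrightarrow> dv (\<lambda>x. sqrt (f x)) x = dv f x / (2 * sqrt (f x))"
proof -
  obtain u v where xuv: "x = (u, v)" by fastforce
  note p = smooth_on_partials[OF U f x[unfolded xuv]] smooth_on_partials[OF U g x[unfolded xuv]]
  show "du (\<lambda>x. f x + g x) x = du f x + du g x" "dv (\<lambda>x. f x + g x) x = dv f x + dv g x"
    unfolding xuv by (intro du_eqI dv_eqI DERIV_add p)+
  show "du (\<lambda>x. f x - g x) x = du f x - du g x" "dv (\<lambda>x. f x - g x) x = dv f x - dv g x"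
    unfolding xuv by (intro du_eqI dv_eqI DERIV_diff p)+
  show "du (\<lambda>x. - f x) x = - du f x" "dv (\<lambda>x. - f x) x = - dv f x"
    unfolding xuv by (intro du_eqI dv_eqI DERIV_minus p)+
  show "du (\<lambda>x. f x * g x) x = du f x * g x + f x * du g x" "dv (\<lambda>x. f x * g x) x = dv f x * g x + f x * dv g x"
    unfolding xuv using DERIV_mult[OF p(1,3)] DERIV_mult[OF p(2,4)]
    by (intro du_eqI dv_eqI; simp add: algebra_simps)+
  show "g x \<noteq> 0 \<Longrightarrow> du (\<lambda>x. f x / g x) x = (du f x * g x - f x * du g x) / (g x)\<^sup>2"
   "g x \<noteq> 0 \<Longrightarrow> dv (\<lambda>x. f x / g x) x = (dv f x * g x - f x * dv g x) / (g x)\<^sup>2"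
    unfolding xuv using DERIV_divide[OF p(1,3)] DERIV_divide[OF p(2,4)]
    by (intro du_eqI dv_eqI; simp add: power2_eq_square)+
  show "f x > 0 \<Longrightarrow> du (\<lambda>x. sqrt (f x)) x = du f x / (2 * sqrt (f x))"
    "f x > 0 \<Longrightarrow> dv (\<lambda>x. sqrt (f x)) x = dv f x / (2 * sqrt (f x))"
    unfolding xuv using DERIV_chain2[OF DERIV_real_sqrt p(1)] DERIV_chain2[OF DERIV_real_sqrt p(2)]
    by (intro du_eqI dv_eqI; simp add: field_simps)+
qed

end

lemma du_dv_const: "du (\<lambda>_. c) x = 0" "dv (\<lambda>_. c) x = 0"
  and du_dv_fst: "du fst x = 1" "dv fst x = 0"
  and du_dv_snd: "du snd x = 0" "dv snd x = 1"
  by (simp_all add: du_def dv_def)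

section \<open>Homogeneous functions with respect to the Euler field\<close>

locale scale_invariant_metric =
  fixes U :: "point set" and E F G :: "point \<Rightarrow> real"
  assumes open_U: "open U" and connected_U: "connected U" and U_nonempty: "U \<noteq> {}"
    and metric: "is_metric U E F G"
    and system: "solves_system U E F G"
    and invariant: "invariant_under scaling_field U E F G"
begin

lemma smooth_EFG: "smooth_on E U" "smooth_on F U" "smooth_on G U"
  and E_pos: "x \<in> U \<Longrightarrow> E x > 0"
  and det_pos: "x \<in> U \<Longrightarrow> E x * G x - (F x)\<^sup>2 > 0"
  using metric by (simp_all add: is_metric_def)

definition Y :: "(point \<Rightarrow> real) \<Rightarrow> point \<Rightarrow> real" where
  "Y f x = fst x * du f x + snd x * dv f x"

definition homogeneous :: "real \<Rightarrow> (point \<Rightarrow> real) \<Rightarrow> bool" where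
  "homogeneous k f \<longleftrightarrow> smooth_on f U \<and> (\<forall>x\<in>U. Y f x = k * f x)"

lemma homogeneous_EFG: "homogeneous (-2) E" "homogeneous (-2) F" "homogeneous (-2) G"
proof -
  have "Y E x = -2 * E x \<and> Y F x = -2 * F x \<and> Y G x = -2 * G x" if "x \<in> U" for x
  proof -
    have "scaling_field (fst x, snd x, E x, F x, G x)
        \<in> span {(1, 0, du E x, du F x, du G x), (0, 1, dv E x, dv F x, dv G x)}"
      using invariant that by (simp add: invariant_under_def)
    \<comment> \<open>The first two components force \<open>a\<close> and \<open>b\<close> to be the
      coordinates of \<open>x\<close>; the other three are then Euler's relations of degree
      -2.\<close>
    then obtain a b where
      "scaling_field (fst x, snd x, E x, F x, G x) - a *\<^sub>R (1, 0, du E x, du F x, du G x)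
        = b *\<^sub>R (0, 1, dv E x, dv F x, dv G x)"
      by (auto simp: span_insert span_empty)
    then show ?thesis by (simp add: scaling_field_def Y_def)
  qed
  then show "homogeneous (-2) E" "homogeneous (-2) F" "homogeneous (-2) G"
    using smooth_EFG by (simp_all add: homogeneous_def)
qed

lemma homogeneous_imp_smooth: "homogeneous k f \<Longrightarrow> smooth_on f U"
  by (simp add: homogeneous_def)

lemma homogeneousI: "smooth_on f U \<Longrightarrow> (\<And>x. x \<in> U \<Longrightarrow> Y f x = k * f x) \<Longrightarrow> homogeneous k f"
  by (simp add: homogeneous_def)

lemma homogeneousD: "homogeneous k f \<Longrightarrow> x \<in> U \<Longrightarrow> Y f x = k * f x"
  by (simp add: homogeneous_def)

lemma homogeneous_const: "homogeneous 0 (\<lambda>_. c)"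
  by (rule homogeneousI[OF smooth_on_const[OF open_U]]) (simp add: Y_def du_dv_const)

lemma homogeneous_fst: "homogeneous 1 fst"
  by (rule homogeneousI[OF smooth_on_fst[OF open_U]]) (simp add: Y_def du_dv_fst)

lemma homogeneous_snd: "homogeneous 1 snd"
  by (rule homogeneousI[OF smooth_on_snd[OF open_U]]) (simp add: Y_def du_dv_snd)

lemma homogeneous_uminus:
  assumes f: "homogeneous k f"
  shows "homogeneous k (\<lambda>x. - f x)"
proof (rule homogeneousI[OF smooth_on_uminus[OF open_U]])
  show sm: "smooth_on f U" using f by (rule homogeneous_imp_smooth)
  show "Y (\<lambda>x. - f x) x = k * - f x" if "x \<in> U" for x
    using homogeneousD[OF f that] unfolding Y_def du_dv_uminus[OF open_U sm sm that] by simp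
qed

lemma homogeneous_mult:
  assumes f: "homogeneous k f" and g: "homogeneous l g"
  shows "homogeneous (k + l) (\<lambda>x. f x * g x)"
proof (rule homogeneousI[OF smooth_on_mult[OF open_U]])
  show sf: "smooth_on f U" and sg: "smooth_on g U" using f g by (auto intro: homogeneous_imp_smooth)
  show "Y (\<lambda>x. f x * g x) x = (k + l) * (f x * g x)" if "x \<in> U" for x
  proof -
    have "Y (\<lambda>x. f x * g x) x = Y f x * g x + f x * Y g x"
      unfolding Y_def du_dv_mult[OF open_U sf sg that] by (simp add: algebra_simps)
    then show ?thesis by (simp add: homogeneousD[OF f that] homogeneousD[OF g that] algebra_simps)
  qed
qed

lemma homogeneous_multI:
  "homogeneous k f \<Longrightarrow> homogeneous l g \<Longrightarrow> k + l = n \<Longrightarrow> homogeneous n (\<lambda>x. f x * g x)"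
  using homogeneous_mult by blast

lemma homogeneous_add:
  assumes f: "homogeneous k f" and g: "homogeneous k g"
  shows "homogeneous k (\<lambda>x. f x + g x)"
proof (rule homogeneousI[OF smooth_on_add[OF open_U]])
  show sf: "smooth_on f U" and sg: "smooth_on g U" using f g by (auto intro: homogeneous_imp_smooth)
  show "Y (\<lambda>x. f x + g x) x = k * (f x + g x)" if "x \<in> U" for x
  proof -
    have "Y (\<lambda>x. f x + g x) x = Y f x + Y g x"
      unfolding Y_def du_dv_add[OF open_U sf sg that] by (simp add: algebra_simps)
    then show ?thesis by (simp add: homogeneousD[OF f that] homogeneousD[OF g that] algebra_simps)
  qed
qed

lemma homogeneous_diff:
  "homogeneous k f \<Longrightarrow> homogeneous k g \<Longrightarrow> homogeneous k (\<lambda>x. f x - g x)"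
  using homogeneous_add[of k f "\<lambda>x. - g x"] homogeneous_uminus[of k g] by simp

lemma homogeneous_divide:
  assumes "homogeneous k f" "homogeneous l g" "\<forall>x\<in>U. g x \<noteq> 0"
  shows "homogeneous (k - l) (\<lambda>x. f x / g x)"
proof -
  have "Y (\<lambda>x. f x / g x) x = (k - l) * (f x / g x)" if "x \<in> U" for x
  proof -
    note 1 = homogeneousD[OF assms(1) that] homogeneousD[OF assms(2) that]
      homogeneous_imp_smooth[OF assms(1)] homogeneous_imp_smooth[OF assms(2)]
    have g: "g x \<noteq> 0" using assms(3) that by blast
    have "Y (\<lambda>x. f x / g x) x = (Y f x * g x - f x * Y g x) / (g x)\<^sup>2"
      unfolding Y_def du_dv_divide[OF open_U 1(3,4) that g]
      by (simp add: algebra_simps add_divide_distrib diff_divide_distrib)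
    also have "\<dots> = (k - l) * (f x / g x)"
      using g by (simp add: 1(1,2) power2_eq_square field_simps)
    finally show ?thesis .
  qed
  then show ?thesis
    by (rule homogeneousI[OF smooth_on_divide[OF open_U homogeneous_imp_smooth[OF assms(1)]
            homogeneous_imp_smooth[OF assms(2)] assms(3)]])
qed

lemma homogeneous_sqrt:
  assumes "homogeneous k f" "\<forall>x\<in>U. f x > 0"
  shows "homogeneous (k / 2) (\<lambda>x. sqrt (f x))"
proof -
  have "Y (\<lambda>x. sqrt (f x)) x = k / 2 * sqrt (f x)" if "x \<in> U" for x
  proof -
    note 1 = homogeneousD[OF assms(1) that] homogeneous_imp_smooth[OF assms(1)]
    have f: "f x > 0" using assms(2) that by blast
    have "Y (\<lambda>x. sqrt (f x)) x = Y f x / (2 * sqrt (f x))"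
      unfolding Y_def du_dv_sqrt[OF open_U 1(2,2) that f] by (simp add: add_divide_distrib)
    also have "\<dots> = k / 2 * (f x / sqrt (f x))" by (simp add: 1(1))
    also have "f x / sqrt (f x) = sqrt (f x)" using f by (simp add: real_div_sqrt)
    finally show ?thesis .
  qed
  then show ?thesis
    by (rule homogeneousI[OF smooth_on_sqrt[OF open_U homogeneous_imp_smooth[OF assms(1)] assms(2)]])
qed

text \<open>\<open>(n1, n2)\<close> is the unit normal of the Killing field. The factor \<open>N\<close> in the normal derivative \<open>Z\<close>
  makes it commute with \<open>Y\<close>.\<close>

definition D where "D x = E x * G x - (F x)\<^sup>2"
definition N where "N x = E x * (fst x)\<^sup>2 + 2 * F x * fst x * snd x + G x * (snd x)\<^sup>2"
definition m where "m x = 1 / N x"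
definition R where "R x = sqrt (D x * N x)"
definition n1 where "n1 x = - (F x * fst x + G x * snd x) / R x"
definition n2 where "n2 x = (E x * fst x + F x * snd x) / R x"

definition Z :: "(point \<Rightarrow> real) \<Rightarrow> point \<Rightarrow> real" where
  "Z f x = N x * (n1 x * du f x + n2 x * dv f x)"

text \<open>The Euler field vanishes at the origin, while \<open>Y E\<close> is \<open>-2 E\<close>
  and \<open>E\<close> is positive.\<close>

lemma origin_notin: "(0, 0) \<notin> U"
proof
  assume o: "(0, 0) \<in> U"
  then have "Y E (0, 0) = -2 * E (0, 0)" using homogeneous_EFG(1) by (simp only: homogeneous_def)
  then show False using E_pos[OF o] by (simp add: Y_def)
qed

lemma D_pos: "x \<in> U \<Longrightarrow> D x > 0"
  using det_pos by (simp add: D_def)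

lemma N_pos: assumes x: "x \<in> U" shows "N x > 0"
proof -
  have id: "E x * N x = (E x * fst x + F x * snd x)\<^sup>2 + D x * (snd x)\<^sup>2"
    by (simp add: N_def D_def algebra_simps power2_eq_square)
  have "E x * N x > 0"
  proof (cases "snd x = 0")
    case True
    then have "fst x \<noteq> 0" using origin_notin x by (metis prod.collapse)
    then show ?thesis using E_pos[OF x] True by (simp add: id)
  next
    case False
    then have "D x * (snd x)\<^sup>2 > 0" using D_pos[OF x] by simp
    then show ?thesis unfolding id by (rule add_nonneg_pos[OF zero_le_power2])
  qed
  then show ?thesis using E_pos[OF x] by (simp add: zero_less_mult_iff)
qed

lemma m_pos: "x \<in> U \<Longrightarrow> m x > 0" and m_N: "x \<in> U \<Longrightarrow> m x * N x = 1"
  using N_pos[of x] by (simp_all add: m_def)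

lemma R_pos: "x \<in> U \<Longrightarrow> R x > 0" and R_sq: "x \<in> U \<Longrightarrow> (R x)\<^sup>2 = D x * N x"
  using D_pos[of x] N_pos[of x] by (simp_all add: R_def)

lemma homogeneous_D: "homogeneous (-4) D"
  using homogeneous_diff[OF homogeneous_mult[OF homogeneous_EFG(1,3)] homogeneous_mult[OF homogeneous_EFG(2,2)]]
  by (simp add: D_def[abs_def] power2_eq_square)

lemma homogeneous_N: "homogeneous 0 N"
  unfolding N_def[abs_def] power2_eq_square
  by (rule homogeneous_add homogeneous_multI homogeneous_EFG homogeneous_const homogeneous_fst
      homogeneous_snd | simp)+

lemma homogeneous_m: "homogeneous 0 m"
proof -
  have "\<forall>x\<in>U. N x \<noteq> 0" using N_pos by (metis less_irrefl)
  from homogeneous_divide[OF homogeneous_const[of 1] homogeneous_N this]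
  show ?thesis by (simp add: m_def[abs_def])
qed

lemma homogeneous_R: "homogeneous (-2) R"
proof -
  have "\<forall>x\<in>U. D x * N x > 0" using D_pos N_pos by simp
  from homogeneous_sqrt[OF homogeneous_mult[OF homogeneous_D homogeneous_N] this]
  show ?thesis by (simp add: R_def[abs_def])
qed

lemma homogeneous_n: "homogeneous 1 n1" "homogeneous 1 n2"
proof -
  have R: "\<forall>x\<in>U. R x \<noteq> 0" using R_pos by (metis less_irrefl)
  show "homogeneous 1 n1"
    using homogeneous_divide[OF homogeneous_uminus[OF homogeneous_add[OF
          homogeneous_mult[OF homogeneous_EFG(2) homogeneous_fst]
          homogeneous_mult[OF homogeneous_EFG(3) homogeneous_snd]]] homogeneous_R R]
    by (simp add: n1_def[abs_def])
  show "homogeneous 1 n2"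
    using homogeneous_divide[OF homogeneous_add[OF
          homogeneous_mult[OF homogeneous_EFG(1) homogeneous_fst]
          homogeneous_mult[OF homogeneous_EFG(2) homogeneous_snd]] homogeneous_R R]
    by (simp add: n2_def[abs_def])
qed

lemmas smooth_frame = smooth_EFG homogeneous_D[THEN homogeneous_imp_smooth]
  homogeneous_N[THEN homogeneous_imp_smooth] homogeneous_m[THEN homogeneous_imp_smooth]
  homogeneous_R[THEN homogeneous_imp_smooth] homogeneous_n[THEN homogeneous_imp_smooth]

lemma smooth_Y: "smooth_on f U \<Longrightarrow> smooth_on (Y f) U"
  and smooth_Z: "smooth_on f U \<Longrightarrow> smooth_on (Z f) U"
  unfolding Y_def[abs_def] Z_def[abs_def]
  by (intro smooth_on_mult[OF open_U] smooth_on_add[OF open_U] smooth_on_fst[OF open_U]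
      smooth_on_snd[OF open_U] smooth_on_du smooth_on_dv smooth_frame; assumption)+

lemma Y_m: "x \<in> U \<Longrightarrow> Y m x = 0"
  and Y_n1: "x \<in> U \<Longrightarrow> Y n1 x = n1 x" and Y_n2: "x \<in> U \<Longrightarrow> Y n2 x = n2 x"
  using homogeneous_m homogeneous_n by (simp_all add: homogeneous_def)

lemma R_n1: "x \<in> U \<Longrightarrow> R x * n1 x = - (F x * fst x + G x * snd x)"
  and R_n2: "x \<in> U \<Longrightarrow> R x * n2 x = E x * fst x + F x * snd x"
  using R_pos[of x] by (simp_all add: n1_def n2_def)

text \<open>The Killing field has length \<open>sqrt N\<close> and the unit vector
  \<open>(n1, n2)\<close> is orthogonal to it, so \<open>sqrt D\<close> times their determinant is
  \<open>sqrt N\<close>.\<close>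

lemma frame_det:
  assumes "x \<in> U"
  shows "R x * (fst x * n2 x - snd x * n1 x) = N x"
proof -
  have "R x * (fst x * n2 x - snd x * n1 x) = fst x * (R x * n2 x) - snd x * (R x * n1 x)"
    by (simp only: algebra_simps)
  then show ?thesis unfolding R_n1[OF assms] R_n2[OF assms]
    by (simp add: N_def algebra_simps power2_eq_square)
qed

section \<open>The Hamiltonian and the Poisson bracket in the frame\<close>

definition cubic :: "(point \<Rightarrow> real) \<Rightarrow> (point \<Rightarrow> real) \<Rightarrow> (point \<Rightarrow> real) \<Rightarrow> (point \<Rightarrow> real) \<Rightarrow> phase \<Rightarrow> real" where
  "cubic be si ta de = (\<lambda>(x, (p, q)).
     let w = n1 x * p + n2 x * q; k = fst x * p + snd x * q
     in if x \<in> U then be x * w ^ 3 + si x * w\<^sup>2 * k + ta x * w * k\<^sup>2 + de x * k ^ 3 else 0)"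

text \<open>The normal \<open>(n1, n2)\<close> and the Killing field divided by
  \<open>sqrt N\<close> are orthonormal, so \<open>2 H\<close> is the sum of the squares of the
  momenta \<open>w\<close> and \<open>k / sqrt N\<close> along them.\<close>

lemma hamiltonian_frame:
  assumes "x \<in> U"
  shows "hamiltonian E F G (x, (p, q)) =
    ((n1 x * p + n2 x * q)\<^sup>2 + m x * (fst x * p + snd x * q)\<^sup>2) / 2"
proof -
  define w k where "w = n1 x * p + n2 x * q" and "k = fst x * p + snd x * q"
  define P where "P = G x * p\<^sup>2 - 2 * F x * p * q + E x * q\<^sup>2"
  have Rw: "R x * w = (E x * fst x + F x * snd x) * q - (F x * fst x + G x * snd x) * p"
  proof -
    have "R x * w = (R x * n1 x) * p + (R x * n2 x) * q" by (simp add: w_def algebra_simps)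
    then show ?thesis unfolding R_n1[OF assms] R_n2[OF assms] by (simp add: algebra_simps)
  qed
  have "N x * (D x * w\<^sup>2 + D x * m x * k\<^sup>2) = (R x * w)\<^sup>2 + D x * k\<^sup>2 * (m x * N x)"
    unfolding power_mult_distrib R_sq[OF assms] by (simp add: algebra_simps)
  also have "\<dots> = N x * P"
    unfolding Rw m_N[OF assms] by (simp add: N_def D_def P_def k_def power2_eq_square algebra_simps)
  finally have "D x * w\<^sup>2 + D x * m x * k\<^sup>2 = P" using N_pos[OF assms] by simp
  then have "D x * (w\<^sup>2 + m x * k\<^sup>2) = P" by (simp add: distrib_left mult.assoc)
  then have "w\<^sup>2 + m x * k\<^sup>2 = P / D x"
    using D_pos[OF assms] by (simp add: nonzero_eq_divide_eq mult.commute)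
  then show ?thesis by (simp add: hamiltonian_def D_def w_def k_def P_def)
qed

text \<open>The velocity is \<open>w\<close> times the normal plus \<open>m k\<close> times the
  Killing field, and the normal derivative is \<open>m Z\<close>. So along the flow a function f of
  position changes at the rate \<open>m (w Z f + k Y f)\<close>, \<open>k\<close> is conserved, and
  \<open>w\<close> changes at the rate \<open>- m (Z m) k^2 / 2\<close>. The factor \<open>N\<close>
  in \<open>Z\<close> is what makes \<open>m\<close> a common factor.\<close>

lemma poisson_frame:
  assumes x: "x \<in> U" and sm: "smooth_on be U" "smooth_on si U" "smooth_on ta U" "smooth_on de U"
    and w: "w = n1 x * p + n2 x * q" and k: "k = fst x * p + snd x * q"
  shows "poisson (hamiltonian E F G) (cubic be si ta de) (x, (p, q)) = m x *
    (Z be x * w ^ 4 + (Z si x + Y be x) * w ^ 3 * k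
    + (Z ta x + Y si x - 3 / 2 * Z m x * be x) * w\<^sup>2 * k\<^sup>2
    + (Z de x + Y ta x - Z m x * si x) * w * k ^ 3 + (Y de x - Z m x * ta x / 2) * k ^ 4)"
proof -
  obtain u v where xuv: "x = (u, v)" by fastforce
  define J where "J x = be x * (n1 x * p + n2 x * q) ^ 3 + si x * (n1 x * p + n2 x * q)\<^sup>2 * (fst x * p + snd x * q)
      + ta x * (n1 x * p + n2 x * q) * (fst x * p + snd x * q)\<^sup>2 + de x * (fst x * p + snd x * q) ^ 3" for x
  define H where "H x = ((n1 x * p + n2 x * q)\<^sup>2 + m x * (fst x * p + snd x * q)\<^sup>2) / 2" for x
  have xU: "(u, v) \<in> U" using x xuv by simp
  note pb = smooth_on_partials[OF open_U _ xU]
  define wu wv where "wu = du n1 x * p + du n2 x * q" and "wv = dv n1 x * p + dv n2 x * q"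
  have dw: "((\<lambda>t. n1 (t, v) * p + n2 (t, v) * q) has_real_derivative wu) (at u)"
    "((\<lambda>t. n1 (u, t) * p + n2 (u, t) * q) has_real_derivative wv) (at v)"
    "((\<lambda>t. n1 (u, v) * t + n2 (u, v) * q) has_real_derivative n1 x) (at p)"
    "((\<lambda>t. n1 (u, v) * p + n2 (u, v) * t) has_real_derivative n2 x) (at q)"
    unfolding wu_def wv_def xuv
    by (auto intro!: derivative_eq_intros pb smooth_frame)
  have dk: "((\<lambda>t. fst (t, v) * p + snd (t, v) * q) has_real_derivative p) (at u)"
    "((\<lambda>t. fst (u, t) * p + snd (u, t) * q) has_real_derivative q) (at v)"
    "((\<lambda>t. fst (u, v) * t + snd (u, v) * q) has_real_derivative u) (at p)"
    "((\<lambda>t. fst (u, v) * p + snd (u, v) * t) has_real_derivative v) (at q)"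
    by (auto intro!: derivative_eq_intros)
  have dc: "((\<lambda>t. c) has_real_derivative 0) (at z)" for c z by simp
  define Bu where "Bu = du be x * w ^ 3 + du si x * w\<^sup>2 * k + du ta x * w * k\<^sup>2 + du de x * k ^ 3"
  define Bv where "Bv = dv be x * w ^ 3 + dv si x * w\<^sup>2 * k + dv ta x * w * k\<^sup>2 + dv de x * k ^ 3"
  define Jw where "Jw = 3 * be x * w\<^sup>2 + 2 * si x * w * k + ta x * k\<^sup>2"
  define Jk where "Jk = si x * w\<^sup>2 + 2 * ta x * w * k + 3 * de x * k\<^sup>2"
  have cJ: "x \<in> U \<Longrightarrow> cubic be si ta de (x, (p, q)) = J x" for x
    by (simp add: cubic_def J_def Let_def)
  have cJ': "cubic be si ta de ((u, v), (p, q)) = be (u, v) * (n1 (u, v) * p + n2 (u, v) * q) ^ 3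
      + si (u, v) * (n1 (u, v) * p + n2 (u, v) * q)\<^sup>2 * (fst (u, v) * p + snd (u, v) * q)
      + ta (u, v) * (n1 (u, v) * p + n2 (u, v) * q) * (fst (u, v) * p + snd (u, v) * q)\<^sup>2
      + de (u, v) * (fst (u, v) * p + snd (u, v) * q) ^ 3" for p q
    using xU by (simp add: cubic_def Let_def)
  note ham = hamiltonian_frame[OF xU]
  have 1: "((\<lambda>t. J (t, v)) has_real_derivative Bu + Jw * wu + Jk * p) (at u)"
    "((\<lambda>t. J (u, t)) has_real_derivative Bv + Jw * wv + Jk * q) (at v)"
    "((\<lambda>t. cubic be si ta de ((u, v), (t, q))) has_real_derivative Jw * n1 x + Jk * u) (at p)"
    "((\<lambda>t. cubic be si ta de ((u, v), (p, t))) has_real_derivative Jw * n2 x + Jk * v) (at q)"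
    unfolding J_def cJ'
    using DERIV_cubic_form[OF pb(1)[OF sm(1)] pb(1)[OF sm(2)] pb(1)[OF sm(3)] pb(1)[OF sm(4)] dw(1) dk(1)]
      DERIV_cubic_form[OF pb(2)[OF sm(1)] pb(2)[OF sm(2)] pb(2)[OF sm(3)] pb(2)[OF sm(4)] dw(2) dk(2)]
      DERIV_cubic_form[OF dc dc dc dc dw(3) dk(3)] DERIV_cubic_form[OF dc dc dc dc dw(4) dk(4)]
    by (simp_all add: Bu_def Bv_def Jw_def Jk_def w k xuv)
  have 2: "((\<lambda>t. H (t, v)) has_real_derivative w * wu + m x * k * p + du m x * k\<^sup>2 / 2) (at u)"
    "((\<lambda>t. H (u, t)) has_real_derivative w * wv + m x * k * q + dv m x * k\<^sup>2 / 2) (at v)"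
    "((\<lambda>t. hamiltonian E F G ((u, v), (t, q))) has_real_derivative w * n1 x + m x * k * u) (at p)"
    "((\<lambda>t. hamiltonian E F G ((u, v), (p, t))) has_real_derivative w * n2 x + m x * k * v) (at q)"
    unfolding H_def ham
    using DERIV_quadratic_form[OF dw(1) dk(1) pb(1)[OF smooth_frame(6)]]
      DERIV_quadratic_form[OF dw(2) dk(2) pb(2)[OF smooth_frame(6)]]
      DERIV_quadratic_form[OF dw(3) dk(3) dc] DERIV_quadratic_form[OF dw(4) dk(4) dc]
    by (simp_all add: w k xuv)
  have P: "poisson (hamiltonian E F G) (cubic be si ta de) (x, (p, q)) =
      (w * n1 x + m x * k * u) * (Bu + Jw * wu + Jk * p)
      - (w * wu + m x * k * p + du m x * k\<^sup>2 / 2) * (Jw * n1 x + Jk * u)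
      + (w * n2 x + m x * k * v) * (Bv + Jw * wv + Jk * q)
      - (w * wv + m x * k * q + dv m x * k\<^sup>2 / 2) * (Jw * n2 x + Jk * v)"
    unfolding xuv
    by (rule poisson_eqI[OF DERIV_transform_slices(1)[OF open_U xU hamiltonian_frame]
          DERIV_transform_slices(2)[OF open_U xU hamiltonian_frame] 2(3,4)
          DERIV_transform_slices(1)[OF open_U xU cJ] DERIV_transform_slices(2)[OF open_U xU cJ] 1(3,4),
          unfolded xuv])
      (use 1 2 in \<open>simp_all add: H_def xuv\<close>)
  have h1: "u * wu + v * wv = w"
    using Y_n1[OF x] Y_n2[OF x] unfolding wu_def wv_def w
    by (simp add: Y_def xuv algebra_simps) (simp add: algebra_simps flip: distrib_left)
  have h2: "u * du m x + v * dv m x = 0"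
    using Y_m[OF x] by (simp add: Y_def xuv)
  have mN: "m x * N x = 1" by (rule m_N[OF x])
  have zm: "n1 x * du f x + n2 x * dv f x = m x * Z f x" for f
    by (simp add: Z_def mult.assoc[symmetric] mN)
  \<comment> \<open>The bracket of \<open>H\<close> with \<open>w\<close>. Likewise
    \<open>a2\<close> is the bracket with \<open>k\<close>, and \<open>a3\<close> differentiates the
    coefficients along the velocity.\<close>
  have a1: "(w * n1 x + m x * k * u) * wu - (w * wu + m x * k * p + du m x * k\<^sup>2 / 2) * n1 x
      + (w * n2 x + m x * k * v) * wv - (w * wv + m x * k * q + dv m x * k\<^sup>2 / 2) * n2 x
      = - (m x * Z m x * k\<^sup>2 / 2)"
  proof -
    have "(w * n1 x + m x * k * u) * wu - (w * wu + m x * k * p + du m x * k\<^sup>2 / 2) * n1 x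
      + (w * n2 x + m x * k * v) * wv - (w * wv + m x * k * q + dv m x * k\<^sup>2 / 2) * n2 x
      = m x * k * (u * wu + v * wv) - m x * k * (n1 x * p + n2 x * q)
        - (n1 x * du m x + n2 x * dv m x) * k\<^sup>2 / 2"
      by (simp add: field_simps)
    also have "\<dots> = - (m x * Z m x * k\<^sup>2 / 2)" by (simp add: h1 zm flip: w)
    finally show ?thesis .
  qed
  have a2: "(w * n1 x + m x * k * u) * p - (w * wu + m x * k * p + du m x * k\<^sup>2 / 2) * u
      + (w * n2 x + m x * k * v) * q - (w * wv + m x * k * q + dv m x * k\<^sup>2 / 2) * v = 0"
  proof -
    have "(w * n1 x + m x * k * u) * p - (w * wu + m x * k * p + du m x * k\<^sup>2 / 2) * u
      + (w * n2 x + m x * k * v) * q - (w * wv + m x * k * q + dv m x * k\<^sup>2 / 2) * v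
      = w * (n1 x * p + n2 x * q) - w * (u * wu + v * wv) - (u * du m x + v * dv m x) * k\<^sup>2 / 2"
      by (simp add: field_simps)
    then show ?thesis by (simp add: h1 h2 flip: w)
  qed
  have a3: "(w * n1 x + m x * k * u) * Bu + (w * n2 x + m x * k * v) * Bv
      = m x * ((w * Z be x + k * Y be x) * w ^ 3 + (w * Z si x + k * Y si x) * w\<^sup>2 * k
        + (w * Z ta x + k * Y ta x) * w * k\<^sup>2 + (w * Z de x + k * Y de x) * k ^ 3)"
  proof -
    have f: "(w * n1 x + m x * k * u) * du f x + (w * n2 x + m x * k * v) * dv f x
        = m x * (w * Z f x + k * Y f x)" for f
    proof -
      have "(w * n1 x + m x * k * u) * du f x + (w * n2 x + m x * k * v) * dv f x
        = w * (n1 x * du f x + n2 x * dv f x) + m x * k * (u * du f x + v * dv f x)"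
        by (simp add: algebra_simps)
      also have "u * du f x + v * dv f x = Y f x" by (simp add: Y_def xuv)
      finally show ?thesis unfolding zm by (simp add: algebra_simps)
    qed
    have "(w * n1 x + m x * k * u) * Bu + (w * n2 x + m x * k * v) * Bv
      = ((w * n1 x + m x * k * u) * du be x + (w * n2 x + m x * k * v) * dv be x) * w ^ 3
      + ((w * n1 x + m x * k * u) * du si x + (w * n2 x + m x * k * v) * dv si x) * w\<^sup>2 * k
      + ((w * n1 x + m x * k * u) * du ta x + (w * n2 x + m x * k * v) * dv ta x) * w * k\<^sup>2
      + ((w * n1 x + m x * k * u) * du de x + (w * n2 x + m x * k * v) * dv de x) * k ^ 3"
      unfolding Bu_def Bv_def by (simp add: algebra_simps)
    then show ?thesis unfolding f by (simp add: algebra_simps)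
  qed
  have "poisson (hamiltonian E F G) (cubic be si ta de) (x, (p, q)) =
      ((w * n1 x + m x * k * u) * Bu + (w * n2 x + m x * k * v) * Bv)
      + Jw * ((w * n1 x + m x * k * u) * wu - (w * wu + m x * k * p + du m x * k\<^sup>2 / 2) * n1 x
      + (w * n2 x + m x * k * v) * wv - (w * wv + m x * k * q + dv m x * k\<^sup>2 / 2) * n2 x)
      + Jk * ((w * n1 x + m x * k * u) * p - (w * wu + m x * k * p + du m x * k\<^sup>2 / 2) * u
      + (w * n2 x + m x * k * v) * q - (w * wv + m x * k * q + dv m x * k\<^sup>2 / 2) * v)"
    unfolding P by (simp only: algebra_simps)
  then show ?thesis unfolding a1 a2 a3 Jw_def
    by (simp add: field_simps power2_eq_square power3_eq_cube power4_eq_xxxx)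
qed

end

section \<open>Cubic integrals in the frame\<close>

lemma quartic_form_eq_0:
  fixes a b c d e :: real
  assumes "\<And>w k. a * w ^ 4 + b * w ^ 3 * k + c * w\<^sup>2 * k\<^sup>2 + d * w * k ^ 3 + e * k ^ 4 = 0"
  shows "a = 0 \<and> b = 0 \<and> c = 0 \<and> d = 0 \<and> e = 0"
  using assms[of 1 0] assms[of 0 1] assms[of 1 1] assms[of 1 "-1"] assms[of 2 1] by simp

context scale_invariant_metric
begin

definition frame_integral ::
  "(point \<Rightarrow> real) \<Rightarrow> (point \<Rightarrow> real) \<Rightarrow> (point \<Rightarrow> real) \<Rightarrow> (point \<Rightarrow> real) \<Rightarrow> bool" where
  "frame_integral be si ta de \<longleftrightarrow>
     smooth_on be U \<and> smooth_on si U \<and> smooth_on ta U \<and> smooth_on de U \<and>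
     (\<forall>x\<in>U. Z be x = 0 \<and> Z si x + Y be x = 0 \<and> Z ta x + Y si x - 3 / 2 * Z m x * be x = 0 \<and>
       Z de x + Y ta x - Z m x * si x = 0 \<and> Y de x - Z m x * ta x / 2 = 0)"

lemma momenta_of_frame:
  assumes "x \<in> U"
  obtains p q where "n1 x * p + n2 x * q = w" "fst x * p + snd x * q = k"
proof -
  define \<Delta> where "\<Delta> = fst x * n2 x - snd x * n1 x"
  have "R x * \<Delta> = N x" unfolding \<Delta>_def by (rule frame_det[OF assms])
  then have "\<Delta> \<noteq> 0" using N_pos[OF assms] by auto
  show thesis
  proof (rule that)
    have "n1 x * ((n2 x * k - snd x * w) / \<Delta>) + n2 x * ((fst x * w - n1 x * k) / \<Delta>)
        = \<Delta> * w / \<Delta>"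
      by (simp add: \<Delta>_def algebra_simps add_divide_distrib[symmetric] diff_divide_distrib[symmetric])
    then show "n1 x * ((n2 x * k - snd x * w) / \<Delta>) + n2 x * ((fst x * w - n1 x * k) / \<Delta>) = w"
      using \<open>\<Delta> \<noteq> 0\<close> by simp
    have "fst x * ((n2 x * k - snd x * w) / \<Delta>) + snd x * ((fst x * w - n1 x * k) / \<Delta>)
        = \<Delta> * k / \<Delta>"
      by (simp add: \<Delta>_def algebra_simps add_divide_distrib[symmetric] diff_divide_distrib[symmetric])
    then show "fst x * ((n2 x * k - snd x * w) / \<Delta>) + snd x * ((fst x * w - n1 x * k) / \<Delta>) = k"
      using \<open>\<Delta> \<noteq> 0\<close> by simp
  qed
qed

text \<open>At each point the pair \<open>(w, k)\<close> takes all values, so the bracket, a quartic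
  form in it, vanishes exactly if its five coefficients do.\<close>

lemma frame_integral_iff_poisson:
  assumes sm: "smooth_on be U" "smooth_on si U" "smooth_on ta U" "smooth_on de U"
  shows "frame_integral be si ta de \<longleftrightarrow>
    (\<forall>x\<in>U. \<forall>y. poisson (hamiltonian E F G) (cubic be si ta de) (x, y) = 0)"
proof
  assume *: "frame_integral be si ta de"
  show "\<forall>x\<in>U. \<forall>y. poisson (hamiltonian E F G) (cubic be si ta de) (x, y) = 0"
  proof (intro ballI allI)
    fix x and y :: point assume x: "x \<in> U"
    obtain p q where y: "y = (p, q)" by fastforce
    have e: "Z be x = 0" "Z si x + Y be x = 0" "Z ta x + Y si x - 3 / 2 * Z m x * be x = 0"
       "Z de x + Y ta x - Z m x * si x = 0" "Y de x - Z m x * ta x / 2 = 0"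
      using * x unfolding frame_integral_def by blast+
    show "poisson (hamiltonian E F G) (cubic be si ta de) (x, y) = 0"
      unfolding y poisson_frame[OF x sm refl refl] e by simp
  qed
next
  assume P: "\<forall>x\<in>U. \<forall>y. poisson (hamiltonian E F G) (cubic be si ta de) (x, y) = 0"
  show "frame_integral be si ta de"
    unfolding frame_integral_def
  proof (intro conjI sm ballI)
    fix x assume x: "x \<in> U"
    have "Z be x = 0 \<and> Z si x + Y be x = 0 \<and> Z ta x + Y si x - 3 / 2 * Z m x * be x = 0 \<and>
       Z de x + Y ta x - Z m x * si x = 0 \<and> Y de x - Z m x * ta x / 2 = 0"
    proof (rule quartic_form_eq_0)
      fix w k
      obtain p q where "n1 x * p + n2 x * q = w" "fst x * p + snd x * q = k"
        using momenta_of_frame[OF x] by blast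
      from poisson_frame[OF x sm this[symmetric]] P x
      have "m x * (Z be x * w ^ 4 + (Z si x + Y be x) * w ^ 3 * k
        + (Z ta x + Y si x - 3 / 2 * Z m x * be x) * w\<^sup>2 * k\<^sup>2
        + (Z de x + Y ta x - Z m x * si x) * w * k ^ 3 + (Y de x - Z m x * ta x / 2) * k ^ 4) = 0"
        by simp
      then show "Z be x * w ^ 4 + (Z si x + Y be x) * w ^ 3 * k
        + (Z ta x + Y si x - 3 / 2 * Z m x * be x) * w\<^sup>2 * k\<^sup>2
        + (Z de x + Y ta x - Z m x * si x) * w * k ^ 3 + (Y de x - Z m x * ta x / 2) * k ^ 4 = 0"
        using m_pos[OF x] by simp
    qed
    then show "Z be x = 0" "Z si x + Y be x = 0" "Z ta x + Y si x - 3 / 2 * Z m x * be x = 0"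
       "Z de x + Y ta x - Z m x * si x = 0" "Y de x - Z m x * ta x / 2 = 0"
      by blast+
  qed
qed

lemma cubic_apply:
  "x \<in> U \<Longrightarrow> cubic be si ta de (x, (p, q)) =
    be x * (n1 x * p + n2 x * q) ^ 3 + si x * (n1 x * p + n2 x * q)\<^sup>2 * (fst x * p + snd x * q)
    + ta x * (n1 x * p + n2 x * q) * (fst x * p + snd x * q)\<^sup>2 + de x * (fst x * p + snd x * q) ^ 3"
  by (simp add: cubic_def Let_def)

lemma cubic_outside: "x \<notin> U \<Longrightarrow> cubic be si ta de (x, y) = 0"
  by (cases y) (simp add: cubic_def Let_def)

lemmas smooth_ring = smooth_on_add[OF open_U] smooth_on_mult[OF open_U] smooth_on_diff[OF open_U]
  smooth_on_uminus[OF open_U] smooth_on_power[OF open_U] smooth_on_fst[OF open_U]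
  smooth_on_snd[OF open_U] smooth_on_const[OF open_U]

lemma frame_integral_imp_cubic_integral:
  assumes "frame_integral be si ta de"
  shows "cubic be si ta de \<in> cubic_integrals U E F G"
proof -
  have sm: "smooth_on be U" "smooth_on si U" "smooth_on ta U" "smooth_on de U"
    using assms by (simp_all add: frame_integral_def)
  let ?a = "\<lambda>x. be x * n1 x ^ 3 + si x * n1 x ^ 2 * fst x + ta x * n1 x * fst x ^ 2 + de x * fst x ^ 3"
  let ?b = "\<lambda>x. 3 * be x * n1 x ^ 2 * n2 x + si x * (n1 x ^ 2 * snd x + 2 * n1 x * n2 x * fst x)
    + ta x * (n2 x * fst x ^ 2 + 2 * n1 x * fst x * snd x) + 3 * de x * fst x ^ 2 * snd x"
  let ?c = "\<lambda>x. 3 * be x * n1 x * n2 x ^ 2 + si x * (n2 x ^ 2 * fst x + 2 * n1 x * n2 x * snd x)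
    + ta x * (n1 x * snd x ^ 2 + 2 * n2 x * fst x * snd x) + 3 * de x * fst x * snd x ^ 2"
  let ?d = "\<lambda>x. be x * n2 x ^ 3 + si x * n2 x ^ 2 * snd x + ta x * n2 x * snd x ^ 2 + de x * snd x ^ 3"
  have "smooth_on ?a U" "smooth_on ?b U" "smooth_on ?c U" "smooth_on ?d U"
    by (intro smooth_ring sm smooth_frame)+
  moreover have "\<forall>x\<in>U. \<forall>p q. cubic be si ta de (x, (p, q)) =
      ?a x * p ^ 3 + ?b x * p\<^sup>2 * q + ?c x * p * q\<^sup>2 + ?d x * q ^ 3"
    by (intro ballI allI)
      (simp add: cubic_apply algebra_simps power2_eq_square power3_eq_cube)
  ultimately show ?thesis
    using assms frame_integral_iff_poisson[OF sm] cubic_outside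
    unfolding cubic_integrals_def mem_Collect_eq by blast
qed

lemma cubic_integral_imp_frame_integral:
  assumes "J \<in> cubic_integrals U E F G"
  obtains be si ta de where "frame_integral be si ta de" "J = cubic be si ta de"
proof -
  obtain a b c d where sm: "smooth_on a U" "smooth_on b U" "smooth_on c U" "smooth_on d U"
    and J: "\<forall>x\<in>U. \<forall>p q. J (x, (p, q)) = a x * p ^ 3 + b x * p\<^sup>2 * q + c x * p * q\<^sup>2 + d x * q ^ 3"
    and P: "\<forall>x\<in>U. \<forall>y. poisson (hamiltonian E F G) J (x, y) = 0"
    and out: "\<forall>x y. x \<notin> U \<longrightarrow> J (x, y) = 0"
    using assms unfolding cubic_integrals_def by blast
  \<comment> \<open>The inverse of the frame matrix: p is \<open>P1 w + P2 k\<close> and q is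
    \<open>Q1 w + Q2 k\<close>. By \<open>frame_det\<close> the reciprocal of the determinant is
    \<open>R m\<close>.\<close>
  define P1 where "P1 x = - (snd x * R x * m x)" for x
  define P2 where "P2 x = n2 x * R x * m x" for x
  define Q1 where "Q1 x = fst x * R x * m x" for x
  define Q2 where "Q2 x = - (n1 x * R x * m x)" for x
  have smPQ: "smooth_on P1 U" "smooth_on P2 U" "smooth_on Q1 U" "smooth_on Q2 U"
    unfolding P1_def[abs_def] P2_def[abs_def] Q1_def[abs_def] Q2_def[abs_def]
    by (intro smooth_ring smooth_frame)+
  define be where "be x = a x * P1 x ^ 3 + b x * P1 x ^ 2 * Q1 x + c x * P1 x * Q1 x ^ 2 + d x * Q1 x ^ 3" for x
  define si where "si x = 3 * a x * P1 x ^ 2 * P2 x + b x * (P1 x ^ 2 * Q2 x + 2 * P1 x * P2 x * Q1 x)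
    + c x * (P2 x * Q1 x ^ 2 + 2 * P1 x * Q1 x * Q2 x) + 3 * d x * Q1 x ^ 2 * Q2 x" for x
  define ta where "ta x = 3 * a x * P1 x * P2 x ^ 2 + b x * (P2 x ^ 2 * Q1 x + 2 * P1 x * P2 x * Q2 x)
    + c x * (P1 x * Q2 x ^ 2 + 2 * P2 x * Q1 x * Q2 x) + 3 * d x * Q1 x * Q2 x ^ 2" for x
  define de where "de x = a x * P2 x ^ 3 + b x * P2 x ^ 2 * Q2 x + c x * P2 x * Q2 x ^ 2 + d x * Q2 x ^ 3" for x
  have smf: "smooth_on be U" "smooth_on si U" "smooth_on ta U" "smooth_on de U"
    unfolding be_def[abs_def] si_def[abs_def] ta_def[abs_def] de_def[abs_def]
    by (intro smooth_ring smPQ sm)+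
  have "J (x, y) = cubic be si ta de (x, y)" for x y
  proof (cases "x \<in> U")
    case True
    obtain p q where y: "y = (p, q)" by fastforce
    define w k where "w = n1 x * p + n2 x * q" and "k = fst x * p + snd x * q"
    have det: "(fst x * n2 x - snd x * n1 x) * R x * m x = 1"
      using frame_det[OF True] m_N[OF True] by (simp add: mult.commute)
    have "P1 x * w + P2 x * k = p * ((fst x * n2 x - snd x * n1 x) * R x * m x)"
      "Q1 x * w + Q2 x * k = q * ((fst x * n2 x - snd x * n1 x) * R x * m x)"
      by (simp_all add: P1_def P2_def Q1_def Q2_def w_def k_def algebra_simps)
    then have pq: "p = P1 x * w + P2 x * k" "q = Q1 x * w + Q2 x * k" unfolding det by simp_all
    have "J (x, (p, q)) = a x * (P1 x * w + P2 x * k) ^ 3 + b x * (P1 x * w + P2 x * k)\<^sup>2 * (Q1 x * w + Q2 x * k)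
        + c x * (P1 x * w + P2 x * k) * (Q1 x * w + Q2 x * k)\<^sup>2 + d x * (Q1 x * w + Q2 x * k) ^ 3"
      unfolding pq[symmetric] using J True by blast
    also have "\<dots> = be x * w ^ 3 + si x * w\<^sup>2 * k + ta x * w * k\<^sup>2 + de x * k ^ 3"
      by (simp add: be_def si_def ta_def de_def algebra_simps power2_eq_square power3_eq_cube)
    finally show ?thesis unfolding y cubic_apply[OF True] w_def k_def .
  next
    case False
    then show ?thesis using out[rule_format, OF False] cubic_outside[OF False] by metis
  qed
  then have eq: "J = cubic be si ta de" by (intro ext) (metis prod.collapse)
  moreover have "frame_integral be si ta de"
    using P frame_integral_iff_poisson[OF smf] unfolding eq by blast
  ultimately show thesis using that by blast
qed

text \<open>Each of the three foliations \<open>v = const\<close>, \<open>u = const\<close>, \<open>u + v = const\<close> is geodesic, which makes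
  the logarithmic derivative of each factor of \<open>u' v' (u' + v')\<close> linear in the velocity. These sum up
  to the logarithmic derivative of \<open>1 / D\<close>.\<close>

definition web :: "phase \<Rightarrow> real" where
  "web = (\<lambda>(x, (p, q)). let a = G x * p - F x * q; b = E x * q - F x * p in a * b * (a + b) / (D x)\<^sup>2)"

lemma DERIV_web:
  assumes "(a has_real_derivative a') (at t)" "(b has_real_derivative b') (at t)"
    "(d has_real_derivative d') (at t)" "d t \<noteq> 0"
  shows "((\<lambda>t. a t * b t * (a t + b t) / (d t)\<^sup>2) has_real_derivative
    (2 * a t * b t + (b t)\<^sup>2) / (d t)\<^sup>2 * a' + ((a t)\<^sup>2 + 2 * a t * b t) / (d t)\<^sup>2 * b'
    - 2 * a t * b t * (a t + b t) / (d t) ^ 3 * d') (at t)"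
  by (rule DERIV_cong[OF DERIV_divide[OF DERIV_mult[OF DERIV_mult[OF assms(1,2)]
          DERIV_add[OF assms(1,2)]] DERIV_mult[OF assms(3,3)]], folded power2_eq_square])
    (use assms(4) in \<open>simp_all add: field_simps power2_eq_square power3_eq_cube\<close>)

lemma DERIV_ham:
  assumes "(p has_real_derivative p') (at t)" "(q has_real_derivative q') (at t)"
    "(a has_real_derivative a') (at t)" "(b has_real_derivative b') (at t)"
    "(d has_real_derivative d') (at t)" "d t \<noteq> 0"
  shows "((\<lambda>t. (p t * a t + q t * b t) / (2 * d t)) has_real_derivative
    (p' * a t + q' * b t + p t * a' + q t * b') / (2 * d t)
      - (p t * a t + q t * b t) * d' / (2 * (d t)\<^sup>2)) (at t)"
  by (rule DERIV_cong[OF DERIV_divide[OF DERIV_add[OF DERIV_mult[OF assms(1,3)]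
          DERIV_mult[OF assms(2,4)]] DERIV_cmult[OF assms(5)]]])
    (use assms(6) in \<open>simp_all add: field_simps power2_eq_square\<close>)

lemma hamiltonian_eq:
  "hamiltonian E F G (x, (p, q)) = (p * (G x * p - F x * q) + q * (E x * q - F x * p)) / (2 * D x)"
  by (simp add: hamiltonian_def D_def algebra_simps power2_eq_square)

lemma poisson_web:
  assumes x: "x \<in> U"
  shows "poisson (hamiltonian E F G) web (x, (p, q)) = 0"
proof -
  obtain u v where xuv: "x = (u, v)" by fastforce
  have xU: "(u, v) \<in> U" using x xuv by simp
  have D0: "D (u, v) \<noteq> 0" using D_pos[OF xU] by simp
  note pb = smooth_on_partials[OF open_U _ xU]
  have dc: "((\<lambda>t. c) has_real_derivative 0) (at z)" for c z :: real by simp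
  define e f g where "e = E x" and "f = F x" and "g = G x"
  define eu fu gu ev fv gv where "eu = du E x" and "fu = du F x" and "gu = du G x"
    and "ev = dv E x" and "fv = dv F x" and "gv = dv G x"
  define a b where "a = g * p - f * q" and "b = e * q - f * p"
  define au bu av bv where "au = gu * p - fu * q" and "bu = eu * q - fu * p"
    and "av = gv * p - fv * q" and "bv = ev * q - fv * p"
  define d where "d = e * g - f\<^sup>2"
  have dD: "D x = d" by (simp add: d_def D_def e_def f_def g_def)
  define Du Dv where "Du = eu * g + e * gu - 2 * f * fu" and "Dv = ev * g + e * gv - 2 * f * fv"
  have A: "((\<lambda>t. G (t, v) * p - F (t, v) * q) has_real_derivative au) (at u)"
    "((\<lambda>t. G (u, t) * p - F (u, t) * q) has_real_derivative av) (at v)"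
    "((\<lambda>t. G (u, v) * t - F (u, v) * q) has_real_derivative g) (at p)"
    "((\<lambda>t. G (u, v) * p - F (u, v) * t) has_real_derivative - f) (at q)"
    unfolding au_def av_def f_def g_def gu_def fu_def gv_def fv_def xuv
    by (auto intro!: derivative_eq_intros pb smooth_EFG)
  have B: "((\<lambda>t. E (t, v) * q - F (t, v) * p) has_real_derivative bu) (at u)"
    "((\<lambda>t. E (u, t) * q - F (u, t) * p) has_real_derivative bv) (at v)"
    "((\<lambda>t. E (u, v) * q - F (u, v) * t) has_real_derivative - f) (at p)"
    "((\<lambda>t. E (u, v) * t - F (u, v) * p) has_real_derivative e) (at q)"
    unfolding bu_def bv_def f_def e_def eu_def fu_def ev_def fv_def xuv
    by (auto intro!: derivative_eq_intros pb smooth_EFG)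
  have DD: "((\<lambda>t. D (t, v)) has_real_derivative Du) (at u)" "((\<lambda>t. D (u, t)) has_real_derivative Dv) (at v)"
    unfolding D_def Du_def Dv_def e_def f_def g_def eu_def fu_def gu_def ev_def fv_def gv_def xuv
    by (auto intro!: derivative_eq_intros pb smooth_EFG)
  have DP: "((\<lambda>t. t) has_real_derivative 1) (at z)" for z :: real by simp
  \<comment> \<open>The components of the velocity. In terms of them \<open>web\<close> is
    \<open>d V W (V + W)\<close>, and the remaining computation is polynomial.\<close>
  define V W where "V = a / d" and "W = b / d"
  have d0: "d \<noteq> 0" using D0 dD xuv by simp
  have ab: "a = d * V" "b = d * W" using d0 by (simp_all add: V_def W_def)
  have pq: "p = e * V + f * W" "q = f * V + g * W"
  proof -
    have "d * p = e * a + f * b" "d * q = f * a + g * b"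
      by (simp_all add: a_def b_def d_def algebra_simps power2_eq_square)
    then show "p = e * V + f * W" "q = f * V + g * W"
      using d0 by (simp_all add: V_def W_def nonzero_eq_divide_eq add_divide_distrib[symmetric] mult.commute)
  qed
  \<comment> \<open>At fixed momentum, the position derivatives of \<open>H\<close> are the
    negatives of those of the kinetic energy at fixed velocity.\<close>
  define Hu Hv where "Hu = - (eu * V\<^sup>2 + 2 * fu * V * W + gu * W\<^sup>2) / 2"
    and "Hv = - (ev * V\<^sup>2 + 2 * fv * V * W + gv * W\<^sup>2) / 2"
  have hu: "(p * au + q * bu) / (2 * d) - (p * a + q * b) * Du / (2 * d\<^sup>2) = Hu"
  proof -
    have "p * au + q * bu - (p * V + q * W) * Du = 2 * d * Hu"
      unfolding au_def bu_def Hu_def Du_def pq d_def by (simp add: algebra_simps power2_eq_square)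
    then show ?thesis using d0 unfolding ab by (simp add: field_simps power2_eq_square)
  qed
  have hv: "(p * av + q * bv) / (2 * d) - (p * a + q * b) * Dv / (2 * d\<^sup>2) = Hv"
  proof -
    have "p * av + q * bv - (p * V + q * W) * Dv = 2 * d * Hv"
      unfolding av_def bv_def Hv_def Dv_def pq d_def by (simp add: algebra_simps power2_eq_square)
    then show ?thesis using d0 unfolding ab by (simp add: field_simps power2_eq_square)
  qed
  have hp: "(a + (p * g + q * - f)) / (2 * d) = V" "(b + (p * - f + q * e)) / (2 * d) = W"
    using d0 by (simp_all add: V_def W_def a_def b_def field_simps)
  define TA TB TD where "TA = 2 * V * W + W\<^sup>2" and "TB = V\<^sup>2 + 2 * V * W" and "TD = - 2 * V * W * (V + W)"
  have T: "(2 * a * b + b\<^sup>2) / d\<^sup>2 = TA" "(a\<^sup>2 + 2 * a * b) / d\<^sup>2 = TB"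
    "2 * a * b * (a + b) / d ^ 3 = - TD"
    using d0 unfolding ab TA_def TB_def TD_def by (simp_all add: field_simps power2_eq_square power3_eq_cube)
  have H: "((\<lambda>t. hamiltonian E F G ((t, v), (p, q))) has_real_derivative Hu) (at u)"
    "((\<lambda>t. hamiltonian E F G ((u, t), (p, q))) has_real_derivative Hv) (at v)"
    "((\<lambda>t. hamiltonian E F G ((u, v), (t, q))) has_real_derivative V) (at p)"
    "((\<lambda>t. hamiltonian E F G ((u, v), (p, t))) has_real_derivative W) (at q)"
    unfolding hamiltonian_eq hu[symmetric] hv[symmetric] hp[symmetric]
    using DERIV_ham[OF dc[of p] dc[of q] A(1) B(1) DD(1) D0] DERIV_ham[OF dc[of p] dc[of q] A(2) B(2) DD(2) D0]
      DERIV_ham[OF DP dc[of q] A(3) B(3) dc[of "D (u, v)"] D0] DERIV_ham[OF dc[of p] DP A(4) B(4) dc[of "D (u, v)"] D0]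
    by (simp_all add: a_def b_def e_def f_def g_def xuv dD[unfolded xuv])
  have W: "((\<lambda>t. web ((t, v), (p, q))) has_real_derivative TA * au + TB * bu + TD * Du) (at u)"
    "((\<lambda>t. web ((u, t), (p, q))) has_real_derivative TA * av + TB * bv + TD * Dv) (at v)"
    "((\<lambda>t. web ((u, v), (t, q))) has_real_derivative TA * g + TB * - f) (at p)"
    "((\<lambda>t. web ((u, v), (p, t))) has_real_derivative TA * - f + TB * e) (at q)"
  proof -
    have ab': "G (u, v) * p - F (u, v) * q = a" "E (u, v) * q - F (u, v) * p = b"
      by (simp_all add: a_def b_def e_def f_def g_def xuv)
    note T' = T[folded ab' dD[unfolded xuv]]
    show "((\<lambda>t. web ((t, v), (p, q))) has_real_derivative TA * au + TB * bu + TD * Du) (at u)"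
      "((\<lambda>t. web ((u, t), (p, q))) has_real_derivative TA * av + TB * bv + TD * Dv) (at v)"
      "((\<lambda>t. web ((u, v), (t, q))) has_real_derivative TA * g + TB * - f) (at p)"
      "((\<lambda>t. web ((u, v), (p, t))) has_real_derivative TA * - f + TB * e) (at q)"
      using DERIV_web[OF A(1) B(1) DD(1) D0] DERIV_web[OF A(2) B(2) DD(2) D0]
        DERIV_web[OF A(3) B(3) dc[of "D (u, v)"] D0] DERIV_web[OF A(4) B(4) dc[of "D (u, v)"] D0]
      unfolding T' by (simp_all add: web_def Let_def)
  qed
  have s: "2 * e * fu - f * eu - e * ev = 0" "2 * g * fv - f * gv - g * gu = 0"
    "g * eu + e * gv - 2 * f * (fu + fv) + (3 * f - 2 * g) * ev + (3 * f - 2 * e) * gu = 0"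
    using system x unfolding solves_system_def e_def f_def g_def eu_def fu_def gu_def ev_def fv_def gv_def
    by blast+
  \<comment> \<open>These are \<open>d\<close> times the Christoffel symbols with indices u;uu,
    u;uv, v;vv and v;uv. The first two equations of the system say that the symbols v;uu and u;vv
    vanish. The third one is \<open>al2\<close>, the condition that the lines u + v = const are
    geodesics.\<close>
  define al be ga de where "al = (g * eu - 2 * f * fu + f * ev) / 2" and "be = (g * ev - f * gu) / 2"
    and "ga = (e * gv - 2 * f * fv + f * gu) / 2" and "de = (e * gu - f * ev) / 2"
  have al2: "2 * (be + de) = al + ga" using s(3) unfolding al_def be_def ga_def de_def by argo
  have Du2: "Du = 2 * (al + de)" "Dv = 2 * (be + ga)"
    unfolding Du_def Dv_def al_def be_def ga_def de_def by argo+
  define Dd where "Dd = Du * V + Dv * W"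
  \<comment> \<open>The bracket of \<open>H\<close> with \<open>a\<close>, and below with
    \<open>b\<close>. Each is divisible by its own velocity component because the coordinate lines
    are geodesics.\<close>
  have dA: "V * au + W * av - Hu * g + Hv * f = V * (Dd - al * V - 2 * be * W)"
  proof -
    have "V * au + W * av - Hu * g + Hv * f = V * (Dd - al * V - 2 * be * W)
        - W\<^sup>2 * (2 * g * fv - f * gv - g * gu) / 2"
      unfolding au_def av_def Hu_def Hv_def pq Dd_def Du_def Dv_def al_def be_def
      by (simp add: field_simps power2_eq_square)
    then show ?thesis unfolding s by simp
  qed
  have dB: "V * bu + W * bv + Hu * f - Hv * e = W * (Dd - 2 * de * V - ga * W)"
  proof -
    have "V * bu + W * bv + Hu * f - Hv * e = W * (Dd - 2 * de * V - ga * W)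
        - V\<^sup>2 * (2 * e * fu - f * eu - e * ev) / 2"
      unfolding bu_def bv_def Hu_def Hv_def pq Dd_def Du_def Dv_def de_def ga_def
      by (simp add: field_simps power2_eq_square)
    then show ?thesis unfolding s by simp
  qed
  have "poisson (hamiltonian E F G) web ((u, v), (p, q)) =
      V * (TA * au + TB * bu + TD * Du) - Hu * (TA * g + TB * - f)
      + W * (TA * av + TB * bv + TD * Dv) - Hv * (TA * - f + TB * e)"
    by (rule poisson_eqI[OF H W])
  also have "\<dots> = TA * (V * au + W * av - Hu * g + Hv * f) + TB * (V * bu + W * bv + Hu * f - Hv * e)
      + TD * Dd"
    by (simp add: Dd_def algebra_simps)
  also have "\<dots> = 0"
  proof -
    have g: "ga = 2 * (be + de) - al" using al2 by simp
    show ?thesis unfolding dA dB TA_def TB_def TD_def unfolding Dd_def Du2 g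
      by (simp add: algebra_simps power2_eq_square)
  qed
  finally show ?thesis by (simp add: xuv)
qed

end

section \<open>Local coordinates adapted to the frame\<close>

lemma primitive_exists:
  fixes f :: "real \<Rightarrow> real"
  assumes "continuous_on {-a..a} f"
  obtains g where "g 0 = 0" "\<And>t. \<bar>t\<bar> < a \<Longrightarrow> (g has_real_derivative f t) (at t)"
proof -
  obtain h where h: "\<And>x. x \<in> {-a..a} \<Longrightarrow> (h has_vector_derivative f x) (at x within {-a..a})"
    using antiderivative_continuous[OF assms] by blast
  show thesis
  proof (rule that[of "\<lambda>t. h t - h 0"])
    fix t assume t: "\<bar>t\<bar> < a"
    then have i: "t \<in> interior {-a..a}" by (auto simp: abs_less_iff)
    have "(h has_real_derivative f t) (at t)"
      using h[of t] t at_within_interior[OF i]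
      by (auto simp: has_real_derivative_iff_has_vector_derivative abs_less_iff)
    then show "((\<lambda>t. h t - h 0) has_real_derivative f t) (at t)"
      by (auto intro!: derivative_eq_intros)
  qed simp
qed

text \<open>Separation of variables: a primitive \<open>T\<close> of \<open>1 / f\<close> gives time
  as a function of position, and the solution is its inverse.\<close>

lemma autonomous_ode_solution:
  fixes f :: "real \<Rightarrow> real"
  assumes a: "a > 0" and cont: "continuous_on {-a..a} f" and pos: "\<And>t. \<bar>t\<bar> \<le> a \<Longrightarrow> f t > 0"
  obtains d g where "d > 0" "g 0 = 0"
    "\<And>z. \<bar>z\<bar> < d \<Longrightarrow> \<bar>g z\<bar> < a \<and> (g has_real_derivative f (g z)) (at z)"
proof -
  have "continuous_on {-a..a} (\<lambda>t. 1 / f t)"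
  proof (intro continuous_intros cont ballI)
    show "f x \<noteq> 0" if "x \<in> {-a..a}" for x using pos[of x] that by (auto simp: abs_le_iff)
  qed
  then obtain T where T: "T 0 = 0" "\<And>t. \<bar>t\<bar> < a \<Longrightarrow> (T has_real_derivative 1 / f t) (at t)"
    using primitive_exists by blast
  define b where "b = a / 2"
  have b: "0 < b" "b < a" using a by (simp_all add: b_def)
  have inc: "T s < T t" if "-b \<le> s" "s < t" "t \<le> b" for s t
  proof (rule DERIV_pos_imp_increasing[OF that(2)])
    fix x assume "s \<le> x" "x \<le> t"
    then have x: "\<bar>x\<bar> < a" using that b by (auto simp: abs_less_iff)
    have "1 / f x > 0" using pos[of x] x by simp
    then show "\<exists>y. (T has_real_derivative y) (at x) \<and> 0 < y" using T(2)[OF x] by blast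
  qed
  have Tc: "isCont T t" if "\<bar>t\<bar> < a" for t using T(2)[OF that] by (rule DERIV_isCont)
  have inj: "inj_on T {-b..b}"
  proof (rule inj_onI)
    fix s t assume "s \<in> {-b..b}" "t \<in> {-b..b}" "T s = T t"
    then show "s = t" using inc[of s t] inc[of t s] by (cases s t rule: linorder_cases) auto
  qed
  define g where "g = the_inv_into {-b..b} T"
  have gT: "g (T t) = t" if "-b \<le> t" "t \<le> b" for t
    unfolding g_def using the_inv_into_f_f[OF inj] that by simp
  define d where "d = min (T b) (- T (-b))"
  have d: "d > 0" using inc[of 0 b] inc[of "-b" 0] b T(1) by (simp add: d_def)
  have ex: "\<exists>t. - b < t \<and> t < b \<and> T t = z" if "\<bar>z\<bar> < d" for z
  proof -
    have z: "T (-b) < z" "z < T b" using that by (auto simp: d_def abs_less_iff)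
    have "\<exists>t\<ge>-b. t \<le> b \<and> T t = z"
    proof (rule IVT)
      show "\<forall>x. - b \<le> x \<and> x \<le> b \<longrightarrow> isCont T x" using Tc b by (auto simp: abs_less_iff)
    qed (use z b in auto)
    then obtain t where "-b \<le> t" "t \<le> b" "T t = z" by blast
    moreover have "t \<noteq> -b" "t \<noteq> b" using z \<open>T t = z\<close> by auto
    ultimately show ?thesis by (intro exI[of _ t]) simp
  qed
  have Tg: "T (g z) = z" if "\<bar>z\<bar> < d" for z
    using ex[OF that] gT by force
  show thesis
  proof (rule that[OF d])
    show "g 0 = 0" using gT[of 0] b T(1) by simp
    fix z assume z: "\<bar>z\<bar> < d"
    obtain t where t: "-b < t" "t < b" "T t = z" using ex[OF z] by blast
    have gz: "g z = t" using gT[of t] t by simp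
    have ta: "\<bar>t\<bar> < a" using t b by (auto simp: abs_less_iff)
    have "isCont g (T t)"
    proof (rule isCont_inverse_function2[of "-b" t b])
      show "\<And>x. -b \<le> x \<Longrightarrow> x \<le> b \<Longrightarrow> g (T x) = x" by (rule gT)
      show "\<And>x. -b \<le> x \<Longrightarrow> x \<le> b \<Longrightarrow> isCont T x" using Tc b by (auto simp: abs_less_iff)
    qed (use t in auto)
    then have cg: "isCont g z" using t by simp
    have ft: "f t > 0" using pos[of t] ta by simp
    have "(g has_real_derivative inverse (1 / f t)) (at z)"
    proof (rule DERIV_inverse_function[where f=T and a="-d" and b=d])
      show "(T has_real_derivative 1 / f t) (at (g z))" using T(2)[OF ta] gz by simp
      show "\<And>y. -d < y \<Longrightarrow> y < d \<Longrightarrow> T (g y) = y" using Tg by (auto simp: abs_less_iff)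
    qed (use z cg ft in \<open>auto simp: abs_less_iff\<close>)
    then show "\<bar>g z\<bar> < a \<and> (g has_real_derivative f (g z)) (at z)" using ta gz ft by simp
  qed
qed

lemma DERIV_along_curve:
  assumes "open U" "smooth_on f U" "(a t, b t) \<in> U"
    and a: "(a has_real_derivative a') (at t)" and b: "(b has_real_derivative b') (at t)"
  shows "((\<lambda>t. f (a t, b t)) has_real_derivative a' * du f (a t, b t) + b' * dv f (a t, b t)) (at t)"
proof -
  have "((\<lambda>t. (a t, b t)) has_derivative (\<lambda>h. (a' * h, b' * h))) (at t)"
    using a b by (auto intro!: derivative_eq_intros simp: has_field_derivative_def)
  from has_derivative_compose[OF this smooth_on_has_derivative[OF assms(1-3)]]
  show ?thesis unfolding has_field_derivative_def
    by (rule has_derivative_eq_rhs) (simp add: fun_eq_iff algebra_simps)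
qed

context scale_invariant_metric
begin

text \<open>Differentiability of \<open>\<Phi>\<close> is recorded through its effect on smooth
  functions, the only form in which it is used: \<open>Z\<close> and \<open>Y\<close> become the two
  partial derivatives. Openness of the map takes the place of an inverse.\<close>

definition chart :: "real \<Rightarrow> (real \<Rightarrow> real \<Rightarrow> point) \<Rightarrow> bool" where
  "chart d \<Phi> \<longleftrightarrow> d > 0 \<and> (\<forall>z y. \<bar>z\<bar> < d \<longrightarrow> \<bar>y\<bar> < d \<longrightarrow> \<Phi> z y \<in> U) \<and>
    (\<forall>f z y. smooth_on f U \<longrightarrow> \<bar>z\<bar> < d \<longrightarrow> \<bar>y\<bar> < d \<longrightarrow>
      ((\<lambda>z. f (\<Phi> z y)) has_real_derivative Z f (\<Phi> z y)) (at z) \<and>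
      ((\<lambda>y. f (\<Phi> z y)) has_real_derivative Y f (\<Phi> z y)) (at y)) \<and>
    continuous_on ({-d<..<d} \<times> {-d<..<d}) (\<lambda>(z, y). \<Phi> z y) \<and>
    (\<forall>S. open S \<longrightarrow> S \<subseteq> {-d<..<d} \<times> {-d<..<d} \<longrightarrow> open ((\<lambda>(z, y). \<Phi> z y) ` S))"

text \<open>Scaling makes the flows explicit. \<open>Y\<close> generates the dilations. Let
  \<open>t\<close> parametrize the line through \<open>x0\<close> orthogonal to its position vector
  and let \<open>exp s\<close> be the dilation factor; then \<open>Z\<close> has components
  depending on \<open>t\<close> alone, so its flow is an autonomous equation for \<open>t\<close>
  followed by a quadrature for \<open>s\<close>.\<close>

lemma chart_exists:
  assumes x0: "x0 \<in> U"
  obtains d \<Phi> where "chart d \<Phi>" "\<Phi> 0 0 = x0"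
proof -
  obtain u0 v0 where x0uv: "x0 = (u0, v0)" by fastforce
  define r where "r = u0\<^sup>2 + v0\<^sup>2"
  have "(u0, v0) \<noteq> (0, 0)" using x0 x0uv origin_notin by auto
  then have r: "r > 0" by (simp add: r_def sum_power2_gt_zero_iff)
  define \<Psi> where "\<Psi> s t = (exp s * (u0 - t * v0), exp s * (v0 + t * u0))" for s t :: real
  have \<Psi>0: "\<Psi> 0 0 = x0" by (simp add: \<Psi>_def x0uv)
  have contP: "continuous_on UNIV (\<lambda>p. \<Psi> (fst p) (snd p))"
    unfolding \<Psi>_def by (intro continuous_intros)
  have "open ((\<lambda>p. \<Psi> (fst p) (snd p)) -` U)"
    using continuous_on_open_vimage[OF open_UNIV, of "\<lambda>p. \<Psi> (fst p) (snd p)"] contP open_U by auto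
  moreover have "(0, 0) \<in> (\<lambda>p. \<Psi> (fst p) (snd p)) -` U" using \<Psi>0 x0 by simp
  ultimately obtain A B where AB: "open A" "open B" "0 \<in> A" "0 \<in> B"
    "A \<times> B \<subseteq> (\<lambda>p. \<Psi> (fst p) (snd p)) -` U"
    using open_prod_elim[of "(\<lambda>p. \<Psi> (fst p) (snd p)) -` U" "(0, 0)"] by (metis mem_Sigma_iff)
  obtain e1 where e1: "e1 > 0" "ball 0 e1 \<subseteq> A" using AB openE by blast
  obtain e2 where e2: "e2 > 0" "ball 0 e2 \<subseteq> B" using AB openE by blast
  define e where "e = min e1 e2"
  have e: "e > 0" using e1 e2 by (simp add: e_def)
  have PU: "\<Psi> s t \<in> U" if "\<bar>s\<bar> < e" "\<bar>t\<bar> < e" for s t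
  proof -
    have "s \<in> ball 0 e1" "t \<in> ball 0 e2" using that by (simp_all add: e_def dist_norm)
    then have "(s, t) \<in> A \<times> B" using e1 e2 by blast
    then show ?thesis using AB(5) by auto
  qed
  have dY: "((\<lambda>s. f (\<Psi> (s + c) t)) has_real_derivative Y f (\<Psi> (s + c) t)) (at s)"
    if "smooth_on f U" "\<bar>s + c\<bar> < e" "\<bar>t\<bar> < e" for f s t c
  proof -
    have 1: "((\<lambda>s. exp (s + c) * (u0 - t * v0)) has_real_derivative exp (s + c) * (u0 - t * v0)) (at s)"
      "((\<lambda>s. exp (s + c) * (v0 + t * u0)) has_real_derivative exp (s + c) * (v0 + t * u0)) (at s)"
      by (auto intro!: derivative_eq_intros)
    show ?thesis
      using DERIV_along_curve[where a="\<lambda>s. exp (s + c) * (u0 - t * v0)"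
          and b="\<lambda>s. exp (s + c) * (v0 + t * u0)", OF open_U that(1) _ 1] PU[OF that(2,3)]
      by (simp add: \<Psi>_def Y_def)
  qed
  define Zu where "Zu x = N x * n1 x" for x
  define Zv where "Zv x = N x * n2 x" for x
  have Zf: "Z f x = Zu x * du f x + Zv x * dv f x" for f x
    by (simp add: Z_def Zu_def Zv_def algebra_simps)
  have hZ: "homogeneous 1 Zu" "homogeneous 1 Zv"
    using homogeneous_mult[OF homogeneous_N homogeneous_n(1)] homogeneous_mult[OF homogeneous_N homogeneous_n(2)]
    by (simp_all add: Zu_def[abs_def] Zv_def[abs_def])
  have scale: "f (\<Psi> s t) = exp s * f (\<Psi> 0 t)" if f: "homogeneous 1 f" and s: "\<bar>s\<bar> < e" and t: "\<bar>t\<bar> < e" for f s t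
  proof -
    define h where "h s = f (\<Psi> s t) * exp (- s)" for s
    have "(h has_real_derivative 0) (at x)" if "x \<in> {-e<..<e}" for x
    proof -
      have x: "\<bar>x\<bar> < e" using that by (simp add: abs_less_iff)
      have "((\<lambda>s. f (\<Psi> s t)) has_real_derivative f (\<Psi> x t)) (at x)"
        using dY[OF homogeneous_imp_smooth[OF f], of x 0 t] x t homogeneousD[OF f PU[OF x t]] by simp
      then show ?thesis unfolding h_def by (auto intro!: derivative_eq_intros)
    qed
    then have "\<exists>c. \<forall>x\<in>{-e<..<e}. h x = c"
      by (intro has_field_derivative_zero_constant) (auto simp: has_field_derivative_at_within)
    then obtain c where c: "\<And>x. x \<in> {-e<..<e} \<Longrightarrow> h x = c" by blast
    have "h s = h 0" using c[of s] c[of 0] s e by (simp add: abs_less_iff)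
    then show ?thesis by (simp add: h_def exp_minus field_simps)
  qed
  \<comment> \<open>Cramer's rule: on the line s = 0 the field \<open>Z\<close> is
    \<open>\<eta>\<close> times the position vector plus \<open>\<zeta>\<close> times
    \<open>(- v0, u0)\<close>, and the determinant is \<open>r\<close>. By \<open>scale\<close> the
    same \<open>\<zeta>\<close> and \<open>\<eta>\<close> serve for all \<open>s\<close>.\<close>
  define \<zeta> where "\<zeta> t = ((u0 - t * v0) * Zv (\<Psi> 0 t) - (v0 + t * u0) * Zu (\<Psi> 0 t)) / r" for t
  define \<eta> where "\<eta> t = (Zu (\<Psi> 0 t) * u0 + Zv (\<Psi> 0 t) * v0) / r" for t
  define a where "a = e / 2"
  have a: "a > 0" "a < e" using e by (simp_all add: a_def)
  have cZ: "continuous_on {-a..a} (\<lambda>t. f (\<Psi> 0 t))" if "homogeneous 1 f" for f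
  proof (rule continuous_on_compose2[OF smooth_on_continuous_on[OF homogeneous_imp_smooth[OF that]]])
    show "continuous_on {-a..a} (\<Psi> 0)" unfolding \<Psi>_def by (intro continuous_intros)
    show "\<Psi> 0 ` {-a..a} \<subseteq> U" using PU[of 0] e a by (auto simp: abs_less_iff)
  qed
  have c\<zeta>: "continuous_on {-a..a} \<zeta>" and c\<eta>: "continuous_on {-a..a} \<eta>"
    unfolding \<zeta>_def \<eta>_def using r by (intro continuous_intros cZ hZ; simp)+
  have pos: "\<zeta> t > 0" if "\<bar>t\<bar> \<le> a" for t
  proof -
    have xU: "\<Psi> 0 t \<in> U" using PU[of 0 t] that a e by simp
    have "(u0 - t * v0) * Zv (\<Psi> 0 t) - (v0 + t * u0) * Zu (\<Psi> 0 t)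
      = N (\<Psi> 0 t) * (fst (\<Psi> 0 t) * n2 (\<Psi> 0 t) - snd (\<Psi> 0 t) * n1 (\<Psi> 0 t))"
      unfolding Zu_def Zv_def by (simp add: \<Psi>_def algebra_simps)
    moreover have "fst (\<Psi> 0 t) * n2 (\<Psi> 0 t) - snd (\<Psi> 0 t) * n1 (\<Psi> 0 t) > 0"
      using frame_det[OF xU] R_pos[OF xU] N_pos[OF xU] by (metis zero_less_mult_pos)
    ultimately show ?thesis using N_pos[OF xU] r by (simp add: \<zeta>_def)
  qed
  obtain d1 g where g: "d1 > 0" "g 0 = 0"
    "\<And>z. \<bar>z\<bar> < d1 \<Longrightarrow> \<bar>g z\<bar> < a \<and> (g has_real_derivative \<zeta> (g z)) (at z)"
    using autonomous_ode_solution[OF a(1) c\<zeta> pos] by blast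
  have "continuous_on {-a..a} (\<lambda>t. \<eta> t / \<zeta> t)"
  proof (intro continuous_intros c\<zeta> c\<eta> ballI)
    show "\<zeta> x \<noteq> 0" if "x \<in> {-a..a}" for x using pos[of x] that by (auto simp: abs_le_iff)
  qed
  \<comment> \<open>\<open>W\<close> is the change of \<open>s\<close> as a function of
    \<open>t\<close> along a flow line of \<open>Z\<close>.\<close>
  then obtain W where W: "W 0 = 0" "\<And>t. \<bar>t\<bar> < a \<Longrightarrow> (W has_real_derivative \<eta> t / \<zeta> t) (at t)"
    using primitive_exists by blast
  define S where "S z = W (g z)" for z
  have dS: "(S has_real_derivative \<eta> (g z)) (at z)" if "\<bar>z\<bar> < d1" for z
  proof -
    have ga: "\<bar>g z\<bar> < a" using g(3)[OF that] by blast
    have "(S has_real_derivative \<eta> (g z) / \<zeta> (g z) * \<zeta> (g z)) (at z)"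
      unfolding S_def using DERIV_chain2[where f=W and g=g, OF W(2)[OF ga]] g(3)[OF that] by blast
    then show ?thesis using pos[of "g z"] ga by simp
  qed
  have "isCont S 0" using dS[of 0] g(1) DERIV_isCont by force
  moreover have S0: "S 0 = 0" by (simp add: S_def g W)
  ultimately obtain d2 where d2: "d2 > 0" "\<And>z. \<bar>z\<bar> < d2 \<Longrightarrow> \<bar>S z\<bar> < e / 2"
    using e unfolding continuous_at_eps_delta by (metis abs_0_eq diff_zero dist_real_def half_gt_zero)
  define d where "d = min d1 (min d2 (e / 2))"
  have d: "d > 0" using g d2 e by (simp add: d_def)
  define \<Phi> where "\<Phi> z y = \<Psi> (y + S z) (g z)" for z y
  have small: "\<bar>y + S z\<bar> < e" "\<bar>g z\<bar> < e" "\<bar>z\<bar> < d1" if "\<bar>z\<bar> < d" "\<bar>y\<bar> < d" for z y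
    using that d2(2)[of z] g(3)[of z] a by (auto simp: d_def)
  have \<Phi>U: "\<Phi> z y \<in> U" if "\<bar>z\<bar> < d" "\<bar>y\<bar> < d" for z y
    unfolding \<Phi>_def by (rule PU) (use small[OF that] in auto)
  have dYd: "((\<lambda>y. f (\<Phi> z y)) has_real_derivative Y f (\<Phi> z y)) (at y)"
    if "smooth_on f U" "\<bar>z\<bar> < d" "\<bar>y\<bar> < d" for f z y
    unfolding \<Phi>_def by (rule dY) (use small[OF that(2,3)] that(1) in auto)
  have dZd: "((\<lambda>z. f (\<Phi> z y)) has_real_derivative Z f (\<Phi> z y)) (at z)"
    if f: "smooth_on f U" and z: "\<bar>z\<bar> < d" and y: "\<bar>y\<bar> < d" for f z y
  proof -
    let ?s = "y + S z" and ?t = "g z"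
    note sm = small[OF z y]
    have dg: "(g has_real_derivative \<zeta> ?t) (at z)" using g(3)[OF sm(3)] by blast
    let ?a' = "exp ?s * (\<eta> ?t * (u0 - ?t * v0) - \<zeta> ?t * v0)"
    let ?b' = "exp ?s * (\<eta> ?t * (v0 + ?t * u0) + \<zeta> ?t * u0)"
    have 1: "((\<lambda>z. exp (y + S z) * (u0 - g z * v0)) has_real_derivative ?a') (at z)"
      "((\<lambda>z. exp (y + S z) * (v0 + g z * u0)) has_real_derivative ?b') (at z)"
      by (auto intro!: derivative_eq_intros dS[OF sm(3)] dg simp: algebra_simps)
    have "r * (\<eta> ?t * (u0 - ?t * v0) - \<zeta> ?t * v0) = r * Zu (\<Psi> 0 ?t)"
      "r * (\<eta> ?t * (v0 + ?t * u0) + \<zeta> ?t * u0) = r * Zv (\<Psi> 0 ?t)"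
    proof -
      have re: "r * \<eta> ?t = Zu (\<Psi> 0 ?t) * u0 + Zv (\<Psi> 0 ?t) * v0"
        and rz: "r * \<zeta> ?t = (u0 - ?t * v0) * Zv (\<Psi> 0 ?t) - (v0 + ?t * u0) * Zu (\<Psi> 0 ?t)"
        using r by (simp_all add: \<eta>_def \<zeta>_def)
      have "r * (\<eta> ?t * (u0 - ?t * v0) - \<zeta> ?t * v0) = (r * \<eta> ?t) * (u0 - ?t * v0) - (r * \<zeta> ?t) * v0"
        "r * (\<eta> ?t * (v0 + ?t * u0) + \<zeta> ?t * u0) = (r * \<eta> ?t) * (v0 + ?t * u0) + (r * \<zeta> ?t) * u0"
        by (simp_all add: algebra_simps)
      then show "r * (\<eta> ?t * (u0 - ?t * v0) - \<zeta> ?t * v0) = r * Zu (\<Psi> 0 ?t)"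
        "r * (\<eta> ?t * (v0 + ?t * u0) + \<zeta> ?t * u0) = r * Zv (\<Psi> 0 ?t)"
        unfolding re rz by (simp_all add: r_def algebra_simps power2_eq_square)
    qed
    then have "?a' = Zu (\<Phi> z y)" "?b' = Zv (\<Phi> z y)"
      unfolding \<Phi>_def using r scale[OF hZ(1) sm(1,2)] scale[OF hZ(2) sm(1,2)] by simp_all
    with 1 have 2: "((\<lambda>z. exp (y + S z) * (u0 - g z * v0)) has_real_derivative Zu (\<Phi> z y)) (at z)"
      "((\<lambda>z. exp (y + S z) * (v0 + g z * u0)) has_real_derivative Zv (\<Phi> z y)) (at z)" by simp_all
    have "(exp (y + S z) * (u0 - g z * v0), exp (y + S z) * (v0 + g z * u0)) \<in> U"
      using \<Phi>U[OF z y] by (simp add: \<Phi>_def \<Psi>_def)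
    from DERIV_along_curve[where a="\<lambda>z. exp (y + S z) * (u0 - g z * v0)"
        and b="\<lambda>z. exp (y + S z) * (v0 + g z * u0)", OF open_U f this 2]
    show ?thesis unfolding Zf by (simp add: \<Phi>_def \<Psi>_def)
  qed
  let ?R = "{-d<..<d} \<times> {-d<..<d}"
  have c\<Phi>: "continuous_on ?R (\<lambda>(z, y). \<Phi> z y)"
  proof -
    have "continuous_on {-d<..<d} g" "continuous_on {-d<..<d} S"
    proof -
      have "isCont g z \<and> isCont S z" if "z \<in> {-d<..<d}" for z
      proof -
        have z: "\<bar>z\<bar> < d1" using that by (auto simp: d_def abs_less_iff)
        show ?thesis using g(3)[OF z] dS[OF z] DERIV_isCont by blast
      qed
      then show "continuous_on {-d<..<d} g" "continuous_on {-d<..<d} S"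
        by (auto intro: continuous_at_imp_continuous_on)
    qed
    note cgS = this
    have sub: "fst ` ?R \<subseteq> {-d<..<d}" by (rule image_subsetI) (simp add: mem_Times_iff)
    note c = continuous_on_compose2[OF cgS(1) continuous_on_fst[OF continuous_on_id] sub]
      continuous_on_compose2[OF cgS(2) continuous_on_fst[OF continuous_on_id] sub]
    show ?thesis unfolding \<Phi>_def \<Psi>_def case_prod_beta by (intro continuous_intros c)
  qed
  \<comment> \<open>The components of a point along and across the position vector of
    \<open>x0\<close> determine \<open>y + S z\<close> and \<open>g z\<close>, and \<open>g\<close>
    is increasing.\<close>
  have inj\<Phi>: "inj_on (\<lambda>(z, y). \<Phi> z y) ?R"
  proof (rule inj_onI, clarify)
    fix z y z' y'
    assume zy: "z \<in> {-d<..<d}" "z' \<in> {-d<..<d}" and eq: "\<Phi> z y = \<Phi> z' y'"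
    have 1: "u0 * fst (\<Phi> z y) + v0 * snd (\<Phi> z y) = exp (y + S z) * r"
      "u0 * snd (\<Phi> z y) - v0 * fst (\<Phi> z y) = exp (y + S z) * g z * r" for z y
      by (simp_all add: \<Phi>_def \<Psi>_def r_def algebra_simps power2_eq_square)
    have "exp (y + S z) * r = exp (y' + S z') * r" unfolding 1(1)[symmetric] eq ..
    then have s: "y + S z = y' + S z'" using r by simp
    have "exp (y + S z) * g z * r = exp (y' + S z') * g z' * r"
      unfolding 1(2)[symmetric] eq ..
    then have gg: "g z = g z'" using r s by simp
    have inc: "g a1 < g b1" if "a1 \<in> {-d<..<d}" "b1 \<in> {-d<..<d}" "a1 < b1" for a1 b1
    proof (rule DERIV_pos_imp_increasing[OF that(3)])
      fix x assume "a1 \<le> x" "x \<le> b1"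
      then have "\<bar>x\<bar> < d1" using that by (auto simp: d_def abs_less_iff)
      from g(3)[OF this] pos[of "g x"] show "\<exists>y. (g has_real_derivative y) (at x) \<and> 0 < y" by auto
    qed
    have "z = z'" using inc[OF zy(1,2)] inc[OF zy(2,1)] gg by (cases z z' rule: linorder_cases) auto
    then show "z = z' \<and> y = y'" using s by simp
  qed
  \<comment> \<open>By invariance of domain, continuity and injectivity give openness without an
    inverse function theorem.\<close>
  have "open ((\<lambda>(z, y). \<Phi> z y) ` S)" if "open S" "S \<subseteq> ?R" for S
    by (rule invariance_of_domain[OF continuous_on_subset[OF c\<Phi> that(2)] that(1)
          inj_on_subset[OF inj\<Phi> that(2)]])
  then have "chart d \<Phi>"
    unfolding chart_def by (intro conjI allI impI d \<Phi>U dYd dZd c\<Phi>)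
  moreover have "\<Phi> 0 0 = x0" by (simp add: \<Phi>_def S0 g(2) \<Psi>0)
  ultimately show thesis using that by blast
qed

lemma chartD:
  assumes "chart d \<Phi>"
  shows "d > 0" and "\<bar>z\<bar> < d \<Longrightarrow> \<bar>y\<bar> < d \<Longrightarrow> \<Phi> z y \<in> U"
    and "smooth_on f U \<Longrightarrow> \<bar>z\<bar> < d \<Longrightarrow> \<bar>y\<bar> < d \<Longrightarrow>
      ((\<lambda>z. f (\<Phi> z y)) has_real_derivative Z f (\<Phi> z y)) (at z)"
    and "smooth_on f U \<Longrightarrow> \<bar>z\<bar> < d \<Longrightarrow> \<bar>y\<bar> < d \<Longrightarrow>
      ((\<lambda>y. f (\<Phi> z y)) has_real_derivative Y f (\<Phi> z y)) (at y)"
    and "continuous_on ({-d<..<d} \<times> {-d<..<d}) (\<lambda>(z, y). \<Phi> z y)"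
    and "open S \<Longrightarrow> S \<subseteq> {-d<..<d} \<times> {-d<..<d} \<Longrightarrow> open ((\<lambda>(z, y). \<Phi> z y) ` S)"
    and "open ((\<lambda>(z, y). \<Phi> z y) ` ({-d<..<d} \<times> {-d<..<d}))"
proof -
  show "d > 0" and "\<bar>z\<bar> < d \<Longrightarrow> \<bar>y\<bar> < d \<Longrightarrow> \<Phi> z y \<in> U"
    and "smooth_on f U \<Longrightarrow> \<bar>z\<bar> < d \<Longrightarrow> \<bar>y\<bar> < d \<Longrightarrow>
      ((\<lambda>z. f (\<Phi> z y)) has_real_derivative Z f (\<Phi> z y)) (at z)"
    and "smooth_on f U \<Longrightarrow> \<bar>z\<bar> < d \<Longrightarrow> \<bar>y\<bar> < d \<Longrightarrow>
      ((\<lambda>y. f (\<Phi> z y)) has_real_derivative Y f (\<Phi> z y)) (at y)"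
    and "continuous_on ({-d<..<d} \<times> {-d<..<d}) (\<lambda>(z, y). \<Phi> z y)"
    and *: "open S \<Longrightarrow> S \<subseteq> {-d<..<d} \<times> {-d<..<d} \<Longrightarrow> open ((\<lambda>(z, y). \<Phi> z y) ` S)" for S
    using assms[unfolded chart_def] by (elim conjE, simp)+
  show "open ((\<lambda>(z, y). \<Phi> z y) ` ({-d<..<d} \<times> {-d<..<d}))"
    by (rule *[OF open_Times[OF open_greaterThanLessThan open_greaterThanLessThan] order_refl])
qed

lemma chart_restrict:
  assumes ch: "chart d \<Phi>" and e: "0 < e" "e \<le> d"
  shows "chart e \<Phi>"
proof -
  note c = chartD[OF ch]
  have sub: "{-e<..<e} \<times> {-e<..<e} \<subseteq> {-d<..<d} \<times> {-d<..<d}" using e by auto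
  have a: "\<bar>z\<bar> < d" if "\<bar>z\<bar> < e" for z using that e by simp
  show ?thesis
    unfolding chart_def
    by (intro conjI allI impI e c(2-4) a continuous_on_subset[OF c(5) sub] c(6) order_trans[OF _ sub])
qed

lemma chart_primitive_exists:
  assumes "x0 \<in> U"
  obtains d \<Phi> M where "chart d \<Phi>" "\<Phi> 0 0 = x0" "M 0 = 0"
    "\<And>z. \<bar>z\<bar> < d \<Longrightarrow> (M has_real_derivative m (\<Phi> z 0)) (at z)"
proof -
  obtain e \<Phi> where ch: "chart e \<Phi>" "\<Phi> 0 0 = x0" using chart_exists[OF assms] by blast
  \<comment> \<open>On the closed interval of half the size \<open>m\<close> is continuous up to the
    endpoints and has a primitive.\<close>
  define d where "d = e / 2"
  have d: "0 < d" "d \<le> e" "d < e" using chartD(1)[OF ch(1)] by (simp_all add: d_def)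
  have "continuous_on {-d..d} (\<lambda>z. m (\<Phi> z 0))"
  proof (rule continuous_at_imp_continuous_on, rule ballI)
    fix z assume "z \<in> {-d..d}"
    then have "\<bar>z\<bar> < e" "\<bar>0\<bar> < e" using d by auto
    from chartD(3)[OF ch(1) smooth_frame(6) this] show "isCont (\<lambda>z. m (\<Phi> z 0)) z" by (rule DERIV_isCont)
  qed
  from primitive_exists[OF this] obtain M where "M 0 = 0"
    "\<And>z. \<bar>z\<bar> < d \<Longrightarrow> (M has_real_derivative m (\<Phi> z 0)) (at z)" by blast
  with that chart_restrict[OF ch(1) d(1,2)] ch(2) show thesis by blast
qed

end

section \<open>Four independent cubic integrals\<close>

lemma poisson_cong:
  assumes "open U" "x \<in> U" "\<And>x y. x \<in> U \<Longrightarrow> f (x, y) = g (x, y)"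
  shows "poisson h f (x, y) = poisson h g (x, y)"
proof -
  obtain u v where x: "x = (u, v)" by fastforce
  have "eventually (\<lambda>t. f ((t, v), y) = g ((t, v), y)) (nhds u)"
    using eventually_in_open_slices(1)[OF assms(1), of u v] assms(2) x
    by (auto elim: eventually_mono intro: assms(3))
  then have 1: "du (\<lambda>x. f (x, y)) x = du (\<lambda>x. g (x, y)) x"
    unfolding du_def x by (intro deriv_cong_ev) simp_all
  have "eventually (\<lambda>t. f ((u, t), y) = g ((u, t), y)) (nhds v)"
    using eventually_in_open_slices(2)[OF assms(1), of u v] assms(2) x
    by (auto elim: eventually_mono intro: assms(3))
  then have 2: "dv (\<lambda>x. f (x, y)) x = dv (\<lambda>x. g (x, y)) x"
    unfolding dv_def x by (intro deriv_cong_ev) simp_all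
  have "(\<lambda>y. f (x, y)) = (\<lambda>y. g (x, y))" using assms by (intro ext) simp
  then show ?thesis by (simp add: poisson_def 1 2)
qed

lemma exp_ode:
  assumes der: "\<And>y. \<bar>y\<bar> < d \<Longrightarrow> (f has_real_derivative c * f y) (at y)" and y: "\<bar>y\<bar> < d"
  shows "f y = f 0 * exp (c * y)"
proof -
  define h where "h y = f y * exp (- (c * y))" for y
  have "(h has_real_derivative 0) (at x)" if "x \<in> {-d<..<d}" for x
  proof -
    have x: "\<bar>x\<bar> < d" using that by (simp add: abs_less_iff)
    show ?thesis unfolding h_def by (auto intro!: derivative_eq_intros der[OF x])
  qed
  then have "\<exists>a. \<forall>x\<in>{-d<..<d}. h x = a"
    by (intro has_field_derivative_zero_constant) (auto simp: has_field_derivative_at_within)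
  then obtain a where a: "\<And>x. x \<in> {-d<..<d} \<Longrightarrow> h x = a" by blast
  have "h y = h 0" using a[of y] a[of 0] y by (simp add: abs_less_iff)
  then show ?thesis by (simp add: h_def exp_minus field_simps)
qed

lemma const_ode:
  assumes der: "\<And>y. \<bar>y\<bar> < d \<Longrightarrow> (f has_real_derivative 0) (at y)" and y: "\<bar>y\<bar> < d"
  shows "f y = f 0"
  using exp_ode[of d f 0 y] assms by simp

context scale_invariant_metric
begin

text \<open>The left-hand sides are \<open>D\<close> times the components of the velocity, that is,
  of the derivative of the Hamiltonian in the momenta.\<close>

lemma velocity_frame:
  assumes x: "x \<in> U" and w: "w = n1 x * p + n2 x * q" and k: "k = fst x * p + snd x * q"
  shows "G x * p - F x * q = D x * (w * n1 x + m x * k * fst x)"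
    and "E x * q - F x * p = D x * (w * n2 x + m x * k * snd x)"
proof -
  have Rw: "R x * w = (E x * fst x + F x * snd x) * q - (F x * fst x + G x * snd x) * p"
  proof -
    have "R x * w = (R x * n1 x) * p + (R x * n2 x) * q" by (simp add: w algebra_simps)
    then show ?thesis unfolding R_n1[OF x] R_n2[OF x] by (simp add: algebra_simps)
  qed
  have N: "N x \<noteq> 0" using N_pos[OF x] by simp
  have step: "N x * (D x * (w * n + m x * k * c)) = (R x * w) * (R x * n) + D x * k * c" for n c
  proof -
    have "N x * (D x * (w * n + m x * k * c)) = (D x * N x) * (w * n) + (m x * N x) * (D x * k * c)"
      by (simp only: algebra_simps)
    then show ?thesis unfolding m_N[OF x] R_sq[OF x, symmetric] by (simp add: algebra_simps power2_eq_square)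
  qed
  have "N x * (D x * (w * n1 x + m x * k * fst x)) = N x * (G x * p - F x * q)"
    unfolding step Rw R_n1[OF x] by (simp add: D_def N_def k algebra_simps power2_eq_square)
  then show "G x * p - F x * q = D x * (w * n1 x + m x * k * fst x)" using N by simp
  have "N x * (D x * (w * n2 x + m x * k * snd x)) = N x * (E x * q - F x * p)"
    unfolding step Rw R_n2[OF x] by (simp add: D_def N_def k algebra_simps power2_eq_square)
  then show "E x * q - F x * p = D x * (w * n2 x + m x * k * snd x)" using N by simp
qed

text \<open>The velocity is \<open>w n + m k K\<close> in terms of the unit normal \<open>n\<close> and the Killing field \<open>K\<close>; substitute
  this into \<open>web\<close>.\<close>

definition be0 where "be0 x = D x * (n1 x * n2 x * (n1 x + n2 x))"
definition si0 where "si0 x = D x * m x *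
  (fst x * n2 x * (n1 x + n2 x) + snd x * n1 x * (n1 x + n2 x) + (fst x + snd x) * n1 x * n2 x)"
definition ta0 where "ta0 x = D x * m x * m x *
  (fst x * snd x * (n1 x + n2 x) + fst x * n2 x * (fst x + snd x) + snd x * n1 x * (fst x + snd x))"
definition de0 where "de0 x = D x * m x * m x * m x * (fst x * snd x * (fst x + snd x))"

text \<open>\<open>D\<close> contributes the degree -4, \<open>m\<close> the degree 0, and the three
  linear factors one each.\<close>

lemma homogeneous_web: "homogeneous (-1) be0" "homogeneous (-1) si0" "homogeneous (-1) ta0" "homogeneous (-1) de0"
proof -
  note A = homogeneous_add and M = homogeneous_multI
  note h = homogeneous_D homogeneous_m homogeneous_fst homogeneous_snd homogeneous_n
  have h1: "homogeneous 1 (\<lambda>x. n1 x + n2 x)" "homogeneous 1 (\<lambda>x. fst x + snd x)"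
    by (intro A h)+
  have c: "homogeneous 3 (\<lambda>x. f x * g x * k x)" if "homogeneous 1 f" "homogeneous 1 g" "homogeneous 1 k" for f g k
    by (rule M[OF M[OF that(1,2) refl] that(3)]) simp
  have dm: "homogeneous (-4) (\<lambda>x. D x * m x)" "homogeneous (-4) (\<lambda>x. D x * m x * m x)"
    "homogeneous (-4) (\<lambda>x. D x * m x * m x * m x)"
    using M[OF h(1,2), of "-4"] M[OF M[OF h(1,2) refl] h(2), of "-4"]
      M[OF M[OF M[OF h(1,2) refl] h(2) refl] h(2), of "-4"] by simp_all
  show "homogeneous (-1) be0"
    unfolding be0_def[abs_def] by (rule M[OF h(1) c]) (simp_all add: h h1)
  show "homogeneous (-1) si0"
    unfolding si0_def[abs_def] by (rule M[OF dm(1) A[OF A[OF c c] c]]) (simp_all add: h h1)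
  show "homogeneous (-1) ta0"
    unfolding ta0_def[abs_def] by (rule M[OF dm(2) A[OF A[OF c c] c]]) (simp_all add: h h1)
  show "homogeneous (-1) de0"
    unfolding de0_def[abs_def] by (rule M[OF dm(3) c]) (simp_all add: h h1)
qed

lemma web_frame:
  assumes "x \<in> U"
  shows "cubic be0 si0 ta0 de0 (x, y) = web (x, y)"
proof -
  obtain p q where y: "y = (p, q)" by fastforce
  define w k where "w = n1 x * p + n2 x * q" and "k = fst x * p + snd x * q"
  define V W where "V = w * n1 x + m x * k * fst x" and "W = w * n2 x + m x * k * snd x"
  have D: "D x \<noteq> 0" using D_pos[OF assms] by simp
  have "web (x, (p, q)) = D x * V * (D x * W) * (D x * V + D x * W) / (D x)\<^sup>2"
    unfolding web_def Let_def using velocity_frame[OF assms w_def k_def] by (simp add: V_def W_def)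
  also have "\<dots> = D x * (V * W * (V + W))" using D by (simp add: field_simps power2_eq_square)
  also have "\<dots> = be0 x * w ^ 3 + si0 x * w\<^sup>2 * k + ta0 x * w * k\<^sup>2 + de0 x * k ^ 3"
    by (simp add: be0_def si0_def ta0_def de0_def V_def W_def algebra_simps power2_eq_square power3_eq_cube)
  also have "\<dots> = cubic be0 si0 ta0 de0 (x, (p, q))"
    unfolding cubic_apply[OF assms] w_def k_def ..
  finally show ?thesis by (simp add: y)
qed

lemma frame_integral_web: "frame_integral be0 si0 ta0 de0"
proof -
  have "poisson (hamiltonian E F G) (cubic be0 si0 ta0 de0) (x, y) = 0" if x: "x \<in> U" for x y
  proof -
    have "poisson (hamiltonian E F G) (cubic be0 si0 ta0 de0) (x, y) = poisson (hamiltonian E F G) web (x, y)"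
      by (rule poisson_cong[where f="cubic be0 si0 ta0 de0" and g=web, OF open_U x web_frame])
    then show ?thesis using poisson_web[OF x, of "fst y" "snd y"] by simp
  qed
  then show ?thesis
    unfolding frame_integral_iff_poisson[OF homogeneous_web[THEN homogeneous_imp_smooth]] by blast
qed

lemma
  assumes "smooth_on f U" "smooth_on g U" "x \<in> U"
  shows Y_add: "Y (\<lambda>x. f x + g x) x = Y f x + Y g x"
    and Z_add: "Z (\<lambda>x. f x + g x) x = Z f x + Z g x"
    and Y_mult: "Y (\<lambda>x. f x * g x) x = Y f x * g x + f x * Y g x"
    and Z_mult: "Z (\<lambda>x. f x * g x) x = Z f x * g x + f x * Z g x"
    and Y_uminus: "Y (\<lambda>x. - f x) x = - Y f x"
    and Z_uminus: "Z (\<lambda>x. - f x) x = - Z f x"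
  unfolding Y_def Z_def du_dv_add[OF open_U assms] du_dv_mult[OF open_U assms]
    du_dv_uminus[OF open_U assms(1,1,3)] by (simp_all add: algebra_simps)

lemma Y_const: "Y (\<lambda>_. c) x = 0" and Z_const: "Z (\<lambda>_. c) x = 0"
  by (simp_all add: Y_def Z_def du_dv_const)

lemma Y_eq_0: "smooth_on f U \<Longrightarrow> x \<in> U \<Longrightarrow> (\<And>x. x \<in> U \<Longrightarrow> f x = 0) \<Longrightarrow> Y f x = 0"
  unfolding Y_def
  using du_dv_cong[OF open_U, of x f "\<lambda>_. 0"] smooth_on_const[OF open_U] by (simp add: du_dv_const)

text \<open>In every chart such a function is a constant times \<open>exp (k * y)\<close>, so both
  its zero set and the complement are open; \<open>U\<close> is connected.\<close>

lemma zero_or_nonzero: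
  assumes f: "homogeneous k f" and Z: "\<And>x. x \<in> U \<Longrightarrow> Z f x = 0"
  shows "(\<forall>x\<in>U. f x = 0) \<or> (\<forall>x\<in>U. f x \<noteq> 0)"
proof -
  note sm = homogeneous_imp_smooth[OF f]
  have loc: "\<exists>T. open T \<and> x \<in> T \<and> T \<subseteq> U \<and> (\<forall>x'\<in>T. f x' = 0 \<longleftrightarrow> f x = 0)" if x: "x \<in> U" for x
  proof -
    obtain d \<Phi> where ch: "chart d \<Phi>" "\<Phi> 0 0 = x" using chart_exists[OF x] by blast
    note c = chartD[OF ch(1)]
    let ?R = "{-d<..<d} \<times> {-d<..<d}"
    have eq: "f (\<Phi> z y) = f x * exp (k * y)" if z: "\<bar>z\<bar> < d" and y: "\<bar>y\<bar> < d" for z y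
    proof -
      have "f (\<Phi> z y) = f (\<Phi> z 0) * exp (k * y)"
        by (rule exp_ode[of d "\<lambda>y. f (\<Phi> z y)", OF _ y])
          (use c(4)[OF sm z] homogeneousD[OF f c(2)[OF z]] in simp)
      also have "f (\<Phi> z 0) = f (\<Phi> 0 0)"
        by (rule const_ode[of d "\<lambda>z. f (\<Phi> z 0)", OF _ z])
          (use c(3)[OF sm, of _ 0] Z c(2)[of _ 0] c(1) in simp)
      finally show ?thesis by (simp add: ch(2))
    qed
    show ?thesis
    proof (intro exI conjI ballI)
      show "open ((\<lambda>(z, y). \<Phi> z y) ` ?R)" by (rule c(7))
      show "x \<in> (\<lambda>(z, y). \<Phi> z y) ` ?R" using ch(2) c(1) by (intro image_eqI[of _ _ "(0, 0)"]) auto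
      show "(\<lambda>(z, y). \<Phi> z y) ` ?R \<subseteq> U" using c(2) by (auto simp: abs_less_iff)
      fix x' assume "x' \<in> (\<lambda>(z, y). \<Phi> z y) ` ?R"
      then show "f x' = 0 \<longleftrightarrow> f x = 0" using eq by (auto simp: abs_less_iff)
    qed
  qed
  let ?A = "{x \<in> U. f x = 0}" and ?B = "{x \<in> U. f x \<noteq> 0}"
  have "open ?A"
  proof (subst open_subopen, intro ballI)
    fix x assume "x \<in> ?A"
    then obtain T where "open T" "x \<in> T" "T \<subseteq> U" "\<forall>x'\<in>T. f x' = 0 \<longleftrightarrow> f x = 0" "f x = 0"
      using loc[of x] by auto
    then show "\<exists>T. open T \<and> x \<in> T \<and> T \<subseteq> ?A" by (intro exI[of _ T]) auto
  qed
  moreover have "open ?B"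
  proof (subst open_subopen, intro ballI)
    fix x assume "x \<in> ?B"
    then obtain T where "open T" "x \<in> T" "T \<subseteq> U" "\<forall>x'\<in>T. f x' = 0 \<longleftrightarrow> f x = 0" "f x \<noteq> 0"
      using loc[of x] by auto
    then show "\<exists>T. open T \<and> x \<in> T \<and> T \<subseteq> ?B" by (intro exI[of _ T]) auto
  qed
  ultimately have "?A \<inter> U = {} \<or> ?B \<inter> U = {}"
    by (intro connectedD[OF connected_U]) auto
  then show ?thesis by blast
qed

text \<open>The cubic form \<open>D V W (V + W)\<close> has three distinct linear factors, so the
  normal is at most a simple root of it. Up to the factor \<open>m\<close>, \<open>si0\<close> is
  the derivative of the form at the normal in the transversal direction of the Killing
  field.\<close>

lemma si0_nonzero:
  assumes x: "x \<in> U" and "be0 x = 0"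
  shows "si0 x \<noteq> 0"
proof -
  define \<Delta> where "\<Delta> = fst x * n2 x - snd x * n1 x"
  have "R x * \<Delta> = N x" unfolding \<Delta>_def by (rule frame_det[OF x])
  then have \<Delta>: "\<Delta> \<noteq> 0" using N_pos[OF x] by auto
  have Dm: "D x * m x \<noteq> 0" using D_pos[OF x] m_pos[OF x] by simp
  have "n1 x = 0 \<or> n2 x = 0 \<or> n2 x = - n1 x"
    using assms D_pos[OF x] by (simp add: be0_def) (auto simp: add_eq_0_iff2)
  then show ?thesis
  proof (elim disjE)
    assume n: "n1 x = 0"
    then have "si0 x = D x * m x * (\<Delta> * n2 x)" "n2 x \<noteq> 0"
      using \<Delta> by (auto simp: si0_def \<Delta>_def algebra_simps)
    then show ?thesis using Dm \<Delta> by simp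
  next
    assume n: "n2 x = 0"
    then have "si0 x = D x * m x * (- \<Delta> * n1 x)" "n1 x \<noteq> 0"
      using \<Delta> by (auto simp: si0_def \<Delta>_def algebra_simps)
    then show ?thesis using Dm \<Delta> by simp
  next
    assume n: "n2 x = - n1 x"
    then have "si0 x = D x * m x * (\<Delta> * n1 x)" "n1 x \<noteq> 0"
      using \<Delta> by (auto simp: si0_def \<Delta>_def algebra_simps)
    then show ?thesis using Dm \<Delta> by simp
  qed
qed

lemma web_pivot:
  obtains (be) "\<forall>x\<in>U. be0 x \<noteq> 0" | (si) "\<forall>x\<in>U. be0 x = 0" "\<forall>x\<in>U. si0 x \<noteq> 0"
  using zero_or_nonzero[OF homogeneous_web(1)] frame_integral_web si0_nonzero
  unfolding frame_integral_def by blast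

text \<open>\<open>rho\<close> is the exponential of twice the coordinate along the Killing field. It is single-valued
  on \<open>U\<close> because it is an algebraic function of the leading coefficient of \<open>web\<close>.\<close>

lemma scaling_factor_exists:
  obtains rho where "homogeneous 2 rho" "\<And>x. x \<in> U \<Longrightarrow> Z rho x = 0" "\<And>x. x \<in> U \<Longrightarrow> rho x \<noteq> 0"
proof -
  note result = that
  have *: thesis if f: "homogeneous (-1) f" "\<forall>x\<in>U. f x \<noteq> 0" and Z: "\<And>x. x \<in> U \<Longrightarrow> Z f x = 0" for f
  proof -
    \<comment> \<open>The reciprocal of the square has weight 2, which turns the weight -1 of the
      coefficients of \<open>web\<close> into 1.\<close>
    define g where "g = (\<lambda>x. f x * f x)"
    define rho where "rho = (\<lambda>x. 1 / g x)"
    have g: "homogeneous (-2) g" using homogeneous_mult[OF f(1,1)] by (simp add: g_def)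
    have g0: "\<forall>x\<in>U. g x \<noteq> 0" using f(2) by (simp add: g_def)
    have rho: "homogeneous 2 rho"
      using homogeneous_divide[OF homogeneous_const[of 1] g g0] by (simp add: rho_def)
    have "Z rho x = 0" if x: "x \<in> U" for x
    proof -
      have sm: "smooth_on rho U" "smooth_on g U" "smooth_on f U"
        using rho g f(1) by (simp_all add: homogeneous_def)
      have "Z (\<lambda>x. rho x * g x) x = Z (\<lambda>_. 1) x"
        using du_dv_cong[OF open_U x, of "\<lambda>x. rho x * g x" "\<lambda>_. 1"] g0 smooth_on_const[OF open_U]
        by (simp add: Z_def rho_def)
      moreover have "Z g x = 0" unfolding g_def using Z_mult[OF sm(3,3) x] Z[OF x] by simp
      ultimately show ?thesis using Z_mult[OF sm(1,2) x] g0 x by (simp add: Z_const)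
    qed
    moreover have "rho x \<noteq> 0" if "x \<in> U" for x using g0 that by (simp add: rho_def)
    ultimately show thesis by (rule result[OF rho])
  qed
  show thesis
  proof (cases rule: web_pivot)
    case be
    then show thesis using *[OF homogeneous_web(1)] frame_integral_web unfolding frame_integral_def by blast
  next
    case si
    have "Z si0 x = 0" if x: "x \<in> U" for x
    proof -
      have "Z si0 x + Y be0 x = 0" using frame_integral_web x unfolding frame_integral_def by blast
      then show ?thesis using homogeneousD[OF homogeneous_web(1) x] si(1) x by simp
    qed
    then show thesis using *[OF homogeneous_web(2) si(2)] by blast
  qed
qed

definition rho where "rho = (SOME r. homogeneous 2 r \<and> (\<forall>x\<in>U. Z r x = 0 \<and> r x \<noteq> 0))"

lemma homogeneous_rho: "homogeneous 2 rho"
  and Z_rho: "x \<in> U \<Longrightarrow> Z rho x = 0"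
  and rho_nonzero: "x \<in> U \<Longrightarrow> rho x \<noteq> 0"
proof -
  have "\<exists>r. homogeneous 2 r \<and> (\<forall>x\<in>U. Z r x = 0 \<and> r x \<noteq> 0)"
    using scaling_factor_exists by metis
  from someI_ex[OF this] show "homogeneous 2 rho" "x \<in> U \<Longrightarrow> Z rho x = 0" "x \<in> U \<Longrightarrow> rho x \<noteq> 0"
    unfolding rho_def by blast+
qed

text \<open>The reflection in the line orthogonal to the Killing field is an isometry up to reversing the
  coordinate along the field, whence the second integral.\<close>

lemma frame_integral_reflected:
  "frame_integral (\<lambda>x. rho x * be0 x) (\<lambda>x. - (rho x * si0 x)) (\<lambda>x. rho x * ta0 x) (\<lambda>x. - (rho x * de0 x))"
proof -
  note sr = homogeneous_imp_smooth[OF homogeneous_rho]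
  note sm = homogeneous_web[THEN homogeneous_imp_smooth]
  have r: "Y (\<lambda>x. rho x * f x) x = rho x * f x" "Z (\<lambda>x. rho x * f x) x = rho x * Z f x"
    "Y (\<lambda>x. - (rho x * f x)) x = - (rho x * f x)" "Z (\<lambda>x. - (rho x * f x)) x = - (rho x * Z f x)"
    if f: "homogeneous (-1) f" and x: "x \<in> U" for f x
  proof -
    note sf = homogeneous_imp_smooth[OF f]
    note smr = smooth_on_mult[OF open_U sr sf]
    show 1: "Y (\<lambda>x. rho x * f x) x = rho x * f x" "Z (\<lambda>x. rho x * f x) x = rho x * Z f x"
      unfolding Y_mult[OF sr sf x] Z_mult[OF sr sf x] homogeneousD[OF f x] homogeneousD[OF homogeneous_rho x]
        Z_rho[OF x] by simp_all
    show "Y (\<lambda>x. - (rho x * f x)) x = - (rho x * f x)" "Z (\<lambda>x. - (rho x * f x)) x = - (rho x * Z f x)"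
      unfolding Y_uminus[OF smr smr x] Z_uminus[OF smr smr x] 1 by simp_all
  qed
  show ?thesis
    unfolding frame_integral_def
  proof (intro conjI ballI)
    fix x assume x: "x \<in> U"
    have e: "Z be0 x = 0" "Z si0 x + Y be0 x = 0" "Z ta0 x + Y si0 x - 3 / 2 * Z m x * be0 x = 0"
       "Z de0 x + Y ta0 x - Z m x * si0 x = 0" "Y de0 x - Z m x * ta0 x / 2 = 0"
      using frame_integral_web x unfolding frame_integral_def by blast+
    note Yw = homogeneous_web[THEN homogeneousD, OF x]
    note rr = homogeneous_web[THEN r(1), OF x] homogeneous_web[THEN r(2), OF x]
      homogeneous_web[THEN r(3), OF x] homogeneous_web[THEN r(4), OF x]
    show "Z (\<lambda>x. rho x * be0 x) x = 0" unfolding rr e by simp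
    show "Z (\<lambda>x. - (rho x * si0 x)) x + Y (\<lambda>x. rho x * be0 x) x = 0"
      using e(2) unfolding rr Yw by (simp add: eq_neg_iff_add_eq_0 algebra_simps)
    show "Z (\<lambda>x. rho x * ta0 x) x + Y (\<lambda>x. - (rho x * si0 x)) x - 3 / 2 * Z m x * (rho x * be0 x) = 0"
    proof -
      have "rho x * Z ta0 x + - (rho x * si0 x) - 3 / 2 * Z m x * (rho x * be0 x)
        = rho x * (Z ta0 x + Y si0 x - 3 / 2 * Z m x * be0 x)"
        unfolding Yw by (simp add: algebra_simps)
      then show ?thesis unfolding rr e by simp
    qed
    show "Z (\<lambda>x. - (rho x * de0 x)) x + Y (\<lambda>x. rho x * ta0 x) x - Z m x * - (rho x * si0 x) = 0"
    proof -
      have "- (rho x * Z de0 x) + rho x * ta0 x - Z m x * - (rho x * si0 x)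
        = - rho x * (Z de0 x + Y ta0 x - Z m x * si0 x)"
        unfolding Yw by (simp add: algebra_simps)
      then show ?thesis unfolding rr e by simp
    qed
    show "Y (\<lambda>x. - (rho x * de0 x)) x - Z m x * (rho x * ta0 x) / 2 = 0"
    proof -
      have "- (rho x * de0 x) - Z m x * (rho x * ta0 x) / 2 = rho x * (Y de0 x - Z m x * ta0 x / 2)"
        unfolding Yw by (simp add: algebra_simps)
      then show ?thesis unfolding rr e by simp
    qed
  qed (intro smooth_ring sr sm)+
qed

text \<open>The coefficients are those of \<open>2 H k\<close>, which is
  \<open>w^2 k + m k^3\<close>, and of \<open>k^3\<close>.\<close>

lemma frame_integral_energy: "frame_integral (\<lambda>_. 0) (\<lambda>_. 1) (\<lambda>_. 0) m"
  and frame_integral_killing: "frame_integral (\<lambda>_. 0) (\<lambda>_. 0) (\<lambda>_. 0) (\<lambda>_. 1)"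
  unfolding frame_integral_def
  by (auto simp: smooth_on_const[OF open_U] smooth_frame Y_const Z_const Y_m)

end

section \<open>Cubic integrals in adapted coordinates\<close>

text \<open>Gronwall for the sum of squares \<open>f\<close>. A linear bound on the derivatives
  gives |f'| at most \<open>c f\<close>; hence \<open>f y * exp (- (c * y))\<close> does not
  increase to the right of \<open>y0\<close>, and \<open>f y * exp (c * y)\<close> does not decrease
  to the left of it.\<close>

lemma linear_ode_zero:
  fixes x x' :: "nat \<Rightarrow> real \<Rightarrow> real"
  assumes der: "\<And>i y. i < n \<Longrightarrow> \<bar>y\<bar> < d \<Longrightarrow> (x i has_real_derivative x' i y) (at y)"
    and bound: "\<And>i y. i < n \<Longrightarrow> \<bar>y\<bar> < d \<Longrightarrow> \<bar>x' i y\<bar> \<le> K * (\<Sum>j<n. \<bar>x j y\<bar>)"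
    and y0: "\<bar>y0\<bar> < d" "\<And>i. i < n \<Longrightarrow> x i y0 = 0" and i: "i < n" and y: "\<bar>y\<bar> < d"
  shows "x i y = 0"
proof -
  define f where "f y = (\<Sum>i<n. (x i y)\<^sup>2)" for y
  define f' where "f' y = (\<Sum>i<n. 2 * x i y * x' i y)" for y
  define c where "c = 2 * \<bar>K\<bar> * real n"
  have f0: "f y \<ge> 0" for y by (simp add: f_def sum_nonneg)
  have df: "(f has_real_derivative f' t) (at t)" if t: "\<bar>t\<bar> < d" for t
    unfolding f_def f'_def
    by (rule DERIV_sum) (use DERIV_power[OF der[OF _ t], of _ 2] in \<open>simp add: algebra_simps\<close>)
  have bf: "\<bar>f' t\<bar> \<le> c * f t" if t: "\<bar>t\<bar> < d" for t
  proof -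
    let ?s = "\<Sum>j<n. \<bar>x j t\<bar>"
    have s0: "?s \<ge> 0" by (simp add: sum_nonneg)
    have "\<bar>f' t\<bar> \<le> (\<Sum>i<n. \<bar>2 * x i t * x' i t\<bar>)" unfolding f'_def by (rule sum_abs)
    also have "\<dots> \<le> (\<Sum>i<n. 2 * \<bar>K\<bar> * ?s * \<bar>x i t\<bar>)"
    proof (rule sum_mono)
      fix i assume "i \<in> {..<n}"
      then have "\<bar>x' i t\<bar> \<le> K * ?s" using bound t by simp
      also have "\<dots> \<le> \<bar>K\<bar> * ?s" by (intro mult_right_mono s0) simp
      finally have "\<bar>x i t\<bar> * \<bar>x' i t\<bar> \<le> \<bar>x i t\<bar> * (\<bar>K\<bar> * ?s)" by (rule mult_left_mono) simp
      then show "\<bar>2 * x i t * x' i t\<bar> \<le> 2 * \<bar>K\<bar> * ?s * \<bar>x i t\<bar>" by (simp add: abs_mult mult.commute mult.left_commute)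
    qed
    also have "\<dots> = 2 * \<bar>K\<bar> * ?s\<^sup>2" by (simp add: sum_distrib_left[symmetric] power2_eq_square)
    also have "\<dots> \<le> 2 * \<bar>K\<bar> * (real n * f t)"
      using sum_squared_le_sum_of_squares[of "\<lambda>j. \<bar>x j t\<bar>" "{..<n}"]
      by (intro mult_left_mono) (simp_all add: f_def mult.commute)
    finally show ?thesis by (simp add: c_def mult.assoc)
  qed
  have fy0: "f y0 = 0" using y0(2) by (simp add: f_def)
  have "f y \<le> 0"
  proof (cases "y0 \<le> y")
    case True
    have "f y * exp (- (c * y)) \<le> f y0 * exp (- (c * y0))"
    proof (rule DERIV_nonpos_imp_nonincreasing[OF True])
      fix t assume "y0 \<le> t" "t \<le> y"
      then have t: "\<bar>t\<bar> < d" using y y0 by (auto simp: abs_less_iff)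
      have "((\<lambda>y. f y * exp (- (c * y))) has_real_derivative (f' t - c * f t) * exp (- (c * t))) (at t)"
        by (auto intro!: derivative_eq_intros df[OF t] simp: algebra_simps)
      moreover have "(f' t - c * f t) * exp (- (c * t)) \<le> 0"
        using bf[OF t] by (intro mult_nonpos_nonneg) auto
      ultimately show "\<exists>a. ((\<lambda>y. f y * exp (- (c * y))) has_real_derivative a) (at t) \<and> a \<le> 0" by blast
    qed
    then show ?thesis by (simp add: fy0 mult_le_0_iff)
  next
    case False
    then have le: "y \<le> y0" by simp
    have "f y * exp (c * y) \<le> f y0 * exp (c * y0)"
    proof (rule DERIV_nonneg_imp_nondecreasing[OF le])
      fix t assume "y \<le> t" "t \<le> y0"
      then have t: "\<bar>t\<bar> < d" using y y0 by (auto simp: abs_less_iff)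
      have "((\<lambda>y. f y * exp (c * y)) has_real_derivative (f' t + c * f t) * exp (c * t)) (at t)"
        by (auto intro!: derivative_eq_intros df[OF t] simp: algebra_simps)
      moreover have "(f' t + c * f t) * exp (c * t) \<ge> 0"
        using bf[OF t] by (intro mult_nonneg_nonneg) auto
      ultimately show "\<exists>a. ((\<lambda>y. f y * exp (c * y)) has_real_derivative a) (at t) \<and> 0 \<le> a" by blast
    qed
    then show ?thesis by (simp add: fy0 mult_le_0_iff)
  qed
  then have "f y = 0" using f0[of y] by simp
  then show ?thesis using i unfolding f_def by (simp add: sum_nonneg_eq_0_iff)
qed

text \<open>The coefficients are recovered from the five values by central difference quotients.\<close>

lemma quartic_coefficients_bounded:
  fixes h :: real
  assumes h: "h > 0"
  obtains K where "\<And>S c0 c1 c2 c3 c4 B. (\<And>z. \<bar>z\<bar> \<le> 2 * h \<Longrightarrow> S z = c0 + c1 * z + c2 * z\<^sup>2 + c3 * z ^ 3 + c4 * z ^ 4) \<Longrightarrow>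
    \<bar>S (-2 * h)\<bar> \<le> B \<Longrightarrow> \<bar>S (- h)\<bar> \<le> B \<Longrightarrow> \<bar>S 0\<bar> \<le> B \<Longrightarrow> \<bar>S h\<bar> \<le> B \<Longrightarrow> \<bar>S (2 * h)\<bar> \<le> B \<Longrightarrow>
    \<bar>c2\<bar> \<le> K * B \<and> \<bar>c3\<bar> \<le> K * B \<and> \<bar>c4\<bar> \<le> K * B"
proof -
  \<comment> \<open>The numerators are the sums of the absolute weights in the difference quotients:
    1 + 16 + 30 + 16 + 1, 1 + 2 + 2 + 1 and 1 + 4 + 6 + 4 + 1.\<close>
  define K where "K = max (64 / (24 * h\<^sup>2)) (max (6 / (12 * h ^ 3)) (16 / (24 * h ^ 4)))"
  have "\<bar>c2\<bar> \<le> K * B \<and> \<bar>c3\<bar> \<le> K * B \<and> \<bar>c4\<bar> \<le> K * B"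
    if S: "\<And>z. \<bar>z\<bar> \<le> 2 * h \<Longrightarrow> S z = c0 + c1 * z + c2 * z\<^sup>2 + c3 * z ^ 3 + c4 * z ^ 4"
      and B: "\<bar>S (-2 * h)\<bar> \<le> B" "\<bar>S (- h)\<bar> \<le> B" "\<bar>S 0\<bar> \<le> B" "\<bar>S h\<bar> \<le> B" "\<bar>S (2 * h)\<bar> \<le> B"
    for S c0 c1 c2 c3 c4 B
  proof -
    have B0: "B \<ge> 0" using B(3) by simp
    have v: "S (-2 * h) = c0 - 2 * c1 * h + 4 * c2 * h\<^sup>2 - 8 * c3 * h ^ 3 + 16 * c4 * h ^ 4"
      "S (- h) = c0 - c1 * h + c2 * h\<^sup>2 - c3 * h ^ 3 + c4 * h ^ 4" "S 0 = c0"
      "S h = c0 + c1 * h + c2 * h\<^sup>2 + c3 * h ^ 3 + c4 * h ^ 4"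
      "S (2 * h) = c0 + 2 * c1 * h + 4 * c2 * h\<^sup>2 + 8 * c3 * h ^ 3 + 16 * c4 * h ^ 4"
      using S[of "-2 * h"] S[of "- h"] S[of 0] S[of h] S[of "2 * h"] h
      by (simp_all add: power_mult_distrib)
    have "24 * h\<^sup>2 * c2 = - S (2 * h) + 16 * S h - 30 * S 0 + 16 * S (- h) - S (-2 * h)"
      "12 * h ^ 3 * c3 = S (2 * h) - 2 * S h + 2 * S (- h) - S (-2 * h)"
      "24 * h ^ 4 * c4 = S (2 * h) - 4 * S h + 6 * S 0 - 4 * S (- h) + S (-2 * h)"
      unfolding v by (simp_all add: algebra_simps)
    note e = this
    have B': "S (-2 * h) \<le> B" "- B \<le> S (-2 * h)" "S (- h) \<le> B" "- B \<le> S (- h)" "S 0 \<le> B" "- B \<le> S 0"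
      "S h \<le> B" "- B \<le> S h" "S (2 * h) \<le> B" "- B \<le> S (2 * h)"
      using B by (simp_all add: abs_le_iff)
    have quot: "\<bar>c\<bar> \<le> r / a * B" if "a > 0" "a * c \<le> r * B" "- (r * B) \<le> a * c" for a c r :: real
    proof -
      have "a * \<bar>c\<bar> = \<bar>a * c\<bar>" using that(1) by (simp add: abs_mult)
      also have "\<dots> \<le> r * B" using that(2,3) by (simp add: abs_le_iff)
      finally show ?thesis using that(1) by (simp add: pos_le_divide_eq mult.commute)
    qed
    have "\<bar>c2\<bar> \<le> 64 / (24 * h\<^sup>2) * B"
      by (rule quot) (use h in simp, unfold e, use B' in linarith, use B' in linarith)
    moreover have "\<bar>c3\<bar> \<le> 6 / (12 * h ^ 3) * B"
      by (rule quot) (use h in simp, unfold e, use B' in linarith, use B' in linarith)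
    moreover have "\<bar>c4\<bar> \<le> 16 / (24 * h ^ 4) * B"
      by (rule quot) (use h in simp, unfold e, use B' in linarith, use B' in linarith)
    moreover have "64 / (24 * h\<^sup>2) * B \<le> K * B" "6 / (12 * h ^ 3) * B \<le> K * B" "16 / (24 * h ^ 4) * B \<le> K * B"
      unfolding K_def by (rule mult_right_mono[OF _ B0], simp only: le_max_iff_disj order_refl simp_thms)+
    ultimately show ?thesis by (intro conjI) (rule order_trans, assumption+)+
  qed
  then show thesis by (rule that)
qed

lemma abs_combination_le: "\<bar>a + b - c + d\<bar> \<le> \<bar>a\<bar> + \<bar>b\<bar> + \<bar>c\<bar> + \<bar>d\<bar>" for a b c d :: real
  by linarith

text \<open>The functions f + g and f - g satisfy decoupled first-order equations.\<close>

lemma second_order_ode: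
  assumes der: "\<And>y. \<bar>y\<bar> < d \<Longrightarrow> (f has_real_derivative g y) (at y)"
    "\<And>y. \<bar>y\<bar> < d \<Longrightarrow> (g has_real_derivative f y) (at y)" and y: "\<bar>y\<bar> < d"
  shows "f y = (f 0 - g 0) / 2 * exp (- y) + (f 0 + g 0) / 2 * exp y"
proof -
  have "(f y + g y) = (f 0 + g 0) * exp (1 * y)"
    by (rule exp_ode[of d "\<lambda>y. f y + g y", OF _ y]) (use DERIV_add[OF der] in \<open>simp add: add.commute\<close>)
  moreover have "(f y - g y) = (f 0 - g 0) * exp (- 1 * y)"
    by (rule exp_ode[of d "\<lambda>y. f y - g y", OF _ y]) (use DERIV_diff[OF der] in simp)
  ultimately show ?thesis by (simp add: field_simps)
qed

text \<open>The assumption is the equation \<open>Y de = Z m * ta / 2\<close> written out in a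
  chart, and the conclusion is the vanishing z-derivative of the integrated relation. The two differ
  by the factor -8.\<close>

lemma relation_identity:
  fixes b0 :: real
  assumes "e1 + (m * s1 - (z * m - M) * b2 - (z * t2 - z\<^sup>2 / 2 * s3 + z ^ 3 / 6 * b4 + 3 / 2 * M * b2))
    = dm * (t0 - z * s1 + z\<^sup>2 / 2 * b2 + 3 / 2 * m * b0) / 2" (is "?l = ?r")
  shows "6 * b0 * m * dm + (4 * b2 * z - 4 * s1) * m + (4 * t0 - 4 * s1 * z + 2 * b2 * z\<^sup>2) * dm
      + 4 * b2 * M + (4 * b2 * z - 4 * s1) * m - (8 * e1 - 8 * t2 * z + 4 * s3 * z\<^sup>2 - 4 / 3 * b4 * z ^ 3) = 0"
    (is "?s = 0")
proof -
  have "?s = 8 * (?r - ?l)" by (simp add: field_simps)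
  also have "\<dots> = 0" unfolding assms by (simp only: diff_self mult_zero_right)
  finally show ?thesis .
qed

section \<open>Integration of the equations of an integral in a chart\<close>

context scale_invariant_metric
begin

lemma
  assumes "frame_integral be si ta de"
  shows frame_integral_smooth: "smooth_on be U" "smooth_on si U" "smooth_on ta U" "smooth_on de U"
    and frame_integral_eqs: "x \<in> U \<Longrightarrow> Z be x = 0" "x \<in> U \<Longrightarrow> Z si x = - Y be x"
      "x \<in> U \<Longrightarrow> Z ta x = 3 / 2 * Z m x * be x - Y si x"
      "x \<in> U \<Longrightarrow> Z de x = Z m x * si x - Y ta x" "x \<in> U \<Longrightarrow> Y de x = Z m x * ta x / 2"
  using assms unfolding frame_integral_def by (blast, blast, blast, blast, simp, force+)

context
  fixes d \<Phi> M
  assumes chart: "chart d \<Phi>" and M_0: "M 0 = 0"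
    and DERIV_M: "\<And>z. \<bar>z\<bar> < d \<Longrightarrow> (M has_real_derivative m (\<Phi> z 0)) (at z)"
begin

lemma d_pos: "d > 0" using chartD(1)[OF chart] .

lemma Y_chart:
  assumes "smooth_on f U" "\<bar>z\<bar> < d" "\<bar>y\<bar> < d" "\<And>y. \<bar>y\<bar> < d \<Longrightarrow> f (\<Phi> z y) = g y"
    "(g has_real_derivative a) (at y)"
  shows "Y f (\<Phi> z y) = a"
  by (rule DERIV_unique_on_interval[of d, OF assms(4) assms(3) chartD(4)[OF chart assms(1-3)] assms(5)])

lemma integrate_chart:
  assumes f: "smooth_on f U" and z: "\<bar>z\<bar> < d" and y: "\<bar>y\<bar> < d"
    and h: "\<And>z. \<bar>z\<bar> < d \<Longrightarrow> (h has_real_derivative Z f (\<Phi> z y)) (at z)"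
  shows "f (\<Phi> z y) = f (\<Phi> 0 y) + h z - h 0"
proof -
  have "f (\<Phi> z y) - h z = f (\<Phi> 0 y) - h 0"
  proof (rule const_ode[of d "\<lambda>z. f (\<Phi> z y) - h z", OF _ z])
    fix x assume x: "\<bar>x\<bar> < d"
    show "((\<lambda>z. f (\<Phi> z y) - h z) has_real_derivative 0) (at x)"
      using DERIV_diff[OF chartD(3)[OF chart f x y] h[OF x]] by simp
  qed
  then show ?thesis by simp
qed

lemma m_chart:
  assumes z: "\<bar>z\<bar> < d" and y: "\<bar>y\<bar> < d"
  shows "m (\<Phi> z y) = m (\<Phi> z 0)" "Z m (\<Phi> z y) = Z m (\<Phi> z 0)"
proof -
  have eq: "m (\<Phi> z y) = m (\<Phi> z 0)" if z: "\<bar>z\<bar> < d" for z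
    by (rule const_ode[of d "\<lambda>y. m (\<Phi> z y)", OF _ y])
      (use chartD(4)[OF chart smooth_frame(6) z] Y_m chartD(2)[OF chart z] in simp)
  show "m (\<Phi> z y) = m (\<Phi> z 0)" by (rule eq[OF z])
  have d0: "\<bar>0\<bar> < d" using d_pos by simp
  show "Z m (\<Phi> z y) = Z m (\<Phi> z 0)"
    by (rule DERIV_unique_on_interval[of d, OF eq z chartD(3)[OF chart smooth_frame(6) z y]
          chartD(3)[OF chart smooth_frame(6) z d0]])
qed

lemma DERIV_m: "\<bar>z\<bar> < d \<Longrightarrow> ((\<lambda>z. m (\<Phi> z 0)) has_real_derivative Z m (\<Phi> z 0)) (at z)"
  using chartD(3)[OF chart smooth_frame(6)] d_pos by simp

text \<open>The derivatives along the Killing coordinate on the line z = 0. As iterates of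
  \<open>Y\<close> they exist to every order by the smoothness of \<open>Y f\<close>.\<close>

definition profile :: "(point \<Rightarrow> real) \<Rightarrow> nat \<Rightarrow> real \<Rightarrow> real" where
  "profile f i y = (Y ^^ i) f (\<Phi> 0 y)"

lemma smooth_Y_power: "smooth_on f U \<Longrightarrow> smooth_on ((Y ^^ i) f) U"
  by (induction i) (simp_all add: smooth_Y)

lemma DERIV_profile:
  "smooth_on f U \<Longrightarrow> \<bar>y\<bar> < d \<Longrightarrow> (profile f i has_real_derivative profile f (Suc i) y) (at y)"
  using chartD(4)[OF chart smooth_Y_power, of f 0 y i] d_pos by (simp add: profile_def[abs_def])

context
  fixes be si ta de
  assumes int: "frame_integral be si ta de"
begin

text \<open>The subtracted terms turn \<open>pt 0\<close> and \<open>pe 0\<close> into the integration constants that arise when the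
  equations for \<open>Z ta\<close> and \<open>Z de\<close> are integrated in \<open>z\<close>.\<close>

definition "pb = profile be"
definition "ps = profile si"
definition "pt i y = profile ta i y - 3 / 2 * m (\<Phi> 0 0) * profile be i y"
definition "pe i y = profile de i y - m (\<Phi> 0 0) * profile si i y"

lemmas int_smooth = frame_integral_smooth[OF int]
lemmas int_eq = frame_integral_eqs[OF int]

lemma DERIV_p:
  assumes "\<bar>y\<bar> < d"
  shows "(pb i has_real_derivative pb (Suc i) y) (at y)" "(ps i has_real_derivative ps (Suc i) y) (at y)"
    "(pt i has_real_derivative pt (Suc i) y) (at y)" "(pe i has_real_derivative pe (Suc i) y) (at y)"
  unfolding pb_def ps_def pt_def[abs_def] pe_def[abs_def]
  by (intro DERIV_profile DERIV_diff DERIV_cmult int_smooth assms)+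

lemma be_chart:
  assumes "\<bar>z\<bar> < d" "\<bar>y\<bar> < d"
  shows "be (\<Phi> z y) = pb 0 y"
  using integrate_chart[OF int_smooth(1) assms, of "\<lambda>_. 0"] int_eq(1)[OF chartD(2)[OF chart _ assms(2)]]
  by (simp add: pb_def profile_def)

lemma Y_be_chart:
  assumes "\<bar>z\<bar> < d" "\<bar>y\<bar> < d"
  shows "Y be (\<Phi> z y) = pb 1 y"
  using Y_chart[OF int_smooth(1) assms be_chart[OF assms(1)] DERIV_p(1)[OF assms(2)]] by simp

lemma si_chart:
  assumes z: "\<bar>z\<bar> < d" and y: "\<bar>y\<bar> < d"
  shows "si (\<Phi> z y) = ps 0 y - z * pb 1 y"
proof -
  have "((\<lambda>z. - z * pb 1 y) has_real_derivative Z si (\<Phi> z y)) (at z)" if "\<bar>z\<bar> < d" for z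
    using Y_be_chart[OF that y] int_eq(2)[OF chartD(2)[OF chart that y]]
    by (auto intro!: derivative_eq_intros)
  from integrate_chart[OF int_smooth(2) z y this] show ?thesis
    by (simp add: ps_def profile_def)
qed

lemma Y_si_chart:
  assumes "\<bar>z\<bar> < d" "\<bar>y\<bar> < d"
  shows "Y si (\<Phi> z y) = ps 1 y - z * pb 2 y"
  using Y_chart[OF int_smooth(2) assms si_chart[OF assms(1)]
      DERIV_diff[OF DERIV_p(2)[OF assms(2)] DERIV_cmult[OF DERIV_p(1)[OF assms(2)]]]]
  by (simp add: numeral_2_eq_2)

lemma ta_chart:
  assumes z: "\<bar>z\<bar> < d" and y: "\<bar>y\<bar> < d"
  shows "ta (\<Phi> z y) = pt 0 y - z * ps 1 y + z\<^sup>2 / 2 * pb 2 y + 3 / 2 * m (\<Phi> z 0) * pb 0 y"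
proof -
  have "((\<lambda>z. - z * ps 1 y + z\<^sup>2 / 2 * pb 2 y + 3 / 2 * m (\<Phi> z 0) * pb 0 y)
      has_real_derivative Z ta (\<Phi> z y)) (at z)" if "\<bar>z\<bar> < d" for z
    using Y_si_chart[OF that y] be_chart[OF that y] int_eq(3)[OF chartD(2)[OF chart that y]] m_chart(2)[OF that y]
    by (auto intro!: derivative_eq_intros DERIV_m[OF that])
  from integrate_chart[OF int_smooth(3) z y this] show ?thesis
    by (simp add: pt_def pb_def profile_def)
qed

lemma Y_ta_chart:
  assumes z: "\<bar>z\<bar> < d" and y: "\<bar>y\<bar> < d"
  shows "Y ta (\<Phi> z y) = pt 1 y - z * ps 2 y + z\<^sup>2 / 2 * pb 3 y + 3 / 2 * m (\<Phi> z 0) * pb 1 y"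
proof (rule Y_chart[OF int_smooth(3) assms ta_chart[OF z]])
  note p = DERIV_p[OF y]
  show "((\<lambda>y. pt 0 y - z * ps 1 y + z\<^sup>2 / 2 * pb 2 y + 3 / 2 * m (\<Phi> z 0) * pb 0 y) has_real_derivative
      pt 1 y - z * ps 2 y + z\<^sup>2 / 2 * pb 3 y + 3 / 2 * m (\<Phi> z 0) * pb 1 y) (at y)"
    using DERIV_add[OF DERIV_add[OF DERIV_diff[OF p(3)[of 0] DERIV_cmult[OF p(2)[of 1]]]
        DERIV_cmult[OF p(1)[of 2], of "z\<^sup>2 / 2"]] DERIV_cmult[OF p(1)[of 0], of "3 / 2 * m (\<Phi> z 0)"]]
    by (simp add: eval_nat_numeral)
qed

text \<open>\<open>M\<close> enters as a primitive of \<open>m\<close> in two ways: through the last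
  term of \<open>Y ta\<close>, and through integrating \<open>z * Z m\<close> by parts.\<close>

lemma de_chart:
  assumes z: "\<bar>z\<bar> < d" and y: "\<bar>y\<bar> < d"
  shows "de (\<Phi> z y) = pe 0 y + (m (\<Phi> z 0) * ps 0 y - (z * m (\<Phi> z 0) - M z) * pb 1 y
    - (z * pt 1 y - z\<^sup>2 / 2 * ps 2 y + z ^ 3 / 6 * pb 3 y + 3 / 2 * M z * pb 1 y))"
proof -
  have "((\<lambda>z. m (\<Phi> z 0) * ps 0 y - (z * m (\<Phi> z 0) - M z) * pb 1 y
    - (z * pt 1 y - z\<^sup>2 / 2 * ps 2 y + z ^ 3 / 6 * pb 3 y + 3 / 2 * M z * pb 1 y))
      has_real_derivative Z de (\<Phi> z y)) (at z)" if "\<bar>z\<bar> < d" for z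
  proof -
    have "Z de (\<Phi> z y) = Z m (\<Phi> z 0) * (ps 0 y - z * pb 1 y)
        - (pt 1 y - z * ps 2 y + z\<^sup>2 / 2 * pb 3 y + 3 / 2 * m (\<Phi> z 0) * pb 1 y)"
      unfolding int_eq(4)[OF chartD(2)[OF chart that y]] Y_ta_chart[OF that y] si_chart[OF that y]
        m_chart(2)[OF that y] ..
    then show ?thesis
      by (auto intro!: derivative_eq_intros DERIV_m[OF that] DERIV_M[OF that]
          simp: algebra_simps power2_eq_square)
  qed
  from integrate_chart[OF int_smooth(4) z y this] show ?thesis
    by (simp add: pe_def ps_def profile_def M_0)
qed

lemma Y_de_chart:
  assumes z: "\<bar>z\<bar> < d" and y: "\<bar>y\<bar> < d"
  shows "Y de (\<Phi> z y) = pe 1 y + (m (\<Phi> z 0) * ps 1 y - (z * m (\<Phi> z 0) - M z) * pb 2 y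
    - (z * pt 2 y - z\<^sup>2 / 2 * ps 3 y + z ^ 3 / 6 * pb 4 y + 3 / 2 * M z * pb 2 y))"
proof (rule Y_chart[OF int_smooth(4) assms de_chart[OF z]])
  note p = DERIV_p[OF y]
  show "((\<lambda>y. pe 0 y + (m (\<Phi> z 0) * ps 0 y - (z * m (\<Phi> z 0) - M z) * pb 1 y
    - (z * pt 1 y - z\<^sup>2 / 2 * ps 2 y + z ^ 3 / 6 * pb 3 y + 3 / 2 * M z * pb 1 y))) has_real_derivative
     pe 1 y + (m (\<Phi> z 0) * ps 1 y - (z * m (\<Phi> z 0) - M z) * pb 2 y
    - (z * pt 2 y - z\<^sup>2 / 2 * ps 3 y + z ^ 3 / 6 * pb 4 y + 3 / 2 * M z * pb 2 y))) (at y)"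
    using DERIV_add[OF p(4)[of 0] DERIV_diff[OF DERIV_diff[OF DERIV_cmult[OF p(2)[of 0]] DERIV_cmult[OF p(1)[of 1]]]
      DERIV_add[OF DERIV_add[OF DERIV_diff[OF DERIV_cmult[OF p(3)[of 1]] DERIV_cmult[OF p(2)[of 2], of "z\<^sup>2 / 2"]]
        DERIV_cmult[OF p(1)[of 3], of "z ^ 3 / 6"]] DERIV_cmult[OF p(1)[of 1], of "3 / 2 * M z"]]],
        of "m (\<Phi> z 0)" "z * m (\<Phi> z 0) - M z" z]
    by (simp add: eval_nat_numeral)
qed

text \<open>This is the remaining equation \<open>Y de = Z m * ta / 2\<close>, integrated in \<open>z\<close>.\<close>

lemma integral_relation:
  assumes y: "\<bar>y\<bar> < d"
  obtains C where "\<And>z. \<bar>z\<bar> < d \<Longrightarrow>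
    3 * pb 0 y * (m (\<Phi> z 0))\<^sup>2 + (4 * pt 0 y - 4 * ps 1 y * z + 2 * pb 2 y * z\<^sup>2) * m (\<Phi> z 0)
      + (4 * pb 2 y * z - 4 * ps 1 y) * M z
    = C + 8 * pe 1 y * z - 4 * pt 2 y * z\<^sup>2 + 4 / 3 * ps 3 y * z ^ 3 - 1 / 3 * pb 4 y * z ^ 4"
proof -
  define L where "L z = 3 * pb 0 y * (m (\<Phi> z 0))\<^sup>2
      + (4 * pt 0 y - 4 * ps 1 y * z + 2 * pb 2 y * z\<^sup>2) * m (\<Phi> z 0) + (4 * pb 2 y * z - 4 * ps 1 y) * M z
      - (8 * pe 1 y * z - 4 * pt 2 y * z\<^sup>2 + 4 / 3 * ps 3 y * z ^ 3 - 1 / 3 * pb 4 y * z ^ 4)" for z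
  have "(L has_real_derivative 0) (at z)" if z: "\<bar>z\<bar> < d" for z
  proof -
    have "(L has_real_derivative
      6 * pb 0 y * m (\<Phi> z 0) * Z m (\<Phi> z 0) + (4 * pb 2 y * z - 4 * ps 1 y) * m (\<Phi> z 0)
      + (4 * pt 0 y - 4 * ps 1 y * z + 2 * pb 2 y * z\<^sup>2) * Z m (\<Phi> z 0)
      + 4 * pb 2 y * M z + (4 * pb 2 y * z - 4 * ps 1 y) * m (\<Phi> z 0)
      - (8 * pe 1 y - 8 * pt 2 y * z + 4 * ps 3 y * z\<^sup>2 - 4 / 3 * pb 4 y * z ^ 3)) (at z)"
      unfolding L_def[abs_def]
      by (auto intro!: derivative_eq_intros DERIV_m[OF z] DERIV_M[OF z]
          simp: algebra_simps power2_eq_square power3_eq_cube)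
    moreover have "Y de (\<Phi> z y) = Z m (\<Phi> z 0) * ta (\<Phi> z y) / 2"
      using int_eq(5)[OF chartD(2)[OF chart z y]] m_chart(2)[OF z y] by simp
    ultimately show ?thesis
      unfolding Y_de_chart[OF z y] ta_chart[OF z y] by (rule DERIV_cong[OF _ relation_identity])
  qed
  then have "L z = L 0"  if "\<bar>z\<bar> < d" for z
    using const_ode[of d L z] that by simp
  then show thesis
    using that[of "L 0"] by (simp add: L_def algebra_simps)
qed

text \<open>Evaluating the relation at five values of \<open>z\<close> bounds \<open>pb 4\<close>, \<open>ps 3\<close> and \<open>pt 2\<close> by lower
  derivatives, so that Gronwall's argument applies.\<close>

lemma zero_if_zero_on_box:
  assumes z0: "\<bar>z0\<bar> < d" and y0: "\<bar>y0\<bar> < d" and e: "e > 0"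
    and zero: "\<And>y. \<bar>y - y0\<bar> < e \<Longrightarrow> \<bar>y\<bar> < d \<Longrightarrow>
      be (\<Phi> z0 y) = 0 \<and> si (\<Phi> z0 y) = 0 \<and> ta (\<Phi> z0 y) = 0 \<and> de (\<Phi> z0 y) = 0"
    and z: "\<bar>z\<bar> < d" and y: "\<bar>y\<bar> < d"
  shows "be (\<Phi> z y) = 0 \<and> si (\<Phi> z y) = 0 \<and> ta (\<Phi> z y) = 0 \<and> de (\<Phi> z y) = 0"
proof -
  define I where "I = {y0 - e<..<y0 + e} \<inter> {-d<..<d}"
  have openI: "open I" unfolding I_def by (intro open_Int open_greaterThanLessThan)
  have I: "\<bar>t - y0\<bar> < e \<and> \<bar>t\<bar> < d" if "t \<in> I" for t
    using that by (auto simp: I_def abs_less_iff)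
  have y0I: "y0 \<in> I" using y0 e by (auto simp: I_def abs_less_iff)
  have step: "\<forall>t\<in>I. f' t = 0" if "\<forall>t\<in>I. f t = 0" "\<And>t. \<bar>t\<bar> < d \<Longrightarrow> (f has_real_derivative f' t) (at t)" for f f'
  proof
    fix t assume t: "t \<in> I"
    have "((\<lambda>_. 0) has_real_derivative f' t) (at t)"
      by (rule has_field_derivative_transform_within_open[OF that(2) openI t]) (use I[OF t] that(1) in auto)
    then show "f' t = 0" using DERIV_unique[OF _ DERIV_const] by blast
  qed
  have iter: "\<forall>t\<in>I. f i t = 0" if "\<forall>t\<in>I. f 0 t = 0"
    "\<And>i t. \<bar>t\<bar> < d \<Longrightarrow> (f i has_real_derivative f (Suc i) t) (at t)" for f :: "nat \<Rightarrow> real \<Rightarrow> real" and i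
    by (induction i) (use that step in blast)+
  have "pb 0 t = 0" if "t \<in> I" for t
    using be_chart[OF z0, of t] zero[of t] I[OF that] by simp
  then have b: "\<forall>t\<in>I. pb i t = 0" for i
    by (rule iter[where f=pb, OF ballI DERIV_p(1)])
  have "ps 0 t = 0" if "t \<in> I" for t
    using si_chart[OF z0, of t] zero[of t] I[OF that] b[rule_format, OF that] by simp
  then have s: "\<forall>t\<in>I. ps i t = 0" for i
    by (rule iter[where f=ps, OF ballI DERIV_p(2)])
  have "pt 0 t = 0" if "t \<in> I" for t
    using ta_chart[OF z0, of t] zero[of t] I[OF that] b[rule_format, OF that] s[rule_format, OF that] by simp
  then have t: "\<forall>t\<in>I. pt i t = 0" for i
    by (rule iter[where f=pt, OF ballI DERIV_p(3)])
  have "pe 0 t = 0" if "t \<in> I" for t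
    using de_chart[OF z0, of t] zero[of t] I[OF that] b[rule_format, OF that] s[rule_format, OF that] t[rule_format, OF that] by simp
  then have e: "\<forall>t\<in>I. pe i t = 0" for i
    by (rule iter[where f=pe, OF ballI DERIV_p(4)])
  define h where "h = d / 3"
  have h: "h > 0" "2 * h < d" using d_pos by (simp_all add: h_def)
  obtain K where K: "\<And>S c0 c1 c2 c3 c4 B. (\<And>z. \<bar>z\<bar> \<le> 2 * h \<Longrightarrow> S z = c0 + c1 * z + c2 * z\<^sup>2 + c3 * z ^ 3 + c4 * z ^ 4) \<Longrightarrow>
    \<bar>S (-2 * h)\<bar> \<le> B \<Longrightarrow> \<bar>S (- h)\<bar> \<le> B \<Longrightarrow> \<bar>S 0\<bar> \<le> B \<Longrightarrow> \<bar>S h\<bar> \<le> B \<Longrightarrow> \<bar>S (2 * h)\<bar> \<le> B \<Longrightarrow>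
    \<bar>c2\<bar> \<le> K * B \<and> \<bar>c3\<bar> \<le> K * B \<and> \<bar>c4\<bar> \<le> K * B"
    using quartic_coefficients_bounded[OF h(1)] by blast
  \<comment> \<open>All derivatives of orders below those of \<open>pb 4\<close>,
    \<open>ps 3\<close> and \<open>pt 2\<close>, except \<open>ps 0\<close>. The left-hand side of
    the relation is linear in entries of this list, and \<open>pe 1\<close> occurs only in the
    linear coefficient on the right, which needs no bound. \<open>ps 0\<close> and
    \<open>pe 0\<close> are treated at the end.\<close>
  define X where "X y = [pb 0 y, pb 1 y, pb 2 y, pb 3 y, ps 1 y, ps 2 y, pt 0 y, pt 1 y]" for y
  define X' where "X' y = [pb 1 y, pb 2 y, pb 3 y, pb 4 y, ps 2 y, ps 3 y, pt 1 y, pt 2 y]" for y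
  define s where "s y = (\<Sum>j<8. \<bar>X y ! j\<bar>)" for y
  have lt8: "i < 8 \<longleftrightarrow> i = 0 \<or> i = 1 \<or> i = 2 \<or> i = 3 \<or> i = 4 \<or> i = 5 \<or> i = 6 \<or> i = (7::nat)" for i
    by auto
  have s0: "s y \<ge> 0" for y unfolding s_def by (rule sum_nonneg) simp
  have X_le: "\<bar>X y ! j\<bar> \<le> s y" if "j < 8" for j y
    unfolding s_def by (rule member_le_sum[where f="\<lambda>j. \<bar>X y ! j\<bar>"]) (use that in simp_all)
  have s_ge: "\<bar>pb 0 y\<bar> \<le> s y" "\<bar>pb 1 y\<bar> \<le> s y" "\<bar>pb 2 y\<bar> \<le> s y" "\<bar>pb 3 y\<bar> \<le> s y"
    "\<bar>ps 1 y\<bar> \<le> s y" "\<bar>ps 2 y\<bar> \<le> s y" "\<bar>pt 0 y\<bar> \<le> s y" "\<bar>pt 1 y\<bar> \<le> s y" for y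
    using X_le[of 0 y] X_le[of 1 y] X_le[of 2 y] X_le[of 3 y] X_le[of 4 y] X_le[of 5 y] X_le[of 6 y] X_le[of 7 y]
    by (simp_all only: X_def) (simp_all add: eval_nat_numeral)
  \<comment> \<open>The absolute values of the factors of \<open>pb 0\<close>, \<open>pt 0\<close>,
    \<open>ps 1\<close> and \<open>pb 2\<close> on the left-hand side of the relation.\<close>
  define W where "W z = 3 * (m (\<Phi> z 0))\<^sup>2 + 4 * m (\<Phi> z 0) + \<bar>4 * z * m (\<Phi> z 0) + 4 * M z\<bar>
      + \<bar>2 * z\<^sup>2 * m (\<Phi> z 0) + 4 * z * M z\<bar>" for z
  define L where "L = W (-2 * h) + W (- h) + W 0 + W h + W (2 * h)"
  have W0: "W z \<ge> 0" if "\<bar>z\<bar> < d" for z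
    using m_pos[OF chartD(2)[OF chart that, of 0]] d_pos unfolding W_def by (intro add_nonneg_nonneg) auto
  have LW: "W (-2 * h) \<le> L" "W (- h) \<le> L" "W 0 \<le> L" "W h \<le> L" "W (2 * h) \<le> L"
    using W0[of "-2 * h"] W0[of "- h"] W0[of 0] W0[of h] W0[of "2 * h"] h unfolding L_def by auto
  have bound: "\<bar>pt 2 y\<bar> \<le> \<bar>K\<bar> * L * s y \<and> \<bar>ps 3 y\<bar> \<le> \<bar>K\<bar> * L * s y \<and> \<bar>pb 4 y\<bar> \<le> 3 * \<bar>K\<bar> * L * s y"
    if y: "\<bar>y\<bar> < d" for y
  proof -
    obtain C where C: "\<And>z. \<bar>z\<bar> < d \<Longrightarrow>
      3 * pb 0 y * (m (\<Phi> z 0))\<^sup>2 + (4 * pt 0 y - 4 * ps 1 y * z + 2 * pb 2 y * z\<^sup>2) * m (\<Phi> z 0)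
      + (4 * pb 2 y * z - 4 * ps 1 y) * M z
      = C + 8 * pe 1 y * z - 4 * pt 2 y * z\<^sup>2 + 4 / 3 * ps 3 y * z ^ 3 - 1 / 3 * pb 4 y * z ^ 4"
      using integral_relation[OF y] by blast
    define S where "S z = 3 * pb 0 y * (m (\<Phi> z 0))\<^sup>2
      + (4 * pt 0 y - 4 * ps 1 y * z + 2 * pb 2 y * z\<^sup>2) * m (\<Phi> z 0) + (4 * pb 2 y * z - 4 * ps 1 y) * M z" for z
    have SB: "\<bar>S z\<bar> \<le> W z * s y" if z: "\<bar>z\<bar> < d" for z
    proof -
      have mp: "m (\<Phi> z 0) > 0" using m_pos[OF chartD(2)[OF chart z, of 0]] d_pos by simp
      define A1 A2 A3 A4 where "A1 = 3 * (m (\<Phi> z 0))\<^sup>2" and "A2 = 4 * m (\<Phi> z 0)"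
        and "A3 = 4 * z * m (\<Phi> z 0) + 4 * M z" and "A4 = 2 * z\<^sup>2 * m (\<Phi> z 0) + 4 * z * M z"
      have Wz: "W z = \<bar>A1\<bar> + \<bar>A2\<bar> + \<bar>A3\<bar> + \<bar>A4\<bar>"
        using mp by (simp add: W_def A1_def A2_def A3_def A4_def)
      have Sz: "S z = A1 * pb 0 y + A2 * pt 0 y - A3 * ps 1 y + A4 * pb 2 y"
        by (simp add: S_def A1_def A2_def A3_def A4_def algebra_simps)
      have "\<bar>S z\<bar> \<le> \<bar>A1\<bar> * \<bar>pb 0 y\<bar> + \<bar>A2\<bar> * \<bar>pt 0 y\<bar> + \<bar>A3\<bar> * \<bar>ps 1 y\<bar> + \<bar>A4\<bar> * \<bar>pb 2 y\<bar>"
        unfolding Sz abs_mult[symmetric] by (rule abs_combination_le)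
      moreover have "\<bar>A1\<bar> * \<bar>pb 0 y\<bar> + \<bar>A2\<bar> * \<bar>pt 0 y\<bar> + \<bar>A3\<bar> * \<bar>ps 1 y\<bar> + \<bar>A4\<bar> * \<bar>pb 2 y\<bar>
          \<le> W z * s y"
        unfolding Wz distrib_right by (intro add_mono mult_left_mono s_ge abs_ge_zero)
      ultimately show ?thesis by (rule order_trans)
    qed
    have SL: "\<bar>S z\<bar> \<le> L * s y" if "\<bar>z\<bar> < d" "W z \<le> L" for z
      by (rule order_trans[OF SB[OF that(1)] mult_right_mono[OF that(2) s0]])
    have "\<bar>- 4 * pt 2 y\<bar> \<le> K * (L * s y) \<and> \<bar>4 / 3 * ps 3 y\<bar> \<le> K * (L * s y) \<and> \<bar>- 1 / 3 * pb 4 y\<bar> \<le> K * (L * s y)"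
    proof (rule K)
      show "S z = C + (8 * pe 1 y) * z + (- 4 * pt 2 y) * z\<^sup>2 + (4 / 3 * ps 3 y) * z ^ 3 + (- 1 / 3 * pb 4 y) * z ^ 4"
        if "\<bar>z\<bar> \<le> 2 * h" for z
        using C[of z] that h unfolding S_def by simp
    qed (rule SL; use LW h in simp)+
    moreover have "K * (L * s y) \<le> \<bar>K\<bar> * L * s y"
    proof -
      have "0 \<le> L" using LW(3) W0[of 0] d_pos by simp
      then have "K * (L * s y) \<le> \<bar>K\<bar> * (L * s y)" using s0[of y] by (intro mult_right_mono) auto
      then show ?thesis by (simp add: mult.assoc)
    qed
    moreover have quot: "\<bar>x\<bar> \<le> c * r" if "\<bar>x\<bar> * a \<le> r" "1 \<le> a * c" "0 < a" for x a c r :: real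
    proof -
      have "\<bar>x\<bar> * 1 \<le> \<bar>x\<bar> * (a * c)" using that(2) by (intro mult_left_mono) auto
      also have "\<dots> = c * (\<bar>x\<bar> * a)" by simp
      also have "\<dots> \<le> c * r"
      proof (rule mult_left_mono[OF that(1)])
        have "0 < a * c" using that(2) by linarith
        then show "0 \<le> c" using that(3) by (simp add: zero_less_mult_iff)
      qed
      finally show ?thesis by simp
    qed
    ultimately have "\<bar>pt 2 y\<bar> * 4 \<le> \<bar>K\<bar> * L * s y" "\<bar>ps 3 y\<bar> * (4 / 3) \<le> \<bar>K\<bar> * L * s y"
      "\<bar>pb 4 y\<bar> * (1 / 3) \<le> \<bar>K\<bar> * L * s y"
      by (simp_all only: abs_mult) (simp_all add: mult.commute)
    then show ?thesis
      using quot[of "pt 2 y" 4 _ 1] quot[of "ps 3 y" "4 / 3" _ 1] quot[of "pb 4 y" "1 / 3" _ 3] by simp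
  qed
  have L0: "0 \<le> \<bar>K\<bar> * L" using LW(3) W0[of 0] d_pos by simp
  \<comment> \<open>The factor 3 compensates the coefficient 1/3 of \<open>pb 4\<close> in the
    relation; the summand 1 covers those entries of \<open>X'\<close> that are entries of
    \<open>X\<close>.\<close>
  define K' where "K' = 3 * (\<bar>K\<bar> * L) + 1"
  have zero8: "X t ! i = 0" if "i < 8" "\<bar>t\<bar> < d" for i t
  proof (rule linear_ode_zero[of 8 d "\<lambda>i y. X y ! i" "\<lambda>i y. X' y ! i" K' y0, OF _ _ y0 _ that])
    show "((\<lambda>y. X y ! i) has_real_derivative X' y ! i) (at y)" if "i < 8" "\<bar>y\<bar> < d" for i y
      using that(1) DERIV_p(1)[OF that(2), of 0] DERIV_p(1)[OF that(2), of 1] DERIV_p(1)[OF that(2), of 2]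
        DERIV_p(1)[OF that(2), of 3] DERIV_p(2)[OF that(2), of 1] DERIV_p(2)[OF that(2), of 2]
        DERIV_p(3)[OF that(2), of 0] DERIV_p(3)[OF that(2), of 1]
      unfolding lt8 X_def X'_def by (elim disjE) (simp_all add: eval_nat_numeral)
    show "\<bar>X' y ! i\<bar> \<le> K' * (\<Sum>j<8. \<bar>X y ! j\<bar>)" if i: "i < 8" and y: "\<bar>y\<bar> < d" for i y
    proof -
      have P: "0 \<le> \<bar>K\<bar> * L * s y" by (rule mult_nonneg_nonneg[OF L0 s0])
      have "K' * s y = 3 * (\<bar>K\<bar> * L * s y) + s y" by (simp add: K'_def algebra_simps)
      moreover have "\<bar>X' y ! i\<bar> \<le> 3 * (\<bar>K\<bar> * L * s y) + s y"
      proof -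
        have A: "\<bar>a\<bar> \<le> 3 * (\<bar>K\<bar> * L * s y) + s y" if "\<bar>a\<bar> \<le> s y \<or> \<bar>a\<bar> \<le> \<bar>K\<bar> * L * s y \<or> \<bar>a\<bar> \<le> 3 * \<bar>K\<bar> * L * s y" for a
          using that P s0[of y] by (elim disjE) (simp_all add: mult.assoc)
        have B: "\<bar>pb 4 y\<bar> \<le> 3 * \<bar>K\<bar> * L * s y" "\<bar>ps 3 y\<bar> \<le> \<bar>K\<bar> * L * s y" "\<bar>pt 2 y\<bar> \<le> \<bar>K\<bar> * L * s y"
          using bound[OF y] by blast+
        note A1 = A[OF disjI1] and A2 = A[OF disjI2[OF disjI1]] and A3 = A[OF disjI2[OF disjI2]]
        have "\<forall>a\<in>set (X' y). \<bar>a\<bar> \<le> 3 * (\<bar>K\<bar> * L * s y) + s y"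
          unfolding X'_def list.set
          by (intro ballI, elim insertE emptyE; hypsubst,
              rule A1[OF s_ge(2)] A1[OF s_ge(3)] A1[OF s_ge(4)] A3[OF B(1)] A1[OF s_ge(6)] A2[OF B(2)] A1[OF s_ge(8)] A2[OF B(3)])
        moreover have "X' y ! i \<in> set (X' y)" using i by (intro nth_mem) (simp add: X'_def)
        ultimately show ?thesis by blast
      qed
      ultimately show ?thesis unfolding s_def by simp
    qed
    show "X y0 ! i = 0" if "i < 8" for i
      using that b s t y0I unfolding lt8 X_def by (elim disjE) (simp_all add: eval_nat_numeral)
  qed
  have zs: "pb 0 t = 0" "pb 1 t = 0" "pb 2 t = 0" "pb 3 t = 0" "ps 1 t = 0" "ps 2 t = 0" "pt 0 t = 0" "pt 1 t = 0"
    if "\<bar>t\<bar> < d" for t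
    using zero8[OF _ that, of 0] zero8[OF _ that, of 1] zero8[OF _ that, of 2] zero8[OF _ that, of 3]
      zero8[OF _ that, of 4] zero8[OF _ that, of 5] zero8[OF _ that, of 6] zero8[OF _ that, of 7]
    by (simp_all add: X_def eval_nat_numeral)
  have ps0: "ps 0 t = 0" if t: "\<bar>t\<bar> < d" for t
  proof -
    have c: "ps 0 t = ps 0 0" if "\<bar>t\<bar> < d" for t
      by (rule const_ode[of d "ps 0", OF _ that]) (use DERIV_p(2)[of _ 0] zs in simp)
    show ?thesis using c[OF t] c[OF y0] s y0I by simp
  qed
  have pe0: "pe 0 t = 0" if t: "\<bar>t\<bar> < d" for t
  proof -
    have eq: "de (\<Phi> 0 t) = pe 0 t" if t: "\<bar>t\<bar> < d" for t
      using de_chart[OF _ t, of 0] d_pos zs[OF t] ps0[OF t] by (simp add: M_0)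
    have "pe 1 t = 0" if t: "\<bar>t\<bar> < d" for t
    proof -
      have "Y de (\<Phi> 0 t) = pe 1 t"
        using Y_chart[OF int_smooth(4) _ t eq DERIV_p(4)[OF t]] d_pos by simp
      moreover have "Y de (\<Phi> 0 t) = 0"
        using int_eq(5)[OF chartD(2)[OF chart _ t, of 0]] ta_chart[OF _ t, of 0] d_pos zs[OF t] by simp
      ultimately show ?thesis by simp
    qed
    then have c: "pe 0 t = pe 0 0" if "\<bar>t\<bar> < d" for t
      by (intro const_ode[of d "pe 0", OF _ that]) (use DERIV_p(4)[of _ 0] in simp)
    show ?thesis using c[OF t] c[OF y0] e y0I by simp
  qed
  show ?thesis
    unfolding be_chart[OF z y] si_chart[OF z y] ta_chart[OF z y] de_chart[OF z y] zs[OF y] ps0[OF y] pe0[OF y]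
    by simp
qed

text \<open>All higher derivatives of the three functions vanish as well, so \<open>si\<close> is
  constant and the equation for \<open>Y de\<close> makes \<open>pe 0\<close> constant. What is left
  is \<open>c\<close> times \<open>2 H k\<close> plus \<open>e\<close> times
  \<open>k^3\<close>.\<close>

lemma remainder:
  assumes "\<And>y. \<bar>y\<bar> < d \<Longrightarrow> pb 0 y = 0" "\<And>y. \<bar>y\<bar> < d \<Longrightarrow> ps 1 y = 0" "\<And>y. \<bar>y\<bar> < d \<Longrightarrow> pt 0 y = 0"
  obtains c e where "\<And>z y. \<bar>z\<bar> < d \<Longrightarrow> \<bar>y\<bar> < d \<Longrightarrow>
    be (\<Phi> z y) = 0 \<and> si (\<Phi> z y) = c \<and> ta (\<Phi> z y) = 0 \<and> de (\<Phi> z y) = c * m (\<Phi> z y) + e"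
proof -
  have step: "g y = 0" if "\<And>y. \<bar>y\<bar> < d \<Longrightarrow> f y = 0" "(f has_real_derivative g y) (at y)" "\<bar>y\<bar> < d" for f g y
    by (rule DERIV_unique_on_interval[of d f "\<lambda>_. 0", OF that(1,3,2) DERIV_const])
  have b: "pb i y = 0" if "\<bar>y\<bar> < d" for i y
    using that
  proof (induction i arbitrary: y)
    case (Suc i)
    show ?case by (rule step[where f="pb i" and g="pb (Suc i)", OF Suc.IH DERIV_p(1)[OF Suc.prems] Suc.prems])
  qed (rule assms)
  have s: "ps 2 y = 0" if "\<bar>y\<bar> < d" for y
    using step[where f="ps 1" and g="ps (Suc 1)", OF assms(2) DERIV_p(2)[OF that, of 1] that] by (simp add: numeral_2_eq_2)
  have t: "pt 1 y = 0" if "\<bar>y\<bar> < d" for y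
    using step[where f="pt 0" and g="pt (Suc 0)", OF assms(3) DERIV_p(3)[OF that, of 0] that] by simp
  have c: "ps 0 y = ps 0 0" if "\<bar>y\<bar> < d" for y
    by (rule const_ode[of d "ps 0", OF _ that]) (use DERIV_p(2)[of _ 0] assms(2) in simp)
  have de: "de (\<Phi> z y) = ps 0 0 * m (\<Phi> z y) + pe 0 y" if "\<bar>z\<bar> < d" "\<bar>y\<bar> < d" for z y
    using de_chart[OF that] b[OF that(2)] s[OF that(2)] t[OF that(2)] c[OF that(2)] m_chart(1)[OF that]
    by simp
  have ta: "ta (\<Phi> z y) = 0" if "\<bar>z\<bar> < d" "\<bar>y\<bar> < d" for z y
    using ta_chart[OF that] b[OF that(2)] assms(2,3)[OF that(2)] by simp
  have "pe 1 y = 0" if y: "\<bar>y\<bar> < d" for y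
  proof -
    have z: "\<bar>0\<bar> < d" using d_pos by simp
    have "Y de (\<Phi> 0 y) = pe 1 y"
    proof (rule Y_chart[OF int_smooth(4) z y])
      show "de (\<Phi> 0 y) = ps 0 0 * m (\<Phi> 0 0) + pe 0 y" if "\<bar>y\<bar> < d" for y
        using de[OF z that] m_chart(1)[OF z that] by simp
      show "((\<lambda>y. ps 0 0 * m (\<Phi> 0 0) + pe 0 y) has_real_derivative pe 1 y) (at y)"
        using DERIV_add[OF DERIV_const DERIV_p(4)[OF y, of 0]] by simp
    qed
    then show ?thesis using int_eq(5)[OF chartD(2)[OF chart z y]] ta[OF z y] by simp
  qed
  then have e: "pe 0 y = pe 0 0" if "\<bar>y\<bar> < d" for y
    by (intro const_ode[of d "pe 0", OF _ that]) (use DERIV_p(4)[of _ 0] in simp)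
  show thesis
  proof (rule that[of "ps 0 0" "pe 0 0"])
    fix z y assume zy: "\<bar>z\<bar> < d" "\<bar>y\<bar> < d"
    show "be (\<Phi> z y) = 0 \<and> si (\<Phi> z y) = ps 0 0 \<and> ta (\<Phi> z y) = 0 \<and> de (\<Phi> z y) = ps 0 0 * m (\<Phi> z y) + pe 0 0"
      using be_chart[OF zy] si_chart[OF zy] b[OF zy(2)] c[OF zy(2)] ta[OF zy] de[OF zy] e[OF zy(2)] by simp
  qed
qed

end

end

end

section \<open>The space of cubic integrals\<close>

context scale_invariant_metric
begin

lemma frame_integral_lincomb:
  assumes 1: "frame_integral be si ta de" and 2: "frame_integral be' si' ta' de'"
  shows "frame_integral (\<lambda>x. be x + c * be' x) (\<lambda>x. si x + c * si' x) (\<lambda>x. ta x + c * ta' x) (\<lambda>x. de x + c * de' x)"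
proof -
  note sm = frame_integral_smooth[OF 1] frame_integral_smooth[OF 2]
  have YZ: "Y (\<lambda>x. f x + c * g x) x = Y f x + c * Y g x" "Z (\<lambda>x. f x + c * g x) x = Z f x + c * Z g x"
    if f: "smooth_on f U" and g: "smooth_on g U" and x: "x \<in> U" for f g x
  proof -
    note sc = smooth_on_const[OF open_U, of c]
    note scg = smooth_on_mult[OF open_U sc g]
    show "Y (\<lambda>x. f x + c * g x) x = Y f x + c * Y g x" "Z (\<lambda>x. f x + c * g x) x = Z f x + c * Z g x"
      unfolding Y_add[OF f scg x] Z_add[OF f scg x] Y_mult[OF sc g x] Z_mult[OF sc g x] Y_const Z_const by simp_all
  qed
  show ?thesis
    unfolding frame_integral_def
  proof (intro conjI ballI)
    fix x assume x: "x \<in> U"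
    note e = frame_integral_eqs[OF 1 x] frame_integral_eqs[OF 2 x]
    note yz = YZ[OF sm(1,5) x] YZ[OF sm(2,6) x] YZ[OF sm(3,7) x] YZ[OF sm(4,8) x]
    show "Z (\<lambda>x. be x + c * be' x) x = 0" "Z (\<lambda>x. si x + c * si' x) x + Y (\<lambda>x. be x + c * be' x) x = 0"
      "Z (\<lambda>x. ta x + c * ta' x) x + Y (\<lambda>x. si x + c * si' x) x - 3 / 2 * Z m x * (be x + c * be' x) = 0"
      "Z (\<lambda>x. de x + c * de' x) x + Y (\<lambda>x. ta x + c * ta' x) x - Z m x * (si x + c * si' x) = 0"
      "Y (\<lambda>x. de x + c * de' x) x - Z m x * (ta x + c * ta' x) / 2 = 0"
      unfolding yz e by (simp_all add: algebra_simps add_divide_distrib)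
  qed (intro smooth_ring sm)+
qed

text \<open>Let \<open>T\<close> be the interior of the common zero set. By
  \<open>zero_if_zero_on_box\<close> a chart that meets \<open>T\<close> lies in it, so
  \<open>T\<close> and its complement in \<open>U\<close> are both open.\<close>

lemma unique_continuation:
  assumes int: "frame_integral be si ta de"
    and W: "open W" "W \<subseteq> U" "W \<noteq> {}"
    and zero: "\<And>x. x \<in> W \<Longrightarrow> be x = 0 \<and> si x = 0 \<and> ta x = 0 \<and> de x = 0"
    and x: "x \<in> U"
  shows "be x = 0 \<and> si x = 0 \<and> ta x = 0 \<and> de x = 0"
proof -
  define P where "P x \<longleftrightarrow> be x = 0 \<and> si x = 0 \<and> ta x = 0 \<and> de x = 0" for x
  define T where "T = interior {x \<in> U. P x}"
  have T: "T \<subseteq> {x \<in> U. P x}" "open T" by (simp_all add: T_def interior_subset)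
  have loc: "\<exists>V. open V \<and> x \<in> V \<and> V \<subseteq> U \<and> (V \<inter> T \<noteq> {} \<longrightarrow> V \<subseteq> T)" if x: "x \<in> U" for x
  proof -
    obtain d \<Phi> M where ch: "chart d \<Phi>" "\<Phi> 0 0 = x" "M 0 = 0"
      and M: "\<And>z. \<bar>z\<bar> < d \<Longrightarrow> (M has_real_derivative m (\<Phi> z 0)) (at z)"
      using chart_primitive_exists[OF x] by metis
    note c = chartD[OF ch(1)]
    let ?R = "{-d<..<d} \<times> {-d<..<d}"
    define V where "V = (\<lambda>(z, y). \<Phi> z y) ` ?R"
    have oV: "open V" unfolding V_def by (rule c(7))
    have xV: "x \<in> V" unfolding V_def using ch(2) c(1) by (intro image_eqI[of _ _ "(0, 0)"]) auto
    have VU: "V \<subseteq> U" unfolding V_def using c(2) by (auto simp: abs_less_iff)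
    have "V \<subseteq> T" if meets: "V \<inter> T \<noteq> {}"
    proof -
      obtain z0 y0 where zy0: "\<bar>z0\<bar> < d" "\<bar>y0\<bar> < d" "\<Phi> z0 y0 \<in> T"
      proof -
        obtain p where p: "p \<in> ?R" "(\<lambda>(z, y). \<Phi> z y) p \<in> T" using meets unfolding V_def by blast
        have "\<bar>fst p\<bar> < d" "\<bar>snd p\<bar> < d" "\<Phi> (fst p) (snd p) \<in> T"
          using p by (auto simp: abs_less_iff case_prod_beta mem_Times_iff)
        then show thesis by (rule that)
      qed
      have cont: "continuous_on {-d<..<d} (\<lambda>y. \<Phi> z0 y)"
      proof -
        have im: "Pair z0 ` {-d<..<d} \<subseteq> ?R" using zy0 by (auto simp: abs_less_iff)
        have "continuous_on {-d<..<d} (Pair z0)" by (intro continuous_intros)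
        from continuous_on_compose2[OF c(5) this im] show ?thesis by simp
      qed
      have "open ({-d<..<d} \<inter> (\<lambda>y. \<Phi> z0 y) -` T)"
        by (rule continuous_open_preimage[OF cont open_greaterThanLessThan T(2)])
      moreover have "y0 \<in> {-d<..<d} \<inter> (\<lambda>y. \<Phi> z0 y) -` T" using zy0 by (simp add: abs_less_iff)
      ultimately obtain e where e: "e > 0" "ball y0 e \<subseteq> {-d<..<d} \<inter> (\<lambda>y. \<Phi> z0 y) -` T"
        using openE by blast
      have box: "P (\<Phi> z0 y)" if "\<bar>y - y0\<bar> < e" for y
      proof -
        have "y \<in> ball y0 e" using that by (simp add: dist_real_def abs_minus_commute)
        then have "\<Phi> z0 y \<in> T" using e(2) by blast
        then show ?thesis using T(1) by blast
      qed
      have "P (\<Phi> z y)" if "\<bar>z\<bar> < d" "\<bar>y\<bar> < d" for z y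
        unfolding P_def
        by (rule zero_if_zero_on_box[OF ch(1,3) M int zy0(1,2) e(1) box[unfolded P_def] that])
      then have "V \<subseteq> {x \<in> U. P x}" using VU by (auto simp: V_def abs_less_iff)
      then show "V \<subseteq> T" unfolding T_def by (rule interior_maximal) (rule oV)
    qed
    then show ?thesis using oV xV VU by blast
  qed
  have "open (U - T)"
  proof (subst open_subopen, intro ballI)
    fix x assume x: "x \<in> U - T"
    then obtain V where "open V" "x \<in> V" "V \<subseteq> U" "V \<inter> T \<noteq> {} \<longrightarrow> V \<subseteq> T" using loc by blast
    then show "\<exists>V. open V \<and> x \<in> V \<and> V \<subseteq> U - T" using x by (intro exI[of _ V]) blast
  qed
  then have "T \<inter> U = {} \<or> (U - T) \<inter> U = {}"
    by (intro connectedD[OF connected_U T(2)]) auto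
  moreover have "W \<subseteq> T" unfolding T_def
    by (rule interior_maximal[OF _ W(1)]) (use W(2) zero in \<open>auto simp: P_def\<close>)
  ultimately have "U \<subseteq> T" using W by blast
  then show ?thesis using T(1) x unfolding P_def by blast
qed

text \<open>The parameters multiply, in this order, the web integral, its reflection,
  \<open>2 H k\<close> and \<open>k^3\<close>.\<close>

definition combination where
  "combination a b c e = cubic (\<lambda>x. a * be0 x + b * (rho x * be0 x)) (\<lambda>x. a * si0 x - b * (rho x * si0 x) + c)
    (\<lambda>x. a * ta0 x + b * (rho x * ta0 x)) (\<lambda>x. a * de0 x - b * (rho x * de0 x) + c * m x + e)"

lemma Y_power_homogeneous:
  assumes "homogeneous (-1) f" "x \<in> U"
  shows "(Y ^^ i) f x = (-1) ^ i * f x"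
  using assms(2)
proof (induction i arbitrary: x)
  case (Suc i)
  have sm: "smooth_on f U" "smooth_on (\<lambda>_. (-1) ^ i) U"
    using assms(1) smooth_on_const[OF open_U] by (simp_all add: homogeneous_def)
  have "(Y ^^ Suc i) f x = Y (\<lambda>x. (-1) ^ i * f x) x"
    unfolding funpow.simps comp_def Y_def[of _ x]
    using du_dv_cong[OF open_U Suc.prems Suc.IH smooth_on_mult[OF open_U sm(2,1)]] by (simp only:)
  also have "\<dots> = (-1) ^ i * Y f x" unfolding Y_mult[OF sm(2,1) Suc.prems] Y_const by simp
  finally show ?case using homogeneousD[OF assms(1) Suc.prems] by simp
qed simp

text \<open>In the first case of the conclusion the transversal leading coefficient is an
  eigenfunction of the second derivative along the Killing field, in the second case the next
  coefficient is. Subtracting suitable multiples of the two integrals of nonzero weight leaves a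
  combination of \<open>2 H k\<close> and \<open>k\<^sup>3\<close>.\<close>

lemma local_combination:
  assumes ch: "chart d \<Phi>" and M0: "M 0 = 0"
    and M: "\<And>z. \<bar>z\<bar> < d \<Longrightarrow> (M has_real_derivative m (\<Phi> z 0)) (at z)"
    and nc: "\<not> (\<exists>A. degree A \<le> 3 \<and> (\<forall>z. \<bar>z\<bar> < d \<longrightarrow> M z = poly A z))"
    and J: "frame_integral be si ta de"
  obtains a b c e where "\<And>z y. \<bar>z\<bar> < d \<Longrightarrow> \<bar>y\<bar> < d \<Longrightarrow>
      be (\<Phi> z y) + a * be0 (\<Phi> z y) + b * (rho (\<Phi> z y) * be0 (\<Phi> z y)) = 0 \<and>
      si (\<Phi> z y) + a * si0 (\<Phi> z y) + b * (- (rho (\<Phi> z y) * si0 (\<Phi> z y))) = c \<and>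
      ta (\<Phi> z y) + a * ta0 (\<Phi> z y) + b * (rho (\<Phi> z y) * ta0 (\<Phi> z y)) = 0 \<and>
      de (\<Phi> z y) + a * de0 (\<Phi> z y) + b * (- (rho (\<Phi> z y) * de0 (\<Phi> z y))) = c * m (\<Phi> z y) + e"
proof -
  note c = chartD[OF ch]
  have z0: "\<bar>0\<bar> < d" using c(1) by simp
  define b0 s0 r0 where "b0 = be0 (\<Phi> 0 0)" and "s0 = si0 (\<Phi> 0 0)" and "r0 = rho (\<Phi> 0 0)"
  define t0 where "t0 = pt \<Phi> be0 ta0 0 0"
  have x0: "\<Phi> 0 0 \<in> U" by (rule c(2)[OF z0 z0])
  have r0: "r0 \<noteq> 0" unfolding r0_def by (rule rho_nonzero[OF x0])
  have nz: "b0 \<noteq> 0 \<or> s0 \<noteq> 0" using si0_nonzero[OF x0] by (auto simp: b0_def s0_def)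
  note hp = Y_power_homogeneous[OF homogeneous_web(1) x0] Y_power_homogeneous[OF homogeneous_web(2) x0]
    Y_power_homogeneous[OF homogeneous_web(3) x0]
  have pdefs: "pb \<Phi> be i y = (Y ^^ i) be (\<Phi> 0 y)" "ps \<Phi> si i y = (Y ^^ i) si (\<Phi> 0 y)"
    "pt \<Phi> be ta i y = (Y ^^ i) ta (\<Phi> 0 y) - 3 / 2 * m (\<Phi> 0 0) * (Y ^^ i) be (\<Phi> 0 y)"
    if "frame_integral be si ta de" for be si ta de i y
  proof -
    have pr: "profile \<Phi> f i y = (Y ^^ i) f (\<Phi> 0 y)" for f by (rule profile_def[OF ch M0 M])
    have "pb \<Phi> be = profile \<Phi> be" by (rule pb_def[OF ch M0 M that])
    then show "pb \<Phi> be i y = (Y ^^ i) be (\<Phi> 0 y)" by (simp only: pr)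
    have "ps \<Phi> si = profile \<Phi> si" by (rule ps_def[OF ch M0 M that])
    then show "ps \<Phi> si i y = (Y ^^ i) si (\<Phi> 0 y)" by (simp only: pr)
    have "pt \<Phi> be ta i y = profile \<Phi> ta i y - 3 / 2 * m (\<Phi> 0 0) * profile \<Phi> be i y"
      by (rule pt_def[OF ch M0 M that])
    then show "pt \<Phi> be ta i y = (Y ^^ i) ta (\<Phi> 0 y) - 3 / 2 * m (\<Phi> 0 0) * (Y ^^ i) be (\<Phi> 0 y)"
      by (simp only: pr)
  qed
  have p0: "pb \<Phi> be0 i 0 = (-1) ^ i * b0" "ps \<Phi> si0 i 0 = (-1) ^ i * s0" "pt \<Phi> be0 ta0 i 0 = (-1) ^ i * t0" for i
    unfolding t0_def pdefs[OF frame_integral_web] hp by (simp_all add: b0_def s0_def algebra_simps)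
  obtain C where C: "\<And>z. \<bar>z\<bar> < d \<Longrightarrow>
    3 * pb \<Phi> be0 0 0 * (m (\<Phi> z 0))\<^sup>2 + (4 * pt \<Phi> be0 ta0 0 0 - 4 * ps \<Phi> si0 1 0 * z + 2 * pb \<Phi> be0 2 0 * z\<^sup>2) * m (\<Phi> z 0)
      + (4 * pb \<Phi> be0 2 0 * z - 4 * ps \<Phi> si0 1 0) * M z
    = C + 8 * pe \<Phi> si0 de0 1 0 * z - 4 * pt \<Phi> be0 ta0 2 0 * z\<^sup>2 + 4 / 3 * ps \<Phi> si0 3 0 * z ^ 3 - 1 / 3 * pb \<Phi> be0 4 0 * z ^ 4"
    using integral_relation[OF ch M0 M frame_integral_web z0] by blast
  interpret pr: primitive_relation d M "\<lambda>z. m (\<Phi> z 0)" b0 s0 t0 C "8 * pe \<Phi> si0 de0 1 0"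
  proof
    show "d > 0" by (rule c(1))
    show "3 * b0 * (m (\<Phi> z 0))\<^sup>2 + (4 * t0 + 4 * s0 * z + 2 * b0 * z\<^sup>2) * m (\<Phi> z 0) + (4 * s0 + 4 * b0 * z) * M z
        = C + 8 * pe \<Phi> si0 de0 1 0 * z - 4 * t0 * z\<^sup>2 - 4 / 3 * s0 * z ^ 3 - 1 / 3 * b0 * z ^ 4" if "\<bar>z\<bar> < d" for z
      using C[OF that] unfolding p0 by (simp add: algebra_simps)
  qed (use M nz nc in auto)
  have ratio: "(b0 \<noteq> 0 \<longrightarrow> pb \<Phi> be 2 y = pb \<Phi> be 0 y \<and> - ps \<Phi> si 1 y * b0 = pb \<Phi> be 0 y * s0 \<and>
        pt \<Phi> be ta 0 y * b0 = pb \<Phi> be 0 y * t0) \<and>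
      (b0 = 0 \<longrightarrow> pb \<Phi> be 0 y = 0) \<and>
      (b0 = 0 \<and> pb \<Phi> be 2 y = 0 \<longrightarrow> pt \<Phi> be ta 0 y * s0 = - ps \<Phi> si 1 y * t0 \<and> ps \<Phi> si 3 y = ps \<Phi> si 1 y)"
    if J: "frame_integral be si ta de" and y: "\<bar>y\<bar> < d" for be si ta de y
  proof -
    obtain C' where C': "\<And>z. \<bar>z\<bar> < d \<Longrightarrow>
      3 * pb \<Phi> be 0 y * (m (\<Phi> z 0))\<^sup>2 + (4 * pt \<Phi> be ta 0 y - 4 * ps \<Phi> si 1 y * z + 2 * pb \<Phi> be 2 y * z\<^sup>2) * m (\<Phi> z 0)
        + (4 * pb \<Phi> be 2 y * z - 4 * ps \<Phi> si 1 y) * M z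
      = C' + 8 * pe \<Phi> si de 1 y * z - 4 * pt \<Phi> be ta 2 y * z\<^sup>2 + 4 / 3 * ps \<Phi> si 3 y * z ^ 3 - 1 / 3 * pb \<Phi> be 4 y * z ^ 4"
      using integral_relation[OF ch M0 M J y] by blast
    have rel: "3 * pb \<Phi> be 0 y * (m (\<Phi> z 0))\<^sup>2
        + (4 * pt \<Phi> be ta 0 y + 4 * (- ps \<Phi> si 1 y) * z + 2 * pb \<Phi> be 2 y * z\<^sup>2) * m (\<Phi> z 0)
        + (4 * (- ps \<Phi> si 1 y) + 4 * pb \<Phi> be 2 y * z) * M z
      = C' + (8 * pe \<Phi> si de 1 y) * z + (- 4 * pt \<Phi> be ta 2 y) * z\<^sup>2 + (4 / 3 * ps \<Phi> si 3 y) * z ^ 3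
        + (- 1 / 3 * pb \<Phi> be 4 y) * z ^ 4" if "\<bar>z\<bar> < d" for z
      using C'[OF that] by (simp add: algebra_simps)
    note u = pr.relation_unique[OF rel]
    show ?thesis using u(1) u(2) u(3) by auto
  qed
  have hom: "f (\<Phi> 0 y) = f (\<Phi> 0 0) * exp (k * y)" if f: "homogeneous k f" and y: "\<bar>y\<bar> < d" for f k y
    by (rule exp_ode[of d "\<lambda>y. f (\<Phi> 0 y)", OF _ y])
      (use c(4)[OF homogeneous_imp_smooth[OF f] z0] homogeneousD[OF f c(2)[OF z0]] in simp)
  have hr: "homogeneous 1 (\<lambda>x. rho x * f x)" if "homogeneous (-1) f" for f
    using homogeneous_mult[OF homogeneous_rho that] by simp
  have int: "frame_integral (\<lambda>x. be x + a * be0 x + b * (rho x * be0 x))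
      (\<lambda>x. si x + a * si0 x + b * (- (rho x * si0 x))) (\<lambda>x. ta x + a * ta0 x + b * (rho x * ta0 x))
      (\<lambda>x. de x + a * de0 x + b * (- (rho x * de0 x)))" for a b
    by (rule frame_integral_lincomb[OF frame_integral_lincomb[OF J frame_integral_web] frame_integral_reflected])
  have pbt: "pb \<Phi> (\<lambda>x. be x + a * be0 x + b * (rho x * be0 x)) 0 y = pb \<Phi> be 0 y + a * b0 * exp (- y) + b * (r0 * b0) * exp y"
    if y: "\<bar>y\<bar> < d" for a b y
    unfolding pdefs(1)[OF J] pdefs(1)[OF int] using hom[OF homogeneous_web(1) y] hom[OF hr[OF homogeneous_web(1)] y]
    by (simp add: b0_def r0_def)
  have pst: "ps \<Phi> (\<lambda>x. si x + a * si0 x + b * (- (rho x * si0 x))) 1 y = ps \<Phi> si 1 y - a * s0 * exp (- y) - b * (r0 * s0) * exp y"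
    if y: "\<bar>y\<bar> < d" for a b y
  proof -
    let ?x = "\<Phi> 0 y"
    have x: "?x \<in> U" by (rule c(2)[OF z0 y])
    note sm = frame_integral_smooth[OF J] homogeneous_imp_smooth[OF homogeneous_web(2)] homogeneous_imp_smooth[OF hr[OF homogeneous_web(2)]]
      smooth_on_const[OF open_U]
    have "Y (\<lambda>x. si x + a * si0 x + b * (- (rho x * si0 x))) ?x
      = Y si ?x + a * Y si0 ?x - b * Y (\<lambda>x. rho x * si0 x) ?x"
      unfolding Y_add[OF smooth_on_add[OF open_U sm(2) smooth_on_mult[OF open_U sm(7,5)]]
          smooth_on_mult[OF open_U sm(7) smooth_on_uminus[OF open_U sm(6)]] x]
        Y_add[OF sm(2) smooth_on_mult[OF open_U sm(7,5)] x] Y_mult[OF sm(7,5) x]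
        Y_mult[OF sm(7) smooth_on_uminus[OF open_U sm(6)] x] Y_uminus[OF sm(6,6) x] Y_const by simp
    also have "\<dots> = Y si ?x - a * (s0 * exp (- y)) - b * (r0 * s0 * exp y)"
      unfolding homogeneousD[OF homogeneous_web(2) x] homogeneousD[OF hr[OF homogeneous_web(2)] x]
      using hom[OF homogeneous_web(2) y] hom[OF hr[OF homogeneous_web(2)] y] by (simp add: s0_def r0_def)
    finally show ?thesis unfolding pdefs(2)[OF J] pdefs(2)[OF int] by (simp add: mult.assoc)
  qed
  have Dp: "(pb \<Phi> be i has_real_derivative pb \<Phi> be (Suc i) y) (at y)"
    "(ps \<Phi> si i has_real_derivative ps \<Phi> si (Suc i) y) (at y)"
    if "frame_integral be si ta de" "\<bar>y\<bar> < d" for be si ta de i y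
    by (rule DERIV_p(1)[OF ch M0 M that], assumption) (rule DERIV_p(2)[OF ch M0 M that])
  have step: "g y = 0" if "\<And>y. \<bar>y\<bar> < d \<Longrightarrow> f y = 0" "(f has_real_derivative g y) (at y)" "\<bar>y\<bar> < d" for f g y
    by (rule DERIV_unique_on_interval[of d f "\<lambda>_. 0", OF that(1,3,2) DERIV_const])
  have pb2: "pb \<Phi> be 2 y = 0" if J: "frame_integral be si ta de" and z: "\<And>y. \<bar>y\<bar> < d \<Longrightarrow> pb \<Phi> be 0 y = 0"
    and y: "\<bar>y\<bar> < d" for be si ta de y
  proof -
    have 1: "pb \<Phi> be 1 y = 0" if y: "\<bar>y\<bar> < d" for y
      using step[where f="pb \<Phi> be 0" and g="pb \<Phi> be (Suc 0)", OF z Dp(1)[OF J y] y] by simp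
    show ?thesis
      using step[where f="pb \<Phi> be 1" and g="pb \<Phi> be (Suc 1)", OF 1 Dp(1)[OF J y] y] by (simp add: numeral_2_eq_2)
  qed
  have "\<exists>a b. \<forall>y. \<bar>y\<bar> < d \<longrightarrow> pb \<Phi> (\<lambda>x. be x + a * be0 x + b * (rho x * be0 x)) 0 y = 0
      \<and> ps \<Phi> (\<lambda>x. si x + a * si0 x + b * (- (rho x * si0 x))) 1 y = 0"
  proof (cases "b0 = 0")
    case False
    have "pb \<Phi> be 0 y = (pb \<Phi> be 0 0 - pb \<Phi> be 1 0) / 2 * exp (- y) + (pb \<Phi> be 0 0 + pb \<Phi> be 1 0) / 2 * exp y"
      if y: "\<bar>y\<bar> < d" for y
    proof (rule second_order_ode[OF _ _ y])
      fix y assume y: "\<bar>y\<bar> < d"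
      show "(pb \<Phi> be 0 has_real_derivative pb \<Phi> be 1 y) (at y)"
        using Dp(1)[OF J y, of 0] by simp
      show "(pb \<Phi> be 1 has_real_derivative pb \<Phi> be 0 y) (at y)"
        using Dp(1)[OF J y, of 1] ratio[OF J y] False by (simp add: numeral_2_eq_2)
    qed
    then obtain A B where AB: "\<And>y. \<bar>y\<bar> < d \<Longrightarrow> pb \<Phi> be 0 y = A * exp (- y) + B * exp y" by blast
    \<comment> \<open>Chosen to cancel the two exponentials: \<open>be0\<close> varies like
      \<open>exp (- y)\<close> and \<open>rho * be0\<close> like \<open>exp y\<close>.\<close>
    define a b where "a = - A / b0" and "b = - B / (r0 * b0)"
    have z: "pb \<Phi> (\<lambda>x. be x + a * be0 x + b * (rho x * be0 x)) 0 y = 0" if y: "\<bar>y\<bar> < d" for y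
      unfolding pbt[OF y] AB[OF y] using False r0 by (simp add: a_def b_def)
    moreover have "ps \<Phi> (\<lambda>x. si x + a * si0 x + b * (- (rho x * si0 x))) 1 y = 0" if y: "\<bar>y\<bar> < d" for y
      using ratio[OF int[of a b] y] z[OF y] False by simp
    ultimately show ?thesis by blast
  next
    case True
    then have s0: "s0 \<noteq> 0" using nz by simp
    have zb: "pb \<Phi> be 0 y = 0" if "\<bar>y\<bar> < d" for y using ratio[OF J that] True by blast
    have ps3: "ps \<Phi> si 3 y = ps \<Phi> si 1 y" if y: "\<bar>y\<bar> < d" for y
      using ratio[OF J y] True pb2[OF J zb y] by blast
    have "ps \<Phi> si 1 y = (ps \<Phi> si 1 0 - ps \<Phi> si 2 0) / 2 * exp (- y) + (ps \<Phi> si 1 0 + ps \<Phi> si 2 0) / 2 * exp y"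
      if y: "\<bar>y\<bar> < d" for y
    proof (rule second_order_ode[OF _ _ y])
      fix y assume y: "\<bar>y\<bar> < d"
      show "(ps \<Phi> si 1 has_real_derivative ps \<Phi> si 2 y) (at y)"
        using Dp(2)[OF J y, of 1] by (simp add: numeral_2_eq_2)
      show "(ps \<Phi> si 2 has_real_derivative ps \<Phi> si 1 y) (at y)"
        using Dp(2)[OF J y, of 2] ps3[OF y] by (simp add: numeral_2_eq_2 numeral_3_eq_3)
    qed
    then obtain A B where AB: "\<And>y. \<bar>y\<bar> < d \<Longrightarrow> ps \<Phi> si 1 y = A * exp (- y) + B * exp y" by blast
    \<comment> \<open>The signs are opposite to those of the other case: for \<open>a\<close> since
      \<open>ps 1\<close> is a first derivative and \<open>Y si0\<close> is \<open>- si0\<close>,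
      for \<open>b\<close> since the reflected integral has the coefficient
      \<open>- (rho * si0)\<close>.\<close>
    define a b where "a = A / s0" and "b = B / (r0 * s0)"
    have "pb \<Phi> (\<lambda>x. be x + a * be0 x + b * (rho x * be0 x)) 0 y = 0" if y: "\<bar>y\<bar> < d" for y
      unfolding pbt[OF y] zb[OF y] True by simp
    moreover have "ps \<Phi> (\<lambda>x. si x + a * si0 x + b * (- (rho x * si0 x))) 1 y = 0" if y: "\<bar>y\<bar> < d" for y
      unfolding pst[OF y] AB[OF y] using s0 r0 by (simp add: a_def b_def)
    ultimately show ?thesis by blast
  qed
  then obtain a b where zb: "\<And>y. \<bar>y\<bar> < d \<Longrightarrow> pb \<Phi> (\<lambda>x. be x + a * be0 x + b * (rho x * be0 x)) 0 y = 0"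
    and zs: "\<And>y. \<bar>y\<bar> < d \<Longrightarrow> ps \<Phi> (\<lambda>x. si x + a * si0 x + b * (- (rho x * si0 x))) 1 y = 0" by blast
  \<comment> \<open>The relation of the corrected integral is again proportional to that of
    \<open>web\<close>, so the vanishing of its leading coefficient, or of the next one if
    \<open>b0 = 0\<close>, carries over to the third.\<close>
  have zt: "pt \<Phi> (\<lambda>x. be x + a * be0 x + b * (rho x * be0 x)) (\<lambda>x. ta x + a * ta0 x + b * (rho x * ta0 x)) 0 y = 0"
    if y: "\<bar>y\<bar> < d" for y
  proof (cases "b0 = 0")
    case False
    then show ?thesis using ratio[OF int[of a b] y] zb[OF y] by simp
  next
    case True
    then show ?thesis
      using ratio[OF int[of a b] y] pb2[OF int[of a b] zb y] zs[OF y] nz by simp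
  qed
  obtain c e where "\<And>z y. \<bar>z\<bar> < d \<Longrightarrow> \<bar>y\<bar> < d \<Longrightarrow>
      be (\<Phi> z y) + a * be0 (\<Phi> z y) + b * (rho (\<Phi> z y) * be0 (\<Phi> z y)) = 0 \<and>
      si (\<Phi> z y) + a * si0 (\<Phi> z y) + b * (- (rho (\<Phi> z y) * si0 (\<Phi> z y))) = c \<and>
      ta (\<Phi> z y) + a * ta0 (\<Phi> z y) + b * (rho (\<Phi> z y) * ta0 (\<Phi> z y)) = 0 \<and>
      de (\<Phi> z y) + a * de0 (\<Phi> z y) + b * (- (rho (\<Phi> z y) * de0 (\<Phi> z y))) = c * m (\<Phi> z y) + e"
    using remainder[OF ch M0 M int[of a b] zb zs zt] by blast
  then show thesis by (rule that)
qed

text \<open>The difference between the integral and its local combination is itself an integral on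
  all of \<open>U\<close>; it vanishes on one chart, hence everywhere.\<close>

lemma cubic_integral_is_combination:
  assumes ch: "chart d \<Phi>" and M0: "M 0 = 0"
    and M: "\<And>z. \<bar>z\<bar> < d \<Longrightarrow> (M has_real_derivative m (\<Phi> z 0)) (at z)"
    and nc: "\<not> (\<exists>A. degree A \<le> 3 \<and> (\<forall>z. \<bar>z\<bar> < d \<longrightarrow> M z = poly A z))"
    and J: "frame_integral be si ta de"
  shows "\<exists>a b c e. cubic be si ta de = combination a b c e"
proof -
  obtain a b c e where loc: "\<And>z y. \<bar>z\<bar> < d \<Longrightarrow> \<bar>y\<bar> < d \<Longrightarrow>
      be (\<Phi> z y) + a * be0 (\<Phi> z y) + b * (rho (\<Phi> z y) * be0 (\<Phi> z y)) = 0 \<and>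
      si (\<Phi> z y) + a * si0 (\<Phi> z y) + b * (- (rho (\<Phi> z y) * si0 (\<Phi> z y))) = c \<and>
      ta (\<Phi> z y) + a * ta0 (\<Phi> z y) + b * (rho (\<Phi> z y) * ta0 (\<Phi> z y)) = 0 \<and>
      de (\<Phi> z y) + a * de0 (\<Phi> z y) + b * (- (rho (\<Phi> z y) * de0 (\<Phi> z y))) = c * m (\<Phi> z y) + e"
    using local_combination[OF ch M0 M nc J] by blast
  note ints = frame_integral_lincomb[OF frame_integral_lincomb[OF frame_integral_lincomb[OF
        frame_integral_lincomb[OF J frame_integral_web, of a] frame_integral_reflected, of b]
        frame_integral_energy, of "- c"] frame_integral_killing, of "- e"]
  let ?V = "(\<lambda>(z, y). \<Phi> z y) ` ({-d<..<d} \<times> {-d<..<d})"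
  have "be x + a * be0 x + b * (rho x * be0 x) = 0 \<and> si x + a * si0 x + b * (- (rho x * si0 x)) = c \<and>
      ta x + a * ta0 x + b * (rho x * ta0 x) = 0 \<and> de x + a * de0 x + b * (- (rho x * de0 x)) = c * m x + e"
    if x: "x \<in> U" for x
  proof -
    have "be x + a * be0 x + b * (rho x * be0 x) + - c * 0 + - e * 0 = 0 \<and>
      si x + a * si0 x + b * (- (rho x * si0 x)) + - c * 1 + - e * 0 = 0 \<and>
      ta x + a * ta0 x + b * (rho x * ta0 x) + - c * 0 + - e * 0 = 0 \<and>
      de x + a * de0 x + b * (- (rho x * de0 x)) + - c * m x + - e * 1 = 0"
    proof (rule unique_continuation[OF ints _ _ _ _ x])
      show "open ?V" by (rule chartD(7)[OF ch])
      show "?V \<subseteq> U" using chartD(2)[OF ch] by (auto simp: abs_less_iff)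
      show "?V \<noteq> {}" using chartD(1)[OF ch] by (auto simp: abs_less_iff)
      fix x assume "x \<in> ?V"
      then obtain z y where zy: "z \<in> {-d<..<d}" "y \<in> {-d<..<d}" and x: "x = \<Phi> z y" by auto
      then have "\<bar>z\<bar> < d" "\<bar>y\<bar> < d" by (simp_all add: abs_less_iff)
      then show "be x + a * be0 x + b * (rho x * be0 x) + - c * 0 + - e * 0 = 0 \<and>
        si x + a * si0 x + b * (- (rho x * si0 x)) + - c * 1 + - e * 0 = 0 \<and>
        ta x + a * ta0 x + b * (rho x * ta0 x) + - c * 0 + - e * 0 = 0 \<and>
        de x + a * de0 x + b * (- (rho x * de0 x)) + - c * m x + - e * 1 = 0"
        using loc[of z y] x by simp
    qed
    then show ?thesis by simp
  qed
  note eq = this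
  have "cubic be si ta de (x, y) = combination (- a) (- b) c e (x, y)" for x y
  proof (cases "x \<in> U")
    case True
    obtain p q where y: "y = (p, q)" by fastforce
    have "be x = - a * be0 x + - b * (rho x * be0 x)" "si x = - a * si0 x - - b * (rho x * si0 x) + c"
      "ta x = - a * ta0 x + - b * (rho x * ta0 x)" "de x = - a * de0 x - - b * (rho x * de0 x) + c * m x + e"
      using eq[OF True] by (simp_all add: algebra_simps)
    then show ?thesis unfolding combination_def y cubic_apply[OF True] by (simp only:)
  qed (simp add: combination_def cubic_outside)
  then have "cubic be si ta de = combination (- a) (- b) c e" by (intro ext) (metis prod.collapse)
  then show ?thesis by blast
qed

end

section \<open>Gauss curvature\<close>

text \<open>The second difference \<open>\<Delta>\<close> over a small square of side
  \<open>h\<close> is \<open>h^2\<close> times either mixed partial at some point of the square, by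
  the mean value theorem applied in either order. Continuity of both partials then rules out the gap
  \<open>2 * e\<close>.\<close>

lemma mixed_partials:
  assumes U: "open U" and f: "smooth_on f U" and x: "x \<in> U"
  shows "du (dv f) x = dv (du f) x"
proof (rule ccontr)
  assume ne: "du (dv f) x \<noteq> dv (du f) x"
  obtain u v where xuv: "x = (u, v)" by fastforce
  let ?a = "du (dv f)" and ?b = "dv (du f)"
  define e where "e = \<bar>?a x - ?b x\<bar> / 2"
  have e: "e > 0" using ne by (simp add: e_def)
  have "smooth_on ?a U" "smooth_on ?b U" by (intro smooth_on_du smooth_on_dv f)+
  then have "isCont ?a x" "isCont ?b x"
    by (simp_all add: continuous_on_eq_continuous_at[OF U, THEN iffD1, OF smooth_on_continuous_on, rule_format] x)
  then have c: "\<exists>r>0. \<forall>y. dist y x < r \<longrightarrow> dist (?a y) (?a x) < e" "\<exists>r>0. \<forall>y. dist y x < r \<longrightarrow> dist (?b y) (?b x) < e"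
    using e unfolding continuous_at_eps_delta by simp_all
  from c(1) obtain r1 where r1: "r1 > 0" "\<forall>y. dist y x < r1 \<longrightarrow> dist (?a y) (?a x) < e" by (elim exE conjE)
  from c(2) obtain r2 where r2: "r2 > 0" "\<forall>y. dist y x < r2 \<longrightarrow> dist (?b y) (?b x) < e" by (elim exE conjE)
  note r = r1(1) r1(2)[rule_format] r2(1) r2(2)[rule_format]
  obtain r3 where r3: "r3 > 0" "ball x r3 \<subseteq> U" using U x openE by blast
  define r where "r = min r1 (min r2 r3)"
  define h where "h = r / 3"
  have "r > 0" using r(1,3) r3(1) by (simp add: r_def)
  then have h: "h > 0" "2 * h < r" by (simp_all add: h_def)
  have near: "dist (s, t) x < r" if "u \<le> s" "s \<le> u + h" "v \<le> t" "t \<le> v + h" for s t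
  proof -
    have "dist (s, t) x \<le> \<bar>s - u\<bar> + \<bar>t - v\<bar>"
      using sqrt_sum_squares_le_sum_abs[of "s - u" "t - v"] by (simp add: xuv dist_Pair_Pair dist_real_def)
    also have "\<dots> \<le> h + h" using that by (intro add_mono) auto
    also have "\<dots> < r" using h by simp
    finally show ?thesis .
  qed
  have inU: "(s, t) \<in> U" if "u \<le> s" "s \<le> u + h" "v \<le> t" "t \<le> v + h" for s t
    using near[OF that] r3(2) by (auto simp: r_def dist_commute)
  note pf = smooth_on_partials[OF U f] and pu = smooth_on_partials[OF U smooth_on_du[OF f]]
    and pv = smooth_on_partials[OF U smooth_on_dv[OF f]]
  define \<Delta> where "\<Delta> = f (u + h, v + h) - f (u + h, v) - f (u, v + h) + f (u, v)"
  have "\<exists>s>u. s < u + h \<and> (f (u + h, v + h) - f (u + h, v)) - (f (u, v + h) - f (u, v))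
      = (u + h - u) * (du f (s, v + h) - du f (s, v))"
    by (rule MVT2[where f="\<lambda>s. f (s, v + h) - f (s, v)"]) (use h in \<open>auto intro!: DERIV_diff pf inU\<close>)
  then obtain s where s: "u < s" "s < u + h" "\<Delta> = h * (du f (s, v + h) - du f (s, v))"
    by (auto simp: \<Delta>_def algebra_simps)
  have "\<exists>t>v. t < v + h \<and> du f (s, v + h) - du f (s, v) = (v + h - v) * ?b (s, t)"
    by (rule MVT2[where f="\<lambda>t. du f (s, t)"]) (use h s in \<open>auto intro!: pu inU\<close>)
  then obtain t where t: "v < t" "t < v + h" "\<Delta> = h * (h * ?b (s, t))" using s(3) by auto
  have "\<exists>t'>v. t' < v + h \<and> (f (u + h, v + h) - f (u, v + h)) - (f (u + h, v) - f (u, v))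
      = (v + h - v) * (dv f (u + h, t') - dv f (u, t'))"
    by (rule MVT2[where f="\<lambda>t. f (u + h, t) - f (u, t)"]) (use h in \<open>auto intro!: DERIV_diff pf inU\<close>)
  then obtain t' where t': "v < t'" "t' < v + h" "\<Delta> = h * (dv f (u + h, t') - dv f (u, t'))"
    by (auto simp: \<Delta>_def algebra_simps)
  have "\<exists>s'>u. s' < u + h \<and> dv f (u + h, t') - dv f (u, t') = (u + h - u) * ?a (s', t')"
    by (rule MVT2[where f="\<lambda>s. dv f (s, t')"]) (use h t' in \<open>auto intro!: pv inU\<close>)
  then obtain s' where s': "u < s'" "s' < u + h" "\<Delta> = h * (h * ?a (s', t'))" using t'(3) by auto
  have "?a (s', t') = ?b (s, t)" using t(3) s'(3) h by simp
  moreover have "dist (?a (s', t')) (?a x) < e"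
    using near[of s' t'] s' t' by (intro r(2)) (auto simp: r_def)
  moreover have "dist (?b (s, t)) (?b x) < e"
    using near[of s t] s t by (intro r(4)) (auto simp: r_def)
  ultimately have "\<bar>?a x - ?b x\<bar> < 2 * e" unfolding dist_real_def by linarith
  then show False by (simp add: e_def)
qed

text \<open>The second derivatives enter Brioschi's formula only through the argument \<open>s\<close>.\<close>

definition brioschi :: "real \<Rightarrow> real \<Rightarrow> real \<Rightarrow> real \<Rightarrow> real \<Rightarrow> real \<Rightarrow> real \<Rightarrow> real \<Rightarrow> real \<Rightarrow> real \<Rightarrow> real" where
  "brioschi e f g eu ev fu fv gu gv s =
    det3 (s, eu / 2, fu - ev / 2) (fv - gu / 2, e, f) (gv / 2, f, g)
      - det3 (0, ev / 2, gu / 2) (ev / 2, e, f) (gu / 2, f, g)"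

text \<open>The case u = 1, v = t. Euler's relations express the derivatives in u through those in
  v, after which the identity is polynomial in independent variables.\<close>

lemma brioschi_homogeneous_normalized:
  fixes e f g t ev fv gv evv fvv gvv :: real
  defines "eu \<equiv> - (2 * e + t * ev)" and "fu \<equiv> - (2 * f + t * fv)" and "gu \<equiv> - (2 * g + t * gv)"
    and "euv \<equiv> - (3 * ev + t * evv)" and "fuv \<equiv> - (3 * fv + t * fvv)" and "guv \<equiv> - (3 * gv + t * gvv)"
  defines "fuu \<equiv> - (3 * fu + t * fuv)" and "guu \<equiv> - (3 * gu + t * guv)"
  defines "nu \<equiv> (ev - fu) + t * (fv - gu)"
  shows "4 * (e + 2 * f * t + g * t\<^sup>2) * brioschi e f g eu ev fu fv gu gv (- evv / 2 + fuv - guu / 2)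
    = nu * (- (f + g * t) * (eu * g + e * gu - 2 * f * fu) + (e + f * t) * (ev * g + e * gv - 2 * f * fv))
      - 2 * (e * g - f\<^sup>2) * (- (f + g * t) * ((ev - fu) + (euv - fuu) + t * (fuv - guu))
        + (e + f * t) * ((evv - fuv) + (fv - gu) + t * (fvv - guv)))"
  unfolding brioschi_def det3_def assms by (simp add: field_simps power2_eq_square)

lemma brioschi_scale:
  "brioschi e f g (c * eu) (c * ev) (c * fu) (c * fv) (c * gu) (c * gv) (c\<^sup>2 * s)
    = c\<^sup>2 * brioschi e f g eu ev fu fv gu gv s"
  unfolding brioschi_def det3_def by (simp add: field_simps power2_eq_square)

text \<open>Multiplying every derivative by \<open>u\<close> to the power of its order reduces to u
  = 1 and t = v / u; \<open>brioschi_scale\<close> extracts the powers of \<open>u\<close>.\<close>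

lemma brioschi_homogeneous_aux:
  fixes e f g u v :: real
  assumes u: "u \<noteq> 0"
    and h: "u * eu + v * ev = - 2 * e" "u * fu + v * fv = - 2 * f" "u * gu + v * gv = - 2 * g"
    and h1: "u * euu + v * euv = - 3 * eu" "u * euv + v * evv = - 3 * ev"
      "u * fuu + v * fuv = - 3 * fu" "u * fuv + v * fvv = - 3 * fv"
      "u * guu + v * guv = - 3 * gu" "u * guv + v * gvv = - 3 * gv"
  shows "4 * (e * u\<^sup>2 + 2 * f * u * v + g * v\<^sup>2) * brioschi e f g eu ev fu fv gu gv (- evv / 2 + fuv - guu / 2)
    = (u * (ev - fu) + v * (fv - gu)) *
        (- (f * u + g * v) * (eu * g + e * gu - 2 * f * fu) + (e * u + f * v) * (ev * g + e * gv - 2 * f * fv))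
      - 2 * (e * g - f\<^sup>2) *
        (- (f * u + g * v) * ((ev - fu) + u * (euv - fuu) + v * (fuv - guu))
        + (e * u + f * v) * (u * (evv - fuv) + (fv - gu) + v * (fvv - guv)))"
proof -
  define t where "t = v / u"
  have v: "v = t * u" using u by (simp add: t_def)
  have s1: "- (2 * x + t * (u * xv)) = u * xu" if "u * xu + v * xv = - 2 * x" for x xu xv
    using that unfolding v by (simp add: algebra_simps)
  have s2: "- (3 * (u * xv) + t * (u\<^sup>2 * xvv)) = u\<^sup>2 * xuv" if "u * xuv + v * xvv = - 3 * xv" for xv xvv xuv
  proof -
    have "- (3 * (u * xv) + t * (u\<^sup>2 * xvv)) = u * (- 3 * xv - v * xvv)"
      unfolding v by (simp add: algebra_simps power2_eq_square)
    also have "- 3 * xv - v * xvv = u * xuv" using that by linarith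
    finally show ?thesis by (simp add: power2_eq_square)
  qed
  have N: "e * u\<^sup>2 + 2 * f * u * v + g * v\<^sup>2 = u\<^sup>2 * (e + 2 * f * t + g * t\<^sup>2)"
    unfolding v by (simp add: algebra_simps power2_eq_square)
  have arg: "- (u\<^sup>2 * evv) / 2 + u\<^sup>2 * fuv - u\<^sup>2 * guu / 2 = u\<^sup>2 * (- evv / 2 + fuv - guu / 2)"
    by (simp add: algebra_simps)
  note n = brioschi_homogeneous_normalized[where e=e and f=f and g=g and t=t and ev="u * ev" and fv="u * fv"
      and gv="u * gv" and evv="u\<^sup>2 * evv" and fvv="u\<^sup>2 * fvv" and gvv="u\<^sup>2 * gvv",
      unfolded s1[OF h(1)] s1[OF h(2)] s1[OF h(3)] s2[OF h1(2)] s2[OF h1(4)] s2[OF h1(6)]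
        s2[OF h1(1)] s2[OF h1(3)] s2[OF h1(5)], unfolded arg brioschi_scale]
  have l: "4 * (u\<^sup>2 * x) * y = 4 * x * (u\<^sup>2 * y)" for x y :: real by simp
  show ?thesis
    unfolding N l by (rule trans[OF n]) (simp add: v algebra_simps power2_eq_square)
qed

lemma brioschi_swap:
  "brioschi g f e gv gu fv fu ev eu s = brioschi e f g eu ev fu fv gu gv s"
  unfolding brioschi_def det3_def by (simp add: field_simps power2_eq_square)

text \<open>At u = 0 the two coordinates are exchanged, under which Brioschi's formula is
  symmetric.\<close>

lemma brioschi_homogeneous:
  fixes e f g u v :: real
  assumes uv: "u \<noteq> 0 \<or> v \<noteq> 0"
    and h: "u * eu + v * ev = - 2 * e" "u * fu + v * fv = - 2 * f" "u * gu + v * gv = - 2 * g"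
    and h1: "u * euu + v * euv = - 3 * eu" "u * euv + v * evv = - 3 * ev"
      "u * fuu + v * fuv = - 3 * fu" "u * fuv + v * fvv = - 3 * fv"
      "u * guu + v * guv = - 3 * gu" "u * guv + v * gvv = - 3 * gv"
  shows "4 * (e * u\<^sup>2 + 2 * f * u * v + g * v\<^sup>2) * brioschi e f g eu ev fu fv gu gv (- evv / 2 + fuv - guu / 2)
    = (u * (ev - fu) + v * (fv - gu)) *
        (- (f * u + g * v) * (eu * g + e * gu - 2 * f * fu) + (e * u + f * v) * (ev * g + e * gv - 2 * f * fv))
      - 2 * (e * g - f\<^sup>2) *
        (- (f * u + g * v) * ((ev - fu) + u * (euv - fuu) + v * (fuv - guu))
        + (e * u + f * v) * (u * (evv - fuv) + (fv - gu) + v * (fvv - guv)))"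
proof (cases "u = 0")
  case False
  then show ?thesis by (rule brioschi_homogeneous_aux[OF _ h h1])
next
  case True
  then have v: "v \<noteq> 0" using uv by simp
  have c: "x + y = z \<Longrightarrow> y + x = z" for x y z :: real by simp
  note a = brioschi_homogeneous_aux[where u=v and v=u and e=g and f=f and g=e and eu=gv and ev=gu and fu=fv
      and fv=fu and gu=ev and gv=eu and euu=gvv and euv=guv and evv=guu and fuu=fvv and fuv=fuv and fvv=fuu
      and guu=evv and guv=euv and gvv=euu, OF v c[OF h(3)] c[OF h(2)] c[OF h(1)] c[OF h1(6)] c[OF h1(5)] c[OF h1(4)] c[OF h1(3)] c[OF h1(2)] c[OF h1(1)],
      unfolded brioschi_swap[where e=e and f=f and g=g and eu=eu and ev=ev and fu=fu and fv=fv and gu=gu and gv=gv]]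
  have arg: "- guu / 2 + fuv - evv / 2 = - evv / 2 + fuv - guu / 2" by simp
  have N: "e * u\<^sup>2 + 2 * f * u * v + g * v\<^sup>2 = g * v\<^sup>2 + 2 * f * v * u + e * u\<^sup>2" by simp
  show ?thesis
    unfolding N by (rule trans[OF a[unfolded arg]]) (simp add: True algebra_simps power2_eq_square)
qed

section \<open>Curvature in terms of \<open>m\<close>\<close>

context scale_invariant_metric
begin

text \<open>\<open>X\<close> is proportional to \<open>Z\<close> but free of the square root \<open>R\<close>.\<close>

definition nu where "nu x = fst x * (dv E x - du F x) + snd x * (dv F x - du G x)"
definition X where "X f x = - (F x * fst x + G x * snd x) * du f x + (E x * fst x + F x * snd x) * dv f x"

lemma R_Z: "x \<in> U \<Longrightarrow> R x * Z f x = N x * X f x"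
  unfolding Z_def X_def R_n1[symmetric] R_n2[symmetric] by (simp add: algebra_simps)

lemma first_order_homogeneity:
  assumes "homogeneous k f" "x \<in> U"
  shows "fst x * du f x + snd x * dv f x = k * f x"
  using homogeneousD[OF assms] by (simp add: Y_def)

lemma second_order_homogeneity:
  assumes f: "homogeneous k f" and x: "x \<in> U"
  shows "fst x * du (du f) x + snd x * du (dv f) x = (k - 1) * du f x"
    and "fst x * du (dv f) x + snd x * dv (dv f) x = (k - 1) * dv f x"
proof -
  note sm = homogeneous_imp_smooth[OF f] smooth_on_du[OF homogeneous_imp_smooth[OF f]]
    smooth_on_dv[OF homogeneous_imp_smooth[OF f]] smooth_on_fst[OF open_U] smooth_on_snd[OF open_U]
    smooth_on_const[OF open_U, of k]
  have l: "du (Y f) x = du f x + fst x * du (du f) x + snd x * du (dv f) x"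
    "dv (Y f) x = dv f x + fst x * dv (du f) x + snd x * dv (dv f) x"
    unfolding Y_def[abs_def] du_dv_add[OF open_U smooth_on_mult[OF open_U sm(4,2)] smooth_on_mult[OF open_U sm(5,3)] x]
      du_dv_mult[OF open_U sm(4,2) x] du_dv_mult[OF open_U sm(5,3) x] du_dv_fst du_dv_snd by simp_all
  have "du (Y f) x = du (\<lambda>x. k * f x) x" "dv (Y f) x = dv (\<lambda>x. k * f x) x"
    by (rule du_dv_cong[OF open_U x homogeneousD[OF f] smooth_on_mult[OF open_U sm(6,1)]], assumption)+
  then have r: "du (Y f) x = k * du f x" "dv (Y f) x = k * dv f x"
    unfolding du_dv_mult[OF open_U sm(6,1) x] du_dv_const by simp_all
  show "fst x * du (du f) x + snd x * du (dv f) x = (k - 1) * du f x"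
    using l(1) r(1) by (simp add: algebra_simps)
  show "fst x * du (dv f) x + snd x * dv (dv f) x = (k - 1) * dv f x"
    using l(2) r(2) mixed_partials[OF open_U sm(1) x] by (simp add: algebra_simps)
qed

text \<open>Up to sign, \<open>nu\<close> is the curl of the one-form dual to the Killing field K.
  That form is invariant under the flow of K, so by Cartan's formula the differential of its value
  \<open>N\<close> on K is minus the contraction of its exterior derivative with K.\<close>

lemma partials_N:
  assumes x: "x \<in> U"
  shows "du N x = - (snd x * nu x)" "dv N x = fst x * nu x"
proof -
  obtain u v where xuv: "x = (u, v)" by fastforce
  have xU: "(u, v) \<in> U" using x xuv by simp
  note pb = smooth_on_partials[OF open_U _ xU]
  have N: "((\<lambda>t. N (t, v)) has_real_derivative du E x * u\<^sup>2 + 2 * du F x * u * v + du G x * v\<^sup>2 + 2 * E x * u + 2 * F x * v) (at u)"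
    "((\<lambda>t. N (u, t)) has_real_derivative dv E x * u\<^sup>2 + 2 * dv F x * u * v + dv G x * v\<^sup>2 + 2 * F x * u + 2 * G x * v) (at v)"
    unfolding N_def xuv by (auto intro!: derivative_eq_intros pb smooth_EFG simp: algebra_simps)
  note h = homogeneous_EFG[THEN first_order_homogeneity, OF xU]
  have "du N x = - (v * nu x) + u * (u * du E x + v * dv E x + 2 * E x) + v * (u * du F x + v * dv F x + 2 * F x)"
    using du_eqI[OF N(1)] unfolding xuv nu_def by (simp add: algebra_simps power2_eq_square)
  then show "du N x = - (snd x * nu x)" using h by (simp add: xuv)
  have "dv N x = u * nu x + u * (u * du F x + v * dv F x + 2 * F x) + v * (u * du G x + v * dv G x + 2 * G x)"
    using dv_eqI[OF N(2)] unfolding xuv nu_def by (simp add: algebra_simps power2_eq_square)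
  then show "dv N x = fst x * nu x" using h by (simp add: xuv)
qed

lemma X_N: "x \<in> U \<Longrightarrow> X N x = N x * nu x"
  unfolding X_def partials_N by (simp add: N_def algebra_simps power2_eq_square)

lemma smooth_nu: "smooth_on nu U"
  unfolding nu_def[abs_def] by (intro smooth_ring smooth_on_du smooth_on_dv smooth_EFG)

lemma R_Z_m:
  assumes x: "x \<in> U"
  shows "R x * Z m x = - nu x"
proof -
  have N: "N x > 0" by (rule N_pos[OF x])
  have "Z (\<lambda>x. m x * N x) x = Z (\<lambda>_. 1) x"
    using du_dv_cong[OF open_U x, of "\<lambda>x. m x * N x" "\<lambda>_. 1"] m_N smooth_on_const[OF open_U]
    by (simp add: Z_def)
  then have "Z m x * N x + m x * Z N x = 0"
    unfolding Z_mult[OF smooth_frame(6,5) x] Z_const .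
  then have "R x * (Z m x * N x + m x * Z N x) = 0" by simp
  then have "N x * (R x * Z m x) + m x * (R x * Z N x) = 0" by (simp add: algebra_simps)
  then have "N x * (R x * Z m x) + (m x * N x) * (N x * nu x) = 0"
    unfolding R_Z[OF x] X_N[OF x] by (simp add: algebra_simps)
  then have "N x * (R x * Z m x + nu x) = 0" unfolding m_N[OF x] by (simp add: algebra_simps)
  then show ?thesis using N by simp
qed

text \<open>\<open>Z\<close> contains the root \<open>R\<close>. Differentiating
  \<open>R * Z m = - nu\<close> and \<open>R^2 = D N\<close> and multiplying by powers of
  \<open>R\<close> leaves only the root-free operator \<open>X\<close>.\<close>

lemma Z_Z_m:
  assumes x: "x \<in> U"
  shows "2 * (D x)\<^sup>2 * Z (Z m) x = nu x * X D x - 2 * D x * X nu x + D x * (nu x)\<^sup>2"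
proof -
  have pos: "D x > 0" "N x > 0" "R x > 0" using D_pos N_pos R_pos x by blast+
  note sm = smooth_Z[OF smooth_frame(6)]
  have "Z (\<lambda>x. R x * Z m x) x = Z (\<lambda>x. - nu x) x"
    using du_dv_cong[OF open_U x R_Z_m smooth_on_uminus[OF open_U smooth_nu]] by (simp add: Z_def)
  then have 1: "Z R x * Z m x + R x * Z (Z m) x = - Z nu x"
    unfolding Z_mult[OF smooth_frame(7) sm x] Z_uminus[OF smooth_nu smooth_nu x] .
  have "Z (\<lambda>x. R x * R x) x = Z (\<lambda>x. D x * N x) x"
    using du_dv_cong[OF open_U x, of "\<lambda>x. R x * R x" "\<lambda>x. D x * N x"] R_sq
      smooth_on_mult[OF open_U smooth_frame(4,5)] by (simp add: Z_def power2_eq_square)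
  then have 2: "2 * R x * Z R x = Z D x * N x + D x * Z N x"
    unfolding Z_mult[OF smooth_frame(7,7) x] Z_mult[OF smooth_frame(4,5) x] by simp
  define rr where "rr = R x"
  have rr: "rr * rr = D x * N x" using R_sq[OF x] by (simp add: rr_def power2_eq_square)
  have Zs: "rr * Z m x = - nu x" "rr * Z nu x = N x * X nu x" "rr * Z D x = N x * X D x" "rr * Z N x = N x * (N x * nu x)"
    using R_Z_m[OF x] R_Z[OF x] X_N[OF x] by (simp_all add: rr_def)
  have "2 * (rr * rr) * (rr * rr) * Z (Z m) x
    = 2 * (rr * rr) * rr * (Z R x * Z m x + rr * Z (Z m) x) - (2 * rr * Z R x) * rr * (rr * Z m x)"
    by (simp add: algebra_simps)
  also have "\<dots> = - (2 * (rr * rr) * (rr * Z nu x)) + (N x * (rr * Z D x) + D x * (rr * Z N x)) * nu x"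
    unfolding 1[folded rr_def] 2[folded rr_def] Zs(1) by (simp add: algebra_simps)
  also have "\<dots> = - (2 * (D x * N x) * (N x * X nu x)) + (N x * (N x * X D x) + D x * (N x * (N x * nu x))) * nu x"
    unfolding Zs rr ..
  finally have "(N x * N x) * (2 * (D x)\<^sup>2 * Z (Z m) x) = (N x * N x) * (nu x * X D x - 2 * D x * X nu x + D x * (nu x)\<^sup>2)"
    unfolding rr by (simp add: algebra_simps power2_eq_square)
  then show ?thesis using pos by simp
qed

text \<open>The curvature formula of dz^2 / m^2 + dy^2 / m. It is verified in the original
  coordinates, where homogeneity makes Brioschi's expression a combination of \<open>X D\<close> and
  \<open>X nu\<close>, so that no change of coordinates in the second derivatives is carried
  out.\<close>

lemma curvature_frame:
  assumes x: "x \<in> U"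
  shows "gauss_curvature E F G x = m x * Z (Z m) x / 2 - (Z m x)\<^sup>2 / 4"
proof -
  obtain u v where xuv: "x = (u, v)" by fastforce
  have pos: "D x > 0" "N x > 0" "R x > 0" using D_pos N_pos R_pos x by blast+
  define B where "B = brioschi (E x) (F x) (G x) (du E x) (dv E x) (du F x) (dv F x) (du G x) (dv G x)
    (- dv (dv E) x / 2 + du (dv F) x - du (du G) x / 2)"
  have gc: "gauss_curvature E F G x = B / (D x)\<^sup>2"
    by (simp add: gauss_curvature_def B_def brioschi_def D_def mixed_partials[OF open_U smooth_EFG(2) x])
  have uv: "u \<noteq> 0 \<or> v \<noteq> 0" using origin_notin x xuv by auto
  note h1 = homogeneous_EFG[THEN first_order_homogeneity, OF x, unfolded xuv fst_conv snd_conv]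
  have h2: "fst x * du (du f) x + snd x * du (dv f) x = - 3 * du f x"
    "fst x * du (dv f) x + snd x * dv (dv f) x = - 3 * dv f x" if "homogeneous (-2) f" for f
    using second_order_homogeneity[OF that x] by simp_all
  note h2' = h2[unfolded xuv fst_conv snd_conv]
  have XD: "X D x = - (F x * u + G x * v) * (du E x * G x + E x * du G x - 2 * F x * du F x)
      + (E x * u + F x * v) * (dv E x * G x + E x * dv G x - 2 * F x * dv F x)"
  proof -
    have "du D x = du E x * G x + E x * du G x - 2 * F x * du F x" "dv D x = dv E x * G x + E x * dv G x - 2 * F x * dv F x"
      unfolding D_def[abs_def] power2_eq_square
        du_dv_diff[OF open_U smooth_on_mult[OF open_U smooth_EFG(1,3)] smooth_on_mult[OF open_U smooth_EFG(2,2)] x]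
        du_dv_mult[OF open_U smooth_EFG(1,3) x] du_dv_mult[OF open_U smooth_EFG(2,2) x] by simp_all
    then show ?thesis by (simp add: X_def xuv)
  qed
  have Xnu: "X nu x = - (F x * u + G x * v) * ((dv E x - du F x) + u * (du (dv E) x - du (du F) x) + v * (du (dv F) x - du (du G) x))
      + (E x * u + F x * v) * (u * (dv (dv E) x - du (dv F) x) + (dv F x - du G x) + v * (dv (dv F) x - du (dv G) x))"
  proof -
    note s = smooth_EFG[THEN smooth_on_du] smooth_EFG[THEN smooth_on_dv]
    note d = smooth_on_diff[OF open_U s(4,2)] smooth_on_diff[OF open_U s(5,3)]
    note f = smooth_on_fst[OF open_U] smooth_on_snd[OF open_U]
    have "du nu x = (dv E x - du F x) + u * (du (dv E) x - du (du F) x) + v * (du (dv F) x - du (du G) x)"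
      "dv nu x = u * (dv (dv E) x - du (dv F) x) + (dv F x - du G x) + v * (dv (dv F) x - du (dv G) x)"
      unfolding nu_def[abs_def] du_dv_add[OF open_U smooth_on_mult[OF open_U f(1) d(1)] smooth_on_mult[OF open_U f(2) d(2)] x]
        du_dv_mult[OF open_U f(1) d(1) x] du_dv_mult[OF open_U f(2) d(2) x]
        du_dv_diff[OF open_U s(4,2) x] du_dv_diff[OF open_U s(5,3) x] du_dv_fst du_dv_snd
        mixed_partials[OF open_U smooth_EFG(2) x] mixed_partials[OF open_U smooth_EFG(3) x]
      by (simp_all add: xuv)
    then show ?thesis by (simp add: X_def xuv)
  qed
  have "4 * N x * B = nu x * X D x - 2 * D x * X nu x"
    using brioschi_homogeneous[OF uv h1 h2'[OF homogeneous_EFG(1)] h2'[OF homogeneous_EFG(2)] h2'[OF homogeneous_EFG(3)]]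
    unfolding B_def XD Xnu unfolding xuv N_def D_def nu_def fst_conv snd_conv .
  then have key: "4 * N x * B = 2 * (D x)\<^sup>2 * Z (Z m) x - D x * (nu x)\<^sup>2"
    unfolding Z_Z_m[OF x] by simp
  have "(R x)\<^sup>2 * (Z m x)\<^sup>2 = (nu x)\<^sup>2"
    unfolding power_mult_distrib[symmetric] R_Z_m[OF x] by simp
  then have zm: "D x * N x * (Z m x)\<^sup>2 = (nu x)\<^sup>2" unfolding R_sq[OF x] .
  have "4 * N x * (D x)\<^sup>2 * (m x * Z (Z m) x / 2 - (Z m x)\<^sup>2 / 4)
    = 2 * (m x * N x) * (D x)\<^sup>2 * Z (Z m) x - D x * (D x * N x * (Z m x)\<^sup>2)"
    by (simp add: field_simps power2_eq_square)
  also have "\<dots> = 4 * N x * B" unfolding zm m_N[OF x] key by simp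
  finally have "(4 * N x) * ((D x)\<^sup>2 * (m x * Z (Z m) x / 2 - (Z m x)\<^sup>2 / 4)) = (4 * N x) * B"
    by (simp add: mult.assoc)
  then have "(D x)\<^sup>2 * (m x * Z (Z m) x / 2 - (Z m x)\<^sup>2 / 4) = B" using pos by simp
  then show ?thesis unfolding gc using pos by (simp add: field_simps)
qed

text \<open>Here \<open>m\<close> is a quadratic polynomial in z, and the curvature is -1/4 times
  its discriminant.\<close>

lemma cubic_primitive_imp_constant_curvature:
  assumes ch: "chart d \<Phi>"
    and M: "\<And>z. \<bar>z\<bar> < d \<Longrightarrow> (M has_real_derivative m (\<Phi> z 0)) (at z)" and M0: "M 0 = 0"
    and A: "degree A \<le> 3" "\<And>z. \<bar>z\<bar> < d \<Longrightarrow> M z = poly A z"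
  shows "\<exists>k. \<forall>z y. \<bar>z\<bar> < d \<longrightarrow> \<bar>y\<bar> < d \<longrightarrow> gauss_curvature E F G (\<Phi> z y) = k"
proof -
  define p where "p = pderiv A"
  have dp: "degree p \<le> 2" using A(1) by (simp add: p_def degree_pderiv)
  obtain c0 c1 c2 where p: "p = [:c0, c1, c2:]"
  proof -
    have "p = [:coeff p 0, coeff p 1, coeff p 2:]"
    proof (rule poly_eqI)
      fix n
      show "coeff p n = coeff [:coeff p 0, coeff p 1, coeff p 2:] n"
        using dp coeff_eq_0[of p n] by (cases "n \<le> 2") (auto simp: le_Suc_eq numeral_2_eq_2 coeff_pCons split: nat.split)
    qed
    then show thesis by (rule that)
  qed
  have m: "m (\<Phi> z y) = poly p z" if "\<bar>z\<bar> < d" "\<bar>y\<bar> < d" for z y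
  proof -
    have "m (\<Phi> z 0) = poly (pderiv A) z"
      by (rule DERIV_unique_on_interval[of d, OF A(2) that(1) M[OF that(1)] poly_DERIV])
    moreover have "m (\<Phi> z y) = m (\<Phi> z 0)" by (rule m_chart(1)[OF ch M0 M that])
    ultimately show ?thesis by (simp add: p_def)
  qed
  have Zm: "Z m (\<Phi> z y) = poly (pderiv p) z" if "\<bar>z\<bar> < d" "\<bar>y\<bar> < d" for z y
    by (rule DERIV_unique_on_interval[of d, OF m[OF _ that(2)] that(1)
          chartD(3)[OF ch smooth_frame(6) that] poly_DERIV])
  have ZZm: "Z (Z m) (\<Phi> z y) = poly (pderiv (pderiv p)) z" if "\<bar>z\<bar> < d" "\<bar>y\<bar> < d" for z y
    by (rule DERIV_unique_on_interval[of d, OF Zm[OF _ that(2)] that(1)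
          chartD(3)[OF ch smooth_Z[OF smooth_frame(6)] that] poly_DERIV])
  have "gauss_curvature E F G (\<Phi> z y) = c0 * c2 - c1\<^sup>2 / 4" if "\<bar>z\<bar> < d" "\<bar>y\<bar> < d" for z y
    unfolding curvature_frame[OF chartD(2)[OF ch that]] m[OF that] Zm[OF that] ZZm[OF that] p
    by (simp add: pderiv_pCons field_simps power2_eq_square)
  then show ?thesis by blast
qed

text \<open>If \<open>M\<close> were a polynomial of degree at most 3 in every chart, the curvature
  would be locally constant, hence constant. One such chart is enough, because integrals are
  determined by their restriction to it.\<close>

lemma nonconstant_curvature_chart:
  assumes "\<not> constant_curvature U E F G"
  obtains d \<Phi> M where "chart d \<Phi>" "M 0 = 0"
    "\<And>z. \<bar>z\<bar> < d \<Longrightarrow> (M has_real_derivative m (\<Phi> z 0)) (at z)"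
    "\<not> (\<exists>A. degree A \<le> 3 \<and> (\<forall>z. \<bar>z\<bar> < d \<longrightarrow> M z = poly A z))"
proof -
  have "\<exists>d \<Phi> M. chart d \<Phi> \<and> M 0 = 0 \<and> (\<forall>z. \<bar>z\<bar> < d \<longrightarrow> (M has_real_derivative m (\<Phi> z 0)) (at z))
    \<and> \<not> (\<exists>A. degree A \<le> 3 \<and> (\<forall>z. \<bar>z\<bar> < d \<longrightarrow> M z = poly A z))"
    (is "\<exists>d \<Phi> M. ?P d \<Phi> M")
  proof (rule ccontr)
    assume none: "\<not> (\<exists>d \<Phi> M. ?P d \<Phi> M)"
    let ?K = "gauss_curvature E F G"
    have loc: "eventually (\<lambda>b. ?K a = ?K b) (at a within U)" if a: "a \<in> U" for a
    proof -
      obtain d \<Phi> M where ch: "chart d \<Phi>" "\<Phi> 0 0 = a" "M 0 = 0"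
        and M: "\<And>z. \<bar>z\<bar> < d \<Longrightarrow> (M has_real_derivative m (\<Phi> z 0)) (at z)"
        using chart_primitive_exists[OF a] by metis
      obtain A where "degree A \<le> 3" "\<And>z. \<bar>z\<bar> < d \<Longrightarrow> M z = poly A z"
        using none[simplified not_ex, rule_format, of d \<Phi> M] ch M by blast
      from cubic_primitive_imp_constant_curvature[OF ch(1) M ch(3) this] obtain k
        where k: "\<And>z y. \<bar>z\<bar> < d \<Longrightarrow> \<bar>y\<bar> < d \<Longrightarrow> ?K (\<Phi> z y) = k" by blast
      let ?V = "(\<lambda>(z, y). \<Phi> z y) ` ({-d<..<d} \<times> {-d<..<d})"
      have V: "?K b = k" if bV: "b \<in> ?V" for b
      proof -
        obtain z y where "z \<in> {-d<..<d}" "y \<in> {-d<..<d}" "b = \<Phi> z y" using bV by auto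
        then show ?thesis using k[of z y] by (simp add: abs_less_iff)
      qed
      have aV: "a \<in> ?V" using ch(2) chartD(1)[OF ch(1)] by (intro image_eqI[of _ _ "(0, 0)"]) auto
      have "eventually (\<lambda>b. b \<in> ?V) (nhds a)"
        by (rule eventually_nhds_in_open[OF chartD(7)[OF ch(1)] aV])
      then have "eventually (\<lambda>b. ?K a = ?K b) (nhds a)"
        by (rule eventually_mono) (use V aV in simp)
      then show ?thesis by (simp add: eventually_at_filter eventually_mono)
    qed
    obtain x0 where x0: "x0 \<in> U" using U_nonempty by blast
    have "?K x = ?K x0" if "x \<in> U" for x
      by (rule connected_local_const[OF connected_U that x0]) (use loc in blast)
    then have "constant_curvature U E F G" unfolding constant_curvature_def by blast
    with assms show False by contradiction
  qed
  then show thesis using that by blast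
qed

section \<open>Dimension\<close>

lemma combination_apply:
  "x \<in> U \<Longrightarrow> combination a b c e (x, (p, q)) =
    (a * be0 x + b * (rho x * be0 x)) * (n1 x * p + n2 x * q) ^ 3
    + (a * si0 x - b * (rho x * si0 x) + c) * (n1 x * p + n2 x * q)\<^sup>2 * (fst x * p + snd x * q)
    + (a * ta0 x + b * (rho x * ta0 x)) * (n1 x * p + n2 x * q) * (fst x * p + snd x * q)\<^sup>2
    + (a * de0 x - b * (rho x * de0 x) + c * m x + e) * (fst x * p + snd x * q) ^ 3"
  unfolding combination_def by (rule cubic_apply)

lemma combination_lincomb:
  "combination (a + r * a') (b + r * b') (c + r * c') (e + r * e')
    = combination a b c e + phase_scale r (combination a' b' c' e')"
proof
  fix z :: phase
  obtain x p q where z: "z = (x, (p, q))" by (metis prod.collapse)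
  show "combination (a + r * a') (b + r * b') (c + r * c') (e + r * e') z
    = (combination a b c e + phase_scale r (combination a' b' c' e')) z"
  proof (cases "x \<in> U")
    case True
    then show ?thesis
      by (simp add: z plus_fun_def phase_scale_def combination_apply algebra_simps)
  qed (simp add: z plus_fun_def phase_scale_def combination_def cubic_outside)
qed

lemma combination_zero: "combination 0 0 0 0 = 0"
proof
  fix z :: phase
  obtain x p q where z: "z = (x, (p, q))" by (metis prod.collapse)
  show "combination 0 0 0 0 z = 0 z"
    by (cases "x \<in> U") (simp_all add: z zero_fun_def combination_apply, simp add: combination_def cubic_outside)
qed

lemma combination_cubic_integral: "combination a b c e \<in> cubic_integrals U E F G"
proof -
  have z: "frame_integral (\<lambda>_. 0) (\<lambda>_. 0) (\<lambda>_. 0) (\<lambda>_. 0)"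
    unfolding frame_integral_def by (simp add: smooth_on_const[OF open_U] Y_const Z_const)
  have "frame_integral (\<lambda>x. a * be0 x + b * (rho x * be0 x)) (\<lambda>x. a * si0 x - b * (rho x * si0 x) + c)
    (\<lambda>x. a * ta0 x + b * (rho x * ta0 x)) (\<lambda>x. a * de0 x - b * (rho x * de0 x) + c * m x + e)"
    using frame_integral_lincomb[OF frame_integral_lincomb[OF frame_integral_lincomb[OF
        frame_integral_lincomb[OF z frame_integral_web, of a] frame_integral_reflected, of b]
        frame_integral_energy, of c] frame_integral_killing, of e] by simp
  then show ?thesis unfolding combination_def by (rule frame_integral_imp_cubic_integral)
qed

lemma cubic_form_eq_0:
  fixes a b c d :: real
  assumes "\<And>w k. a * w ^ 3 + b * w\<^sup>2 * k + c * w * k\<^sup>2 + d * k ^ 3 = 0"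
  shows "a = 0 \<and> b = 0 \<and> c = 0 \<and> d = 0"
  using assms[of 1 0] assms[of 0 1] assms[of 1 1] assms[of 1 "-1"] by simp

text \<open>The nowhere vanishing coefficient \<open>be0\<close> or \<open>si0\<close> yields
  \<open>a + b * rho x = 0\<close>. Since \<open>Y\<close> doubles \<open>rho\<close>,
  differentiating along \<open>Y\<close> gives \<open>b = 0\<close>.\<close>

lemma combination_eq_0_imp:
  assumes "combination a b c e = 0"
  shows "a = 0 \<and> b = 0 \<and> c = 0 \<and> e = 0"
proof -
  have co: "a * be0 x + b * (rho x * be0 x) = 0 \<and> a * si0 x - b * (rho x * si0 x) + c = 0 \<and>
    a * ta0 x + b * (rho x * ta0 x) = 0 \<and> a * de0 x - b * (rho x * de0 x) + c * m x + e = 0" if x: "x \<in> U" for x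
  proof (rule cubic_form_eq_0)
    fix w k
    obtain p q where pq: "n1 x * p + n2 x * q = w" "fst x * p + snd x * q = k"
      using momenta_of_frame[OF x] by blast
    have "combination a b c e (x, (p, q)) = 0" using assms by (simp add: zero_fun_def)
    then show "(a * be0 x + b * (rho x * be0 x)) * w ^ 3 + (a * si0 x - b * (rho x * si0 x) + c) * w\<^sup>2 * k
      + (a * ta0 x + b * (rho x * ta0 x)) * w * k\<^sup>2 + (a * de0 x - b * (rho x * de0 x) + c * m x + e) * k ^ 3 = 0"
      unfolding combination_apply[OF x] pq .
  qed
  note smr = homogeneous_imp_smooth[OF homogeneous_rho]
  have h1: "homogeneous 1 (\<lambda>x. rho x * si0 x)"
    using homogeneous_mult[OF homogeneous_rho homogeneous_web(2)] by simp
  have ab: "a + b * rho x = 0" if x: "x \<in> U" for x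
  proof (cases rule: web_pivot)
    case be
    have "(a + b * rho x) * be0 x = 0" using co[OF x] by (simp add: algebra_simps)
    then show ?thesis using be x by simp
  next
    case si
    note sm = homogeneous_imp_smooth[OF homogeneous_web(2)] homogeneous_imp_smooth[OF h1]
    have s: "smooth_on (\<lambda>x. a * si0 x) U" "smooth_on (\<lambda>x. (- b) * (rho x * si0 x)) U" "smooth_on (\<lambda>_. c) U"
      by (intro smooth_on_mult[OF open_U] smooth_on_const[OF open_U] sm homogeneous_imp_smooth[OF homogeneous_web(2)] smr)+
    \<comment> \<open>The derivative along \<open>Y\<close> removes the constant \<open>c\<close>
      and, by the opposite weights, changes the relative sign of the other two terms.\<close>
    have "Y (\<lambda>x. a * si0 x + (- b) * (rho x * si0 x) + c) x = 0"
      by (rule Y_eq_0[OF smooth_on_add[OF open_U smooth_on_add[OF open_U s(1,2)] s(3)] x]) (use co in simp)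
    then have "a * Y si0 x + - b * Y (\<lambda>x. rho x * si0 x) x = 0"
      unfolding Y_add[OF smooth_on_add[OF open_U s(1,2)] s(3) x] Y_add[OF s(1,2) x] Y_const
        Y_mult[OF smooth_on_const[OF open_U] sm(1) x] Y_mult[OF smooth_on_const[OF open_U] sm(2) x] by simp
    then have "- (a * si0 x) - b * (rho x * si0 x) = 0"
      unfolding homogeneousD[OF homogeneous_web(2) x] homogeneousD[OF h1 x] by simp
    then have "(a + b * rho x) * si0 x = 0" by (simp add: algebra_simps)
    then show ?thesis using si x by simp
  qed
  obtain x where x: "x \<in> U" using U_nonempty by blast
  note s = smooth_on_mult[OF open_U smooth_on_const[OF open_U] smr]
  have "Y (\<lambda>x. a + b * rho x) x = 0"
    by (rule Y_eq_0[OF smooth_on_add[OF open_U smooth_on_const[OF open_U] s] x ab])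
  then have "b * (2 * rho x) = 0"
    unfolding Y_add[OF smooth_on_const[OF open_U] s x] Y_mult[OF smooth_on_const[OF open_U] smr x] Y_const
      homogeneousD[OF homogeneous_rho x] by simp
  then have b: "b = 0" using rho_nonzero[OF x] by simp
  then have a: "a = 0" using ab[OF x] by simp
  have "c = 0" using co[OF x] a b by simp
  then show ?thesis using co[OF x] a b by simp
qed

definition combinations where "combinations = {I. \<exists>a b c e. I = combination a b c e}"

lemma combinations_subspace: "phase.subspace combinations"
proof (rule phase.subspaceI)
  show "0 \<in> combinations" unfolding combinations_def using combination_zero by (metis (mono_tags) mem_Collect_eq)
  fix I J assume "I \<in> combinations" "J \<in> combinations"
  then obtain a b c e a' b' c' e' where "I = combination a b c e" "J = combination a' b' c' e'"
    unfolding combinations_def by blast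
  then have "I + J = combination (a + 1 * a') (b + 1 * b') (c + 1 * c') (e + 1 * e')"
    unfolding combination_lincomb by simp
  then show "I + J \<in> combinations" unfolding combinations_def by blast
next
  fix r I assume "I \<in> combinations"
  then obtain a b c e where "I = combination a b c e" unfolding combinations_def by blast
  then have "phase_scale r I = combination (0 + r * a) (0 + r * b) (0 + r * c) (0 + r * e)"
    unfolding combination_lincomb by (simp add: combination_zero)
  then show "phase_scale r I \<in> combinations" unfolding combinations_def by blast
qed

lemma combinations_dim: "phase.dim combinations = 4"
proof -
  define v1 v2 v3 v4 where "v1 = combination 1 0 0 0" and "v2 = combination 0 1 0 0"
    and "v3 = combination 0 0 1 0" and "v4 = combination 0 0 0 1"
  have eq: "combination a b c e = phase_scale a v1 + phase_scale b v2 + phase_scale c v3 + phase_scale e v4" for a b c e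
  proof -
    have step: "combination a' b' c' e' + phase_scale r (combination a'' b'' c'' e'')
      = combination (a' + r * a'') (b' + r * b'') (c' + r * c'') (e' + r * e'')" for r a' b' c' e' a'' b'' c'' e''
      by (simp only: combination_lincomb)
    have "phase_scale a v1 = combination 0 0 0 0 + phase_scale a v1" by (simp add: combination_zero)
    then show ?thesis unfolding v1_def v2_def v3_def v4_def by (simp add: step)
  qed
  have ind: "a = 0 \<and> b = 0 \<and> c = 0 \<and> e = 0"
    if "phase_scale a v1 + phase_scale b v2 + phase_scale c v3 + phase_scale e v4 = 0" for a b c e
    using combination_eq_0_imp that unfolding eq[symmetric] by blast
  have inj: "a = a' \<and> b = b' \<and> c = c' \<and> e = e'" if "combination a b c e = combination a' b' c' e'" for a b c e a' b' c' e'
  proof -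
    have "combination (a + -1 * a') (b + -1 * b') (c + -1 * c') (e + -1 * e') = 0"
      unfolding combination_lincomb that by (simp add: fun_eq_iff plus_fun_def phase_scale_def zero_fun_def)
    from combination_eq_0_imp[OF this] show ?thesis by simp
  qed
  have dist: "v1 \<noteq> v2" "v1 \<noteq> v3" "v1 \<noteq> v4" "v2 \<noteq> v3" "v2 \<noteq> v4" "v3 \<noteq> v4"
    unfolding v1_def v2_def v3_def v4_def by (auto dest: inj)
  let ?B = "{v1, v2, v3, v4}"
  show ?thesis
  proof (rule phase.dim_unique)
    show "?B \<subseteq> combinations" unfolding combinations_def v1_def v2_def v3_def v4_def by blast
    show "combinations \<subseteq> phase.span ?B"
    proof
      fix I assume "I \<in> combinations"
      then obtain a b c e where I: "I = combination a b c e" unfolding combinations_def by blast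
      show "I \<in> phase.span ?B"
        unfolding I eq by (intro phase.span_add phase.span_scale phase.span_base) auto
    qed
    show "card ?B = 4" using dist by simp
    show "phase.independent ?B"
    proof
      assume "phase.dependent ?B"
      then obtain r where r: "\<exists>v\<in>?B. r v \<noteq> 0" "(\<Sum>v\<in>?B. phase_scale (r v) v) = 0"
        using phase.dependent_finite[of ?B] by auto
      have "phase_scale (r v1) v1 + phase_scale (r v2) v2 + phase_scale (r v3) v3 + phase_scale (r v4) v4 = 0"
        using r(2) dist by (simp add: add.assoc)
      from ind[OF this] r(1) show False by auto
    qed
  qed
qed

text \<open>The Lie derivative of a quadratic form along the Euler field acts on each coefficient as
  \<open>Y\<close> plus 2, and the coefficients have degree -2.\<close>

lemma killing_field_scaling: "killing_field U E F G fst snd"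
proof -
  obtain x where x: "x \<in> U" using U_nonempty by blast
  then have "\<exists>x\<in>U. (fst x, snd x) \<noteq> (0, 0)" using origin_notin by (metis prod.collapse)
  moreover have "fst x * du f x + snd x * dv f x = - 2 * f x" if "homogeneous (-2) f" "x \<in> U" for f x
    using first_order_homogeneity[OF that] by simp
  note this[OF homogeneous_EFG(1)] this[OF homogeneous_EFG(2)] this[OF homogeneous_EFG(3)]
  ultimately show ?thesis
    unfolding killing_field_def du_dv_fst du_dv_snd
    by (simp add: smooth_on_fst[OF open_U] smooth_on_snd[OF open_U])
qed

lemma cubic_integrals_eq_combinations:
  assumes "\<not> constant_curvature U E F G"
  shows "cubic_integrals U E F G = combinations"
proof
  show "combinations \<subseteq> cubic_integrals U E F G"
    unfolding combinations_def using combination_cubic_integral by blast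
  obtain d \<Phi> M where ch: "chart d \<Phi>" "M 0 = 0"
    "\<And>z. \<bar>z\<bar> < d \<Longrightarrow> (M has_real_derivative m (\<Phi> z 0)) (at z)"
    "\<not> (\<exists>A. degree A \<le> 3 \<and> (\<forall>z. \<bar>z\<bar> < d \<longrightarrow> M z = poly A z))"
    using nonconstant_curvature_chart[OF assms] by metis
  show "cubic_integrals U E F G \<subseteq> combinations"
  proof
    fix I assume "I \<in> cubic_integrals U E F G"
    then obtain be si ta de where J: "frame_integral be si ta de" and I: "I = cubic be si ta de"
      by (rule cubic_integral_imp_frame_integral)
    show "I \<in> combinations"
      unfolding combinations_def I using cubic_integral_is_combination[OF ch J] by blast
  qed
qed

end

theorem proposition18:
  fixes U :: "(real \<times> real) set" and E F G :: "real \<times> real \<Rightarrow> real"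
  assumes "open U" "connected U" "U \<noteq> {}"
    and "is_metric U E F G"
    and "solves_system U E F G"
    and "invariant_under scaling_field U E F G"
  shows "(\<exists>a b. killing_field U E F G a b)
    \<and> (\<exists>S. S \<subseteq> cubic_integrals U E F G \<and> phase.subspace S \<and> phase.dim S = 4)
    \<and> (\<not> constant_curvature U E F G \<longrightarrow>
         phase.subspace (cubic_integrals U E F G) \<and> phase.dim (cubic_integrals U E F G) = 4)"
proof -
  interpret scale_invariant_metric U E F G by unfold_locales (fact assms)+
  have "combinations \<subseteq> cubic_integrals U E F G"
    unfolding combinations_def using combination_cubic_integral by blast
  then show ?thesis
    using killing_field_scaling combinations_subspace combinations_dim cubic_integrals_eq_combinations
    by (metis (no_types))
qed

end
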